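(* Let $\Omega\subset\mathbb{R}^3$ be a bounded, connected Lipschitz domain. Let $\lambda_1<\lambda_2\le\lambda_3\le\dots$ be the eigenvalues of the Dirichlet Laplacian $-\Delta_{\rm D}$ on $\Omega$ and $\alpha_1\le\alpha_2\le\dots$ the eigenvalues of the curl curl operator $C$, both counted with multiplicities. Then $$\alpha_{2k+1}\le\lambda_k\quad\text{for all }k\in\mathbb{N}.$$ If, in addition, for a given $k$ either $\lambda_k$ is a simple eigenvalue of $-\Delta_{\rm D}$, or $\partial\Omega$ contains three planar pieces (relatively open subsets of planes) whose normal vectors are linearly independent, then $\alpha_{2k+1}<\lambda_k$.
   Context: $\Omega\subset\mathbb{R}^3$ is a bounded, connected Lipschitz domain with outer unit normal $\nu$. $H(\operatorname{curl};\Omega)=\{u\in L^2(\Omega)^3:\operatorname{curl}u\in L^2(\Omega)^3\}$, $H(\operatorname{div}0;\Omega)=\{u\in L^2(\Omega)^3:\operatorname{div}u=0\}$; $H_0(\operatorname{curl};\Omega)=\{u\in H(\operatorname{curl};\Omega):u|_{\partial\Omega}\times\nu=0\}$, where the tangential trace $u|_{\partial\Omega}\times\nu\in H^{-1/2}(\partial\Omega)^3$ is the continuous extension from smooth fields. The curl curl operator $C$ is the self-adjoint operator in the Hilbert space $H(\operatorname{div}0;\Omega)$ (with the $L^2$ inner product) associated with the closed nonnegative form $(u,v)\mapsto\int_\Omega\operatorname{curl}u\cdot\operatorname{curl}v$ on $H_0(\operatorname{curl};\Omega)\cap H(\operatorname{div}0;\Omega)$; it has compact resolvent, and its eigenvalues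 $\alpha$ are the weak solutions of $\operatorname{curl}\operatorname{curl}u=\alpha u$, $\operatorname{div}u=0$ in $\Omega$, $u\times\nu=0$ on $\partial\Omega$. $-\Delta_{\rm D}$ is the Dirichlet Laplacian in $L^2(\Omega)$ (form $\int\nabla\phi\cdot\nabla\psi$ on $H_0^1(\Omega)$). *)

theory Defs
  imports "HOL-Analysis.Analysis"
begin

definition pd :: "3 \<Rightarrow> (real^3 \<Rightarrow> real) \<Rightarrow> real^3 \<Rightarrow> real" where
  "pd i f x = frechet_derivative f (at x) (axis i 1)"

fun Ck :: "nat \<Rightarrow> (real^3 \<Rightarrow> real) \<Rightarrow> bool" where
  "Ck 0 f = continuous_on UNIV f"
| "Ck (Suc n) f = (f differentiable_on UNIV \<and> continuous_on UNIV f \<and> (\<forall>i. Ck n (pd i f)))"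

definition smooth :: "(real^3 \<Rightarrow> real) \<Rightarrow> bool" where
  "smooth f \<longleftrightarrow> (\<forall>n. Ck n f)"

definition test_fun :: "(real^3) set \<Rightarrow> (real^3 \<Rightarrow> real) \<Rightarrow> bool" where
  "test_fun \<Omega> f \<longleftrightarrow> smooth f \<and> compact (closure {x. f x \<noteq> 0}) \<and> closure {x. f x \<noteq> 0} \<subseteq> \<Omega>"

definition smooth_field :: "(real^3 \<Rightarrow> real^3) \<Rightarrow> bool" where
  "smooth_field \<psi> \<longleftrightarrow> (\<forall>j. smooth (\<lambda>x. \<psi> x $ j))"

definition test_field :: "(real^3) set \<Rightarrow> (real^3 \<Rightarrow> real^3) \<Rightarrow> bool" where
  "test_field \<Omega> \<psi> \<longleftrightarrow> (\<forall>j. test_fun \<Omega> (\<lambda>x. \<psi> x $ j))"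

definition grad :: "(real^3 \<Rightarrow> real) \<Rightarrow> real^3 \<Rightarrow> real^3" where
  "grad f x = (\<chi> i. pd i f x)"

definition curl :: "(real^3 \<Rightarrow> real^3) \<Rightarrow> real^3 \<Rightarrow> real^3" where
  "curl \<psi> x = vector
     [pd 2 (\<lambda>y. \<psi> y $ 3) x - pd 3 (\<lambda>y. \<psi> y $ 2) x,
      pd 3 (\<lambda>y. \<psi> y $ 1) x - pd 1 (\<lambda>y. \<psi> y $ 3) x,
      pd 1 (\<lambda>y. \<psi> y $ 2) x - pd 2 (\<lambda>y. \<psi> y $ 1) x]"

definition lipschitz_domain :: "(real^3) set \<Rightarrow> bool" where
  "lipschitz_domain \<Omega> \<longleftrightarrow> open \<Omega> \<and> bounded \<Omega> \<and> \<Omega> \<noteq> {} \<and>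
    (\<forall>p\<in>frontier \<Omega>. \<exists>(Q :: real^3 \<Rightarrow> real^3) (r :: real) (g :: real^2 \<Rightarrow> real) (L :: real).
        orthogonal_transformation Q \<and> r > 0 \<and> L-lipschitz_on UNIV g \<and>
        (\<forall>x\<in>ball p r. x \<in> \<Omega> \<longleftrightarrow>
            (Q (x - p)) $ 3 < g (vector [(Q (x - p)) $ 1, (Q (x - p)) $ 2])))"

definition L2 :: "(real^3) set \<Rightarrow> (real^3 \<Rightarrow> real) \<Rightarrow> bool" where
  "L2 \<Omega> f \<longleftrightarrow> f \<in> borel_measurable (lebesgue_on \<Omega>) \<and>
     integrable (lebesgue_on \<Omega>) (\<lambda>x. (f x)^2)"

definition L2v :: "(real^3) set \<Rightarrow> (real^3 \<Rightarrow> real^3) \<Rightarrow> bool" where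
  "L2v \<Omega> u \<longleftrightarrow> u \<in> borel_measurable (lebesgue_on \<Omega>) \<and>
     integrable (lebesgue_on \<Omega>) (\<lambda>x. (norm (u x))^2)"

definition weak_grad :: "(real^3) set \<Rightarrow> (real^3 \<Rightarrow> real) \<Rightarrow> (real^3 \<Rightarrow> real^3) \<Rightarrow> bool" where
  "weak_grad \<Omega> \<phi> G \<longleftrightarrow> L2 \<Omega> \<phi> \<and> L2v \<Omega> G \<and>
    (\<forall>\<psi>. test_fun \<Omega> \<psi> \<longrightarrow> (\<forall>i.
       (LINT x|lebesgue_on \<Omega>. \<phi> x * pd i \<psi> x) = - (LINT x|lebesgue_on \<Omega>. G x $ i * \<psi> x)))"

definition H10 :: "(real^3) set \<Rightarrow> (real^3 \<Rightarrow> real) \<Rightarrow> (real^3 \<Rightarrow> real^3) \<Rightarrow> bool" where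
  "H10 \<Omega> \<phi> G \<longleftrightarrow> weak_grad \<Omega> \<phi> G \<and>
    (\<exists>\<psi>. (\<forall>n. test_fun \<Omega> (\<psi> n)) \<and>
       (\<lambda>n. LINT x|lebesgue_on \<Omega>. (\<psi> n x - \<phi> x)^2) \<longlonglongrightarrow> 0 \<and>
       (\<lambda>n. LINT x|lebesgue_on \<Omega>. (norm (grad (\<psi> n) x - G x))^2) \<longlonglongrightarrow> 0)"

definition weak_curl :: "(real^3) set \<Rightarrow> (real^3 \<Rightarrow> real^3) \<Rightarrow> (real^3 \<Rightarrow> real^3) \<Rightarrow> bool" where
  "weak_curl \<Omega> u w \<longleftrightarrow> L2v \<Omega> u \<and> L2v \<Omega> w \<and>
    (\<forall>\<psi>. test_field \<Omega> \<psi> \<longrightarrow>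
       (LINT x|lebesgue_on \<Omega>. u x \<bullet> curl \<psi> x) = (LINT x|lebesgue_on \<Omega>. w x \<bullet> \<psi> x))"

text \<open>u in H_0(curl) with curl w: the tangential trace u x nu, defined by duality through
  Green's formula, vanishes, i.e. Green's formula holds with no boundary term for all
  fields smooth on R^3 (dense in H^1(Omega)^3).\<close>
definition Hcurl0 :: "(real^3) set \<Rightarrow> (real^3 \<Rightarrow> real^3) \<Rightarrow> (real^3 \<Rightarrow> real^3) \<Rightarrow> bool" where
  "Hcurl0 \<Omega> u w \<longleftrightarrow> weak_curl \<Omega> u w \<and>
    (\<forall>\<phi>. smooth_field \<phi> \<longrightarrow>
       (LINT x|lebesgue_on \<Omega>. u x \<bullet> curl \<phi> x) = (LINT x|lebesgue_on \<Omega>. w x \<bullet> \<phi> x))"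

definition Hdiv0 :: "(real^3) set \<Rightarrow> (real^3 \<Rightarrow> real^3) \<Rightarrow> bool" where
  "Hdiv0 \<Omega> u \<longleftrightarrow> L2v \<Omega> u \<and>
    (\<forall>\<psi>. test_fun \<Omega> \<psi> \<longrightarrow> (LINT x|lebesgue_on \<Omega>. u x \<bullet> grad \<psi> x) = 0)"

definition dir_eigenpair :: "(real^3) set \<Rightarrow> real \<Rightarrow> (real^3 \<Rightarrow> real) \<Rightarrow> bool" where
  "dir_eigenpair \<Omega> lam \<phi> \<longleftrightarrow> (\<exists>G. H10 \<Omega> \<phi> G \<and>
     (\<forall>\<psi> H. H10 \<Omega> \<psi> H \<longrightarrow>
        (LINT x|lebesgue_on \<Omega>. G x \<bullet> H x) = lam * (LINT x|lebesgue_on \<Omega>. \<phi> x * \<psi> x)))"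

definition dirichlet_eigenvalues :: "(real^3) set \<Rightarrow> (nat \<Rightarrow> real) \<Rightarrow> bool" where
  "dirichlet_eigenvalues \<Omega> lam \<longleftrightarrow>
    (\<forall>j k. 1 \<le> j \<longrightarrow> j \<le> k \<longrightarrow> lam j \<le> lam k) \<and>
    (\<exists>\<phi>. (\<forall>k\<ge>1. dir_eigenpair \<Omega> (lam k) (\<phi> k)) \<and>
       (\<forall>j\<ge>1. \<forall>k\<ge>1. (LINT x|lebesgue_on \<Omega>. \<phi> j x * \<phi> k x) = (if j = k then 1 else 0)) \<and>
       (\<forall>f. L2 \<Omega> f \<and> (\<forall>k\<ge>1. (LINT x|lebesgue_on \<Omega>. f x * \<phi> k x) = 0) \<longrightarrow>
            (AE x in lebesgue_on \<Omega>. f x = 0)))"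

definition curl_eigenpair :: "(real^3) set \<Rightarrow> real \<Rightarrow> (real^3 \<Rightarrow> real^3) \<Rightarrow> bool" where
  "curl_eigenpair \<Omega> a u \<longleftrightarrow> Hdiv0 \<Omega> u \<and> (\<exists>w. Hcurl0 \<Omega> u w \<and>
     (\<forall>v z. Hdiv0 \<Omega> v \<and> Hcurl0 \<Omega> v z \<longrightarrow>
        (LINT x|lebesgue_on \<Omega>. w x \<bullet> z x) = a * (LINT x|lebesgue_on \<Omega>. u x \<bullet> v x)))"

definition curlcurl_eigenvalues :: "(real^3) set \<Rightarrow> (nat \<Rightarrow> real) \<Rightarrow> bool" where
  "curlcurl_eigenvalues \<Omega> alpha \<longleftrightarrow>
    (\<forall>j k. 1 \<le> j \<longrightarrow> j \<le> k \<longrightarrow> alpha j \<le> alpha k) \<and>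
    (\<exists>u. (\<forall>k\<ge>1. curl_eigenpair \<Omega> (alpha k) (u k)) \<and>
       (\<forall>j\<ge>1. \<forall>k\<ge>1. (LINT x|lebesgue_on \<Omega>. u j x \<bullet> u k x) = (if j = k then 1 else 0)) \<and>
       (\<forall>f. Hdiv0 \<Omega> f \<and> (\<forall>k\<ge>1. (LINT x|lebesgue_on \<Omega>. f x \<bullet> u k x) = 0) \<longrightarrow>
            (AE x in lebesgue_on \<Omega>. f x = 0)))"

definition planar_piece :: "(real^3) set \<Rightarrow> real^3 \<Rightarrow> (real^3) set \<Rightarrow> bool" where
  "planar_piece \<Omega> n P \<longleftrightarrow> n \<noteq> 0 \<and> P \<noteq> {} \<and> P \<subseteq> frontier \<Omega> \<and>
     (\<exists>c. openin (top_of_set {x. n \<bullet> x = c}) P)"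

definition three_planar_pieces :: "(real^3) set \<Rightarrow> bool" where
  "three_planar_pieces \<Omega> \<longleftrightarrow> (\<exists>P1 P2 P3 n1 n2 n3.
     planar_piece \<Omega> n1 P1 \<and> planar_piece \<Omega> n2 P2 \<and> planar_piece \<Omega> n3 P3 \<and>
     card {n1, n2, n3} = 3 \<and> independent {n1, n2, n3})"

end

theory Submission
  imports Defs
begin

text \<open>For a vector field \<open>v\<close> let \<open>a[v] = \<integral> |curl v|\<^sup>2 + (div v)\<^sup>2\<close>. On \<open>H\<^sub>0(curl) \<inter> H(div)\<close> the
  Helmholtz decomposition splits this form into the curl curl operator on divergence free fields and
  the Dirichlet Laplacian on gradients, whereas \<open>a[v] = \<integral> |\<nabla>v|\<^sup>2\<close> if all components of \<open>v\<close> lie in \<open>H\<^sub>0\<^sup>1\<close>.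
  All \<open>v\<close> in the span of the \<open>3k + 1\<close> fields \<open>\<phi>\<^sub>j e\<^sub>i\<close> (\<open>j \<le> k\<close>) and \<open>\<nabla>\<phi>\<^sub>k\<close> satisfy
  \<open>a[v] \<le> \<lambda>\<^sub>k \<integral> |v|\<^sup>2\<close>, and some nontrivial combination \<open>v\<close> is orthogonal to the
  first \<open>2k\<close> curl curl eigenfields and to \<open>\<nabla>\<phi>\<^sub>1, \<dots>, \<nabla>\<phi>\<^sub>k\<close>. If
  \<open>\<alpha>\<^sub>2\<^sub>k\<^sub>+\<^sub>1 > \<lambda>\<^sub>k\<close>, then \<open>v\<close> is a gradient, and if \<open>v \<noteq> 0\<close> this yields an eigenfunction whose gradient has
  components in \<open>H\<^sub>0\<^sup>1\<close>; a Rellich type identity excludes this.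

  For the strict inequality \<open>\<nabla>\<phi>\<^sub>k\<close> is not needed: equality would make some field \<open>v \<noteq> 0\<close> with components in the
  eigenspace of \<open>\<lambda>\<^sub>k\<close> satisfy the natural boundary condition \<open>div v = 0\<close>. For a simple eigenvalue
  this forces a directional derivative of \<open>\<phi>\<^sub>k\<close> to be a multiple of \<open>\<phi>\<^sub>k\<close>. On a planar piece of the
  boundary with normal \<open>n\<close> it makes the Cauchy data of \<open>v \<bullet> n\<close> vanish, so \<open>v \<bullet> n = 0\<close> by unique
  continuation.\<close>

section \<open>Square integrable functions\<close>

text \<open>The \<open>3 * k + 1\<close> trial fields face \<open>2 * k + k\<close> linear
  conditions, so a nontrivial combination survives. Orthogonality to \<open>g 1, ..., g k\<close>
  makes the potential of the gradient part orthogonal to \<open>\<phi> 1, ..., \<phi> k\<close>,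
  which raises the Dirichlet bound for that part to \<open>lam (k + 1)\<close>. For the strict
  inequality only the gradients below the first index \<open>l\<close> with
  \<open>lam l = lam k\<close> are imposed; \<open>2 * k + (l - 1) < 3 * k\<close> then leaves room
  without the extra trial field.

  The proof works with weak identities throughout, in place of boundary traces and elliptic
  regularity. Membership in \<open>H10\<close> means approximation by test functions, and a boundary
  condition is a Green formula without boundary term. Inner products over \<Omega> with test
  functions that reach beyond \<Omega> treat a function as extended by zero, so vanishing Cauchy
  data on a planar piece say that the extension solves the Helmholtz equation weakly across it. Weak
  solutions become smooth after pairing with translated test functions, and explicit derivative
  bounds take the place of analyticity.\<close>

definition sq_int :: "'a measure \<Rightarrow> ('a \<Rightarrow> 'b::euclidean_space) \<Rightarrow> bool" where
  "sq_int M f \<longleftrightarrow> f \<in> borel_measurable M \<and> integrable M (\<lambda>x. (norm (f x))^2)"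

definition ip :: "'a measure \<Rightarrow> ('a \<Rightarrow> 'b::euclidean_space) \<Rightarrow> ('a \<Rightarrow> 'b) \<Rightarrow> real" where
  "ip M f g = (LINT x|M. f x \<bullet> g x)"

abbreviation "nsq M f \<equiv> ip M f f"

definition L2_lim :: "'a measure \<Rightarrow> (nat \<Rightarrow> 'a \<Rightarrow> 'b::euclidean_space) \<Rightarrow> ('a \<Rightarrow> 'b) \<Rightarrow> bool" where
  "L2_lim M f F \<longleftrightarrow> (\<lambda>n. nsq M (\<lambda>x. f n x - F x)) \<longlonglongrightarrow> 0"

text \<open>Spaces are predicates on functions, not on classes. Closure under \<open>L2_lim\<close>,
  applied to a constant sequence, makes them invariant under measurable changes on null
  sets.\<close>

definition closed_subspace :: "'a measure \<Rightarrow> (('a \<Rightarrow> 'b::euclidean_space) \<Rightarrow> bool) \<Rightarrow> bool" where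
  "closed_subspace M K \<longleftrightarrow> (\<forall>f. K f \<longrightarrow> sq_int M f) \<and> K (\<lambda>x. 0) \<and>
     (\<forall>f g. K f \<longrightarrow> K g \<longrightarrow> K (\<lambda>x. f x + g x)) \<and> (\<forall>c f. K f \<longrightarrow> K (\<lambda>x. c *\<^sub>R f x)) \<and>
     (\<forall>f F. (\<forall>n. K (f n)) \<longrightarrow> sq_int M F \<longrightarrow> L2_lim M f F \<longrightarrow> K F)"

lemma sq_int_measurable: "sq_int M f \<Longrightarrow> f \<in> borel_measurable M"
  by (simp add: sq_int_def)

lemma sq_int_inner_integrable:
  assumes "sq_int M f" "sq_int M g"
  shows "integrable M (\<lambda>x. f x \<bullet> g x)"
proof (rule Bochner_Integration.integrable_bound)
  show "integrable M (\<lambda>x. (norm (f x))^2 + (norm (g x))^2)"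
    using assms by (simp add: sq_int_def)
  show "(\<lambda>x. f x \<bullet> g x) \<in> borel_measurable M"
    using assms by (auto simp: sq_int_def)
  have "\<bar>f x \<bullet> g x\<bar> \<le> (norm (f x))^2 + (norm (g x))^2" for x
  proof -
    have "\<bar>f x \<bullet> g x\<bar> \<le> norm (f x) * norm (g x)" by (rule Cauchy_Schwarz_ineq2)
    moreover have "2 * (norm (f x) * norm (g x)) \<le> (norm (f x))^2 + (norm (g x))^2"
      using sum_squares_bound[of "norm (f x)" "norm (g x)"] by simp
    moreover have "0 \<le> norm (f x) * norm (g x)" by simp
    ultimately show ?thesis by linarith
  qed
  then show "AE x in M. norm (f x \<bullet> g x) \<le> norm ((norm (f x))^2 + (norm (g x))^2)"
    by (intro AE_I2) (metis real_norm_def abs_ge_self order_trans)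
qed

lemma sq_int_add:
  assumes "sq_int M f" "sq_int M g"
  shows "sq_int M (\<lambda>x. f x + g x)"
proof -
  have "integrable M (\<lambda>x. f x \<bullet> f x + 2 * (f x \<bullet> g x) + g x \<bullet> g x)"
    using assms by (intro Bochner_Integration.integrable_add integrable_mult_right sq_int_inner_integrable)
  moreover have "(norm (f x + g x))^2 = f x \<bullet> f x + 2 * (f x \<bullet> g x) + g x \<bullet> g x" for x
    by (simp add: power2_norm_eq_inner inner_add_left inner_add_right inner_commute)
  ultimately show ?thesis using assms by (auto simp: sq_int_def)
qed

lemma sq_int_scaleR: "sq_int M f \<Longrightarrow> sq_int M (\<lambda>x. c *\<^sub>R f x)"
  by (auto simp: sq_int_def power_mult_distrib)

lemma sq_int_uminus: "sq_int M f \<Longrightarrow> sq_int M (\<lambda>x. - f x)"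
  by (auto simp: sq_int_def)

lemma sq_int_diff:
  assumes "sq_int M f" "sq_int M g"
  shows "sq_int M (\<lambda>x. f x - g x)"
  using sq_int_add[OF assms(1) sq_int_uminus[OF assms(2)]] by simp

lemma sq_int_zero [simp]: "sq_int M (\<lambda>x. 0)"
  by (simp add: sq_int_def)

lemma sq_int_sum: "(\<And>i. i \<in> I \<Longrightarrow> sq_int M (f i)) \<Longrightarrow> sq_int M (\<lambda>x. \<Sum>i\<in>I. f i x)"
  by (induction I rule: infinite_finite_induct) (auto intro: sq_int_add)

lemma sq_int_mult: "sq_int M f \<Longrightarrow> sq_int M (\<lambda>x. c * f x)" for f :: "'a \<Rightarrow> real"
  using sq_int_scaleR[of M f c] by simp

lemmas sq_int_intros = sq_int_add sq_int_scaleR sq_int_uminus sq_int_diff sq_int_zero sq_int_sum sq_int_mult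

lemma ip_commute: "ip M f g = ip M g f"
  by (simp add: ip_def inner_commute)

lemma ip_add_left: "sq_int M f \<Longrightarrow> sq_int M g \<Longrightarrow> sq_int M h \<Longrightarrow>
    ip M (\<lambda>x. f x + g x) h = ip M f h + ip M g h"
  by (simp add: ip_def inner_add_left sq_int_inner_integrable)

lemma ip_diff_left: "sq_int M f \<Longrightarrow> sq_int M g \<Longrightarrow> sq_int M h \<Longrightarrow>
    ip M (\<lambda>x. f x - g x) h = ip M f h - ip M g h"
  by (simp add: ip_def inner_diff_left sq_int_inner_integrable)

lemma ip_scaleR_left: "ip M (\<lambda>x. c *\<^sub>R f x) h = c * ip M f h"
  by (simp add: ip_def)

lemma ip_uminus_left: "ip M (\<lambda>x. - f x) h = - ip M f h"
  by (simp add: ip_def)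

lemma ip_mult_left: "ip M (\<lambda>x. c * f x) h = c * ip M f h" for f :: "'a \<Rightarrow> real"
  using ip_scaleR_left[of M c f h] by simp

lemma ip_mult_right: "ip M h (\<lambda>x. c * f x) = c * ip M h f" for f :: "'a \<Rightarrow> real"
  using ip_mult_left[of M c f h] by (simp add: ip_commute)

lemma ip_zero [simp]: "ip M (\<lambda>x. 0) h = 0" "ip M h (\<lambda>x. 0) = 0"
  by (simp_all add: ip_def)

lemma ip_sum_left: "(\<And>i. i \<in> I \<Longrightarrow> sq_int M (f i)) \<Longrightarrow> sq_int M h \<Longrightarrow>
    ip M (\<lambda>x. \<Sum>i\<in>I. f i x) h = (\<Sum>i\<in>I. ip M (f i) h)"
  by (induction I rule: infinite_finite_induct) (auto simp: ip_add_left sq_int_sum)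

lemma ip_add_right: "sq_int M f \<Longrightarrow> sq_int M g \<Longrightarrow> sq_int M h \<Longrightarrow>
    ip M h (\<lambda>x. f x + g x) = ip M h f + ip M h g"
  using ip_add_left[of M f g h] by (simp add: ip_commute)

lemma ip_diff_right: "sq_int M f \<Longrightarrow> sq_int M g \<Longrightarrow> sq_int M h \<Longrightarrow>
    ip M h (\<lambda>x. f x - g x) = ip M h f - ip M h g"
  using ip_diff_left[of M f g h] by (simp add: ip_commute)

lemma ip_scaleR_right: "ip M h (\<lambda>x. c *\<^sub>R f x) = c * ip M h f"
  by (simp add: ip_def)

lemma ip_uminus_right: "ip M h (\<lambda>x. - f x) = - ip M h f"
  by (simp add: ip_def)

lemma ip_sum_right: "(\<And>i. i \<in> I \<Longrightarrow> sq_int M (f i)) \<Longrightarrow> sq_int M h \<Longrightarrow>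
    ip M h (\<lambda>x. \<Sum>i\<in>I. f i x) = (\<Sum>i\<in>I. ip M h (f i))"
  using ip_sum_left[of I M f h] by (simp add: ip_commute)

lemmas ip_simps = ip_add_left ip_add_right ip_diff_left ip_diff_right ip_scaleR_left ip_scaleR_right
  ip_uminus_left ip_uminus_right ip_mult_left ip_mult_right ip_sum_left ip_sum_right

lemma ip_nonneg [simp]: "0 \<le> nsq M f"
  by (simp add: ip_def)

lemma ip_self_norm: "nsq M f = (LINT x|M. (norm (f x))^2)"
  by (simp add: ip_def power2_norm_eq_inner)

lemma ip_self_eq_0:
  assumes "sq_int M f" "nsq M f = 0"
  shows "AE x in M. f x = 0"
proof -
  have "AE x in M. (norm (f x))^2 = 0"
    using assms integral_nonneg_eq_0_iff_AE[of M "\<lambda>x. (norm (f x))^2"]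
    by (simp add: sq_int_def ip_self_norm)
  then show ?thesis by simp
qed

lemma ip_cong_AE:
  assumes "AE x in M. f x = f' x" "AE x in M. g x = g' x"
    "sq_int M f" "sq_int M f'" "sq_int M g" "sq_int M g'"
  shows "ip M f g = ip M f' g'"
  unfolding ip_def
  by (rule integral_cong_AE) (use assms sq_int_inner_integrable in auto)

lemma ip_expand_diff:
  assumes "sq_int M f" "sq_int M g"
  shows "nsq M (\<lambda>x. f x - g x) = nsq M f - 2 * ip M f g + nsq M g"
  using assms by (simp add: ip_simps sq_int_intros ip_commute[of M g f])

lemma ip_expand_add:
  assumes "sq_int M f" "sq_int M g"
  shows "nsq M (\<lambda>x. f x + g x) = nsq M f + 2 * ip M f g + nsq M g"
  using assms by (simp add: ip_simps sq_int_intros ip_commute[of M g f])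

lemma ip_Cauchy_Schwarz:
  assumes "sq_int M f" "sq_int M g"
  shows "(ip M f g)^2 \<le> nsq M f * nsq M g"
proof (cases "nsq M g = 0")
  case True
  have "AE x in M. g x = 0" using ip_self_eq_0[OF assms(2) True] .
  then have "ip M f g = ip M f (\<lambda>x. 0)"
    by (intro ip_cong_AE) (use assms in auto)
  then show ?thesis by (simp add: True)
next
  case False
  define t where "t = ip M f g / nsq M g"
  have "0 \<le> nsq M (\<lambda>x. f x - t *\<^sub>R g x)" by simp
  also have "\<dots> = nsq M f - 2 * t * ip M f g + t^2 * nsq M g"
    using assms by (simp add: ip_expand_diff sq_int_intros ip_simps power2_eq_square)
  also have "\<dots> = nsq M f - (ip M f g)^2 / nsq M g"
    using False by (simp add: t_def field_simps power2_eq_square)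
  finally have "(ip M f g)^2 / nsq M g \<le> nsq M f" by simp
  moreover have "0 < nsq M g" using False ip_nonneg[of M g] by linarith
  ultimately show ?thesis by (simp add: field_simps)
qed

lemma ip_abs_le:
  assumes "sq_int M f" "sq_int M g"
  shows "\<bar>ip M f g\<bar> \<le> sqrt (nsq M f) * sqrt (nsq M g)"
  using ip_Cauchy_Schwarz[OF assms] real_sqrt_le_mono real_sqrt_mult real_sqrt_abs by metis

lemma L2_lim_ip:
  assumes "\<And>n. sq_int M (f n)" "sq_int M F" "sq_int M g" "L2_lim M f F"
  shows "(\<lambda>n. ip M (f n) g) \<longlonglongrightarrow> ip M F g"
proof -
  have "(\<lambda>n. sqrt (nsq M (\<lambda>x. f n x - F x)) * sqrt (nsq M g)) \<longlonglongrightarrow> sqrt 0 * sqrt (nsq M g)"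
    using assms(4) unfolding L2_lim_def by (intro tendsto_intros)
  then have *: "(\<lambda>n. sqrt (nsq M (\<lambda>x. f n x - F x)) * sqrt (nsq M g)) \<longlonglongrightarrow> 0" by simp
  have "\<bar>ip M (f n) g - ip M F g\<bar> \<le> sqrt (nsq M (\<lambda>x. f n x - F x)) * sqrt (nsq M g)" for n
    using ip_abs_le[OF sq_int_diff[OF assms(1)[of n] assms(2)] assms(3)] assms by (simp add: ip_simps)
  then have "(\<lambda>n. ip M (f n) g - ip M F g) \<longlonglongrightarrow> 0"
    by (intro Lim_null_comparison[OF _ *]) auto
  then show ?thesis by (simp add: LIM_zero_iff)
qed

lemma L2_lim_ip_self:
  assumes "\<And>n. sq_int M (f n)" "sq_int M F" "L2_lim M f F"
  shows "(\<lambda>n. nsq M (f n)) \<longlonglongrightarrow> nsq M F"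
proof -
  have "(\<lambda>n. nsq M (\<lambda>x. f n x - F x) + 2 * ip M (f n) F - nsq M F)
      \<longlonglongrightarrow> 0 + 2 * nsq M F - nsq M F"
    using assms by (intro tendsto_intros L2_lim_ip) (auto simp: L2_lim_def)
  then show ?thesis using assms by (simp add: ip_expand_diff)
qed

lemma L2_lim_add:
  assumes "\<And>n. sq_int M (f n)" "sq_int M F" "L2_lim M f F"
    "\<And>n. sq_int M (g n)" "sq_int M G" "L2_lim M g G"
  shows "L2_lim M (\<lambda>n x. f n x + g n x) (\<lambda>x. F x + G x)"
  unfolding L2_lim_def
proof (rule Lim_null_comparison)
  have "nsq M (\<lambda>x. f n x + g n x - (F x + G x))
      \<le> 2 * nsq M (\<lambda>x. f n x - F x) + 2 * nsq M (\<lambda>x. g n x - G x)" for n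
  proof -
    let ?a = "\<lambda>x. f n x - F x" and ?b = "\<lambda>x. g n x - G x"
    have s: "sq_int M ?a" "sq_int M ?b" using assms by (auto intro: sq_int_intros)
    have "0 \<le> nsq M (\<lambda>x. ?a x - ?b x)" by simp
    then have "2 * ip M ?a ?b \<le> nsq M ?a + nsq M ?b" unfolding ip_expand_diff[OF s] by linarith
    moreover have "(\<lambda>x. f n x + g n x - (F x + G x)) = (\<lambda>x. ?a x + ?b x)" by auto
    ultimately show ?thesis by (simp only: ip_expand_add[OF s])
  qed
  then show "\<forall>\<^sub>F n in sequentially. norm (nsq M (\<lambda>x. f n x + g n x - (F x + G x)))
      \<le> 2 * nsq M (\<lambda>x. f n x - F x) + 2 * nsq M (\<lambda>x. g n x - G x)"
    by (intro always_eventually) simp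
  have "(\<lambda>n. 2 * nsq M (\<lambda>x. f n x - F x) + 2 * nsq M (\<lambda>x. g n x - G x))
      \<longlonglongrightarrow> 2 * 0 + 2 * 0"
    using assms unfolding L2_lim_def by (intro tendsto_intros)
  then show "(\<lambda>n. 2 * nsq M (\<lambda>x. f n x - F x) + 2 * nsq M (\<lambda>x. g n x - G x))
      \<longlonglongrightarrow> 0" by simp
qed

lemma L2_lim_scaleR:
  assumes "L2_lim M f F"
  shows "L2_lim M (\<lambda>n x. c *\<^sub>R f n x) (\<lambda>x. c *\<^sub>R F x)"
proof -
  have "(\<lambda>n. c * (c * nsq M (\<lambda>x. f n x - F x))) \<longlonglongrightarrow> c * (c * 0)"
    using assms unfolding L2_lim_def by (intro tendsto_intros)
  then show ?thesis
    unfolding L2_lim_def by (simp only: scaleR_diff_right[symmetric] ip_scaleR_left ip_scaleR_right) simp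
qed

lemma L2_lim_minus:
  assumes "L2_lim M f F"
  shows "L2_lim M (\<lambda>n x. - f n x) (\<lambda>x. - F x)"
  using L2_lim_scaleR[OF assms, of "-1"] by simp

text \<open>Polarisation reduces this to the convergence of squared norms.\<close>

lemma L2_lim_ip_both:
  assumes "\<And>n. sq_int M (f n)" "sq_int M F" "L2_lim M f F"
    "\<And>n. sq_int M (g n)" "sq_int M G" "L2_lim M g G"
  shows "(\<lambda>n. ip M (f n) (g n)) \<longlonglongrightarrow> ip M F G"
proof -
  have "(\<lambda>n. (nsq M (\<lambda>x. f n x + g n x) - nsq M (f n) - nsq M (g n)) / 2) \<longlonglongrightarrow>
    (nsq M (\<lambda>x. F x + G x) - nsq M F - nsq M G) / 2"
    by (intro tendsto_intros L2_lim_ip_self L2_lim_add sq_int_add assms) auto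
  then show ?thesis using assms by (simp add: ip_expand_add)
qed

text \<open>Gaussian elimination: an equation with a nonzero coefficient at an unknown
  \<open>p\<close> is solved for \<open>p\<close> and substituted into the others, which costs one
  equation and one unknown.\<close>

lemma exists_common_zero:
  fixes A :: "'j \<Rightarrow> 'i \<Rightarrow> real"
  assumes "finite J" "finite I" "card J < card I"
  shows "\<exists>x. (\<exists>i\<in>I. x i \<noteq> 0) \<and> (\<forall>j\<in>J. (\<Sum>i\<in>I. A j i * x i) = 0)"
  using assms
proof (induction J arbitrary: I A rule: finite_induct)
  case empty
  then obtain i where "i \<in> I" by fastforce
  then show ?case by (intro exI[of _ "\<lambda>_. 1"]) auto
next
  case (insert m J)
  show ?case
  proof (cases "\<forall>i\<in>I. A m i = 0")
    case True
    obtain x where x: "\<exists>i\<in>I. x i \<noteq> 0" "\<forall>j\<in>J. (\<Sum>i\<in>I. A j i * x i) = 0"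
      using insert.IH[of I A] insert.prems insert.hyps by auto
    moreover have "(\<Sum>i\<in>I. A m i * x i) = 0" using True by simp
    ultimately show ?thesis by auto
  next
    case False
    then obtain p where p: "p \<in> I" "A m p \<noteq> 0" by auto
    define I' where "I' = I - {p}"
    define A' where "A' j i = A j i - A j p * A m i / A m p" for j i
    have "card J < card I'" "finite I'"
      using insert p by (auto simp: I'_def)
    then obtain x where x: "\<exists>i\<in>I'. x i \<noteq> 0" "\<forall>j\<in>J. (\<Sum>i\<in>I'. A' j i * x i) = 0"
      using insert.IH[of I' A'] by auto
    define s where "s = - (\<Sum>i\<in>I'. A m i * x i) / A m p"
    have split: "(\<Sum>i\<in>I. A j i * (x(p := s)) i) = A j p * s + (\<Sum>i\<in>I'. A j i * x i)" for j
      using p insert.prems by (subst sum.remove[of _ p]) (auto simp: I'_def intro!: sum.cong)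
    have "(\<Sum>i\<in>I. A m i * (x(p := s)) i) = 0"
      unfolding split using p by (simp add: s_def)
    moreover have "(\<Sum>i\<in>I. A j i * (x(p := s)) i) = 0" if "j \<in> J" for j
    proof -
      have "0 = (\<Sum>i\<in>I'. A' j i * x i)" using x that by simp
      also have "\<dots> = (\<Sum>i\<in>I'. A j i * x i) - A j p / A m p * (\<Sum>i\<in>I'. A m i * x i)"
        by (simp add: A'_def algebra_simps sum_subtractf sum_distrib_left)
      finally show ?thesis unfolding split by (simp add: s_def)
    qed
    moreover have "\<exists>i\<in>I. (x(p := s)) i \<noteq> 0"
      using x by (auto simp: I'_def)
    ultimately show ?thesis by (intro exI[of _ "x(p := s)"]) auto
  qed
qed

text \<open>A fast subsequence has differences so small that a weighted series of their squares is
  integrable, hence it converges almost everywhere; Fatou's lemma turns its pointwise limit into the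
  L2 limit of the whole sequence.\<close>

theorem Riesz_Fischer:
  fixes f :: "nat \<Rightarrow> 'a \<Rightarrow> 'b::euclidean_space"
  assumes f: "\<And>n. sq_int M (f n)"
    and Cauchy: "\<And>e. e > 0 \<Longrightarrow> \<exists>N. \<forall>m\<ge>N. \<forall>n\<ge>N. nsq M (\<lambda>x. f m x - f n x) < e"
  shows "\<exists>F. sq_int M F \<and> L2_lim M f F"
proof -
  have "\<exists>N. \<forall>k. \<forall>m\<ge>N k. \<forall>n\<ge>N k. nsq M (\<lambda>x. f m x - f n x) < (1/4)^k"
    using Cauchy by (intro choice allI) simp
  then obtain N where N: "\<And>k m n. m \<ge> N k \<Longrightarrow> n \<ge> N k \<Longrightarrow>
      nsq M (\<lambda>x. f m x - f n x) < (1/4)^k" by blast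
  \<comment> \<open>Summing the \<open>N i\<close> places both \<open>r k\<close> and
    \<open>r (Suc k)\<close> beyond \<open>N k\<close>; the summand \<open>k\<close> lets
    \<open>r k\<close> tend to infinity, as the \<open>Limsup\<close> bound requires.\<close>
  define r where "r k = (\<Sum>i\<le>k. N i) + k" for k
  have Nle: "N k \<le> (\<Sum>i\<le>k. N i)" for k by (intro member_le_sum) auto
  have rN: "r k \<ge> N k" and rS: "r (Suc k) \<ge> N k" and rk: "r k \<ge> k" for k
    using Nle[of k] by (simp_all add: r_def)
  define d where "d k x = f (r (Suc k)) x - f (r k) x" for k x
  have d: "sq_int M (d k)" for k unfolding d_def by (intro sq_int_intros f)
  have [measurable]: "d k \<in> borel_measurable M" "f n \<in> borel_measurable M" for k n
    using d f by (auto dest: sq_int_measurable)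
  have nn: "(\<integral>\<^sup>+x. ennreal ((norm (g x))^2) \<partial>M) = ennreal (nsq M g)" if "sq_int M g" for g :: "'a \<Rightarrow> 'b"
    using that by (simp add: ip_self_norm nn_integral_eq_integral sq_int_def)
  \<comment> \<open>The weight \<open>2^k\<close> still leaves a geometric series because
    \<open>nsq M (d k) < (1/4)^k\<close>; where the weighted sum is finite, it bounds
    \<open>norm (d k x)\<close> by a multiple of \<open>sqrt (1/2) ^ k\<close>.\<close>
  have "(\<integral>\<^sup>+x. (\<Sum>k. ennreal (2^k * (norm (d k x))^2)) \<partial>M) = (\<Sum>k. \<integral>\<^sup>+x. ennreal (2^k * (norm (d k x))^2) \<partial>M)"
    by (intro nn_integral_suminf) measurable
  also have "\<dots> \<le> (\<Sum>k. ennreal ((1/2)^k))"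
  proof (intro suminf_le summableI allI)
    fix k
    have "(\<integral>\<^sup>+x. ennreal (2^k * (norm (d k x))^2) \<partial>M) = (\<integral>\<^sup>+x. ennreal ((2::real)^k) * ennreal ((norm (d k x))^2) \<partial>M)"
      by (simp add: ennreal_mult)
    also have "\<dots> = ennreal (2^k) * (\<integral>\<^sup>+x. ennreal ((norm (d k x))^2) \<partial>M)"
      by (intro nn_integral_cmult) measurable
    also have "\<dots> = ennreal (2^k * nsq M (d k))"
      by (simp add: nn[OF d] ennreal_mult)
    also have "\<dots> \<le> ennreal ((1/2)^k)"
    proof (rule ennreal_leI)
      have "nsq M (d k) \<le> (1/4)^k" unfolding d_def using N[OF rS[of k] rN[of k]] by simp
      then have "2^k * nsq M (d k) \<le> 2^k * (1/4)^k" by simp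
      also have "\<dots> = (1/2)^k" by (simp flip: power_mult_distrib)
      finally show "2^k * nsq M (d k) \<le> (1/2)^k" .
    qed
    finally show "(\<integral>\<^sup>+x. ennreal (2^k * (norm (d k x))^2) \<partial>M) \<le> ennreal ((1/2)^k)" .
  qed
  also have "\<dots> = ennreal (\<Sum>k. (1/2)^k)"
    by (intro suminf_ennreal2) (auto simp: summable_geometric)
  also have "\<dots> < \<infinity>" by simp
  finally have "(\<integral>\<^sup>+x. (\<Sum>k. ennreal (2^k * (norm (d k x))^2)) \<partial>M) \<noteq> \<infinity>" by simp
  then have "AE x in M. (\<Sum>k. ennreal (2^k * (norm (d k x))^2)) \<noteq> \<infinity>"
    by (intro nn_integral_PInf_AE) measurable
  then have conv: "AE x in M. convergent (\<lambda>k. f (r k) x)"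
  proof eventually_elim
    case (elim x)
    have s: "summable (\<lambda>k. 2^k * (norm (d k x))^2)"
      using elim by (intro summable_suminf_not_top) auto
    define S where "S = (\<Sum>k. 2^k * (norm (d k x))^2)"
    have b: "norm (d k x) \<le> sqrt S * (sqrt (1/2))^k" for k
    proof -
      have "2^k * (norm (d k x))^2 \<le> S"
        unfolding S_def using sum_le_suminf[OF s, of "{k}"] by simp
      then have "(norm (d k x))^2 \<le> S * (1/2)^k" by (simp add: field_simps)
      then have "norm (d k x) \<le> sqrt (S * (1/2)^k)" by (rule real_le_rsqrt)
      then show ?thesis by (simp add: real_sqrt_mult real_sqrt_power)
    qed
    have "summable (\<lambda>k. sqrt S * (sqrt (1/2))^k)"
      by (intro summable_mult summable_geometric) (simp add: real_sqrt_lt_1_iff)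
    then have "summable (\<lambda>k. d k x)" by (rule summable_comparison_test') (rule b)
    then have "convergent (\<lambda>n. \<Sum>k<n. d k x)" by (simp add: summable_iff_convergent)
    then have "convergent (\<lambda>n. f (r n) x - f (r 0) x)"
      using sum_lessThan_telescope[of "\<lambda>k. f (r k) x"] unfolding d_def by simp
    from convergent_add[OF this convergent_const[of "f (r 0) x"]]
    show ?case by simp
  qed
  define F where "F x = lim (\<lambda>k. f (r k) x)" for x
  have Fm: "F \<in> borel_measurable M"
    unfolding F_def by (intro borel_measurable_lim_metric) measurable
  have lim: "AE x in M. (\<lambda>k. f (r k) x) \<longlonglongrightarrow> F x"
    using conv by eventually_elim (simp add: F_def convergent_LIMSEQ_iff)
  have Fatou: "(\<integral>\<^sup>+x. ennreal ((norm (f n x - F x))^2) \<partial>M) \<le> ennreal e"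
    if e: "e > 0" and NN: "\<forall>m\<ge>K. \<forall>n\<ge>K. nsq M (\<lambda>x. f m x - f n x) < e" and n: "n \<ge> K" for n K e
  proof -
    have "AE x in M. ennreal ((norm (f n x - F x))^2) = liminf (\<lambda>k. ennreal ((norm (f n x - f (r k) x))^2))"
      using lim
    proof eventually_elim
      case (elim x)
      then have "(\<lambda>k. ennreal ((norm (f n x - f (r k) x))^2)) \<longlonglongrightarrow> ennreal ((norm (f n x - F x))^2)"
        by (intro tendsto_intros)
      then show ?case by (intro lim_imp_Liminf[symmetric] sequentially_bot)
    qed
    then have "(\<integral>\<^sup>+x. ennreal ((norm (f n x - F x))^2) \<partial>M) = (\<integral>\<^sup>+x. liminf (\<lambda>k. ennreal ((norm (f n x - f (r k) x))^2)) \<partial>M)"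
      by (rule nn_integral_cong_AE)
    also have "\<dots> \<le> liminf (\<lambda>k. \<integral>\<^sup>+x. ennreal ((norm (f n x - f (r k) x))^2) \<partial>M)"
      by (intro nn_integral_liminf) measurable
    also have "\<dots> \<le> limsup (\<lambda>k. \<integral>\<^sup>+x. ennreal ((norm (f n x - f (r k) x))^2) \<partial>M)"
      by (intro Liminf_le_Limsup) simp
    also have "\<dots> \<le> ennreal e"
    proof (rule Limsup_bounded)
      show "\<forall>\<^sub>F k in sequentially. (\<integral>\<^sup>+x. ennreal ((norm (f n x - f (r k) x))^2) \<partial>M) \<le> ennreal e"
        using eventually_ge_at_top[of K]
      proof eventually_elim
        case (elim k)
        then have "nsq M (\<lambda>x. f n x - f (r k) x) < e"
          using NN n rk[of k] by auto
        then show ?case using nn[OF sq_int_diff[OF f f]] by (simp add: ennreal_leI)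
      qed
    qed
    finally show ?thesis .
  qed
  have sqd: "sq_int M (\<lambda>x. f n x - F x)"
    if "(\<integral>\<^sup>+x. ennreal ((norm (f n x - F x))^2) \<partial>M) \<le> ennreal e" for n e
    unfolding sq_int_def
  proof
    show 1: "(\<lambda>x. f n x - F x) \<in> borel_measurable M" using Fm sq_int_measurable[OF f] by auto
    show "integrable M (\<lambda>x. (norm (f n x - F x))\<^sup>2)"
      using 1 that by (intro integrableI_bounded) (auto simp: top.not_eq_extremum intro: le_less_trans)
  qed
  obtain K where "\<forall>m\<ge>K. \<forall>n\<ge>K. nsq M (\<lambda>x. f m x - f n x) < 1" using Cauchy[of 1] by auto
  then have "sq_int M (\<lambda>x. f K x - F x)" using Fatou[of 1 K K] by (intro sqd[of _ 1]) auto
  then have "sq_int M (\<lambda>x. f K x - (f K x - F x))" by (rule sq_int_diff[OF f])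
  then have F: "sq_int M F" by simp
  moreover have "L2_lim M f F"
    unfolding L2_lim_def
  proof (rule LIMSEQ_I)
    fix e :: real assume "e > 0"
    then obtain K where K: "\<forall>m\<ge>K. \<forall>n\<ge>K. nsq M (\<lambda>x. f m x - f n x) < e/2" using Cauchy[of "e/2"] by auto
    have "nsq M (\<lambda>x. f n x - F x) \<le> e/2" if "n \<ge> K" for n
      using Fatou[OF _ K that] nn[OF sq_int_diff[OF f F]] \<open>e > 0\<close> by (simp add: ennreal_le_iff)
    then have "norm (nsq M (\<lambda>x. f n x - F x) - 0) < e" if "n \<ge> K" for n
      using \<open>e > 0\<close> that ip_nonneg[of M "\<lambda>x. f n x - F x"] by fastforce
    then show "\<exists>no. \<forall>n\<ge>no. norm (nsq M (\<lambda>x. f n x - F x) - 0) < e" by blast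
  qed
  ultimately show ?thesis by blast
qed

section \<open>Closed subspaces, orthogonal projection and the Rayleigh principle\<close>

lemma closed_subspaceD:
  assumes "closed_subspace M K"
  shows "K f \<Longrightarrow> sq_int M f" "K (\<lambda>x. 0)" "K f \<Longrightarrow> K g \<Longrightarrow> K (\<lambda>x. f x + g x)"
    "K f \<Longrightarrow> K (\<lambda>x. c *\<^sub>R f x)" "K f \<Longrightarrow> K g \<Longrightarrow> K (\<lambda>x. f x - g x)"
    "(\<And>n. K (F n)) \<Longrightarrow> sq_int M f \<Longrightarrow> L2_lim M F f \<Longrightarrow> K f"
proof -
  show *: "K f \<Longrightarrow> sq_int M f" "K (\<lambda>x. 0)" "\<And>g. K f \<Longrightarrow> K g \<Longrightarrow> K (\<lambda>x. f x + g x)"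
    "\<And>c f. K f \<Longrightarrow> K (\<lambda>x. c *\<^sub>R f x)"
    "(\<And>n. K (F n)) \<Longrightarrow> sq_int M f \<Longrightarrow> L2_lim M F f \<Longrightarrow> K f"
    using assms unfolding closed_subspace_def by blast+
  show "K f \<Longrightarrow> K g \<Longrightarrow> K (\<lambda>x. f x - g x)"
    using *(3)[of "\<lambda>x. (-1) *\<^sub>R g x"] *(4)[of g "-1"] by simp
qed

lemma closed_subspace_sum:
  assumes "closed_subspace M K" "\<And>i. i \<in> I \<Longrightarrow> K (f i)"
  shows "K (\<lambda>x. \<Sum>i\<in>I. f i x)"
  using assms(2) by (induction I rule: infinite_finite_induct) (auto intro: closed_subspaceD(2,3)[OF assms(1)])

lemma closed_subspace_sq_int: "closed_subspace M (sq_int M)"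
  by (auto simp: closed_subspace_def intro: sq_int_intros)

theorem projection_closed_subspace:
  fixes V :: "'a \<Rightarrow> 'b::euclidean_space"
  assumes K: "closed_subspace M K" and V: "sq_int M V"
  shows "\<exists>G. K G \<and> (\<forall>H. K H \<longrightarrow> ip M (\<lambda>x. V x - G x) H = 0)"
proof -
  note Ksq = closed_subspaceD(1)[OF K]
  define dd where "dd G = nsq M (\<lambda>x. V x - G x)" for G
  define d where "d = Inf (dd ` {G. K G})"
  have bdd: "bdd_below (dd ` {G. K G})" by (intro bdd_belowI[of _ 0]) (auto simp: dd_def)
  have ne: "dd ` {G. K G} \<noteq> {}" using closed_subspaceD(2)[OF K] by auto
  have dle: "d \<le> dd G" if "K G" for G unfolding d_def using that bdd by (intro cInf_lower) auto
  have "\<exists>G. K G \<and> dd G < d + inverse (real (Suc n))" for n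
  proof -
    have "d < d + inverse (real (Suc n))" by (simp add: field_simps)
    then have "\<exists>y\<in>dd ` {G. K G}. y < d + inverse (real (Suc n))"
      unfolding d_def using cInf_less_iff[OF ne bdd] by blast
    then show ?thesis by blast
  qed
  then obtain G where G: "\<And>n. K (G n)" "\<And>n. dd (G n) < d + inverse (real (Suc n))" by metis
  note Gs = Ksq[OF G(1)]
  \<comment> \<open>Parallelogram law: the midpoint \<open>h\<close> belongs to \<open>K\<close>, so
    its distance from \<open>V\<close> is at least \<open>d\<close>, which forces two
    near-minimisers to be close to each other.\<close>
  have par: "nsq M (\<lambda>x. G m x - G n x) \<le> 2 * inverse (real (Suc m)) + 2 * inverse (real (Suc n))" for m n
  proof -
    let ?a = "\<lambda>x. V x - G m x" and ?b = "\<lambda>x. V x - G n x"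
    have s: "sq_int M ?a" "sq_int M ?b" using V Gs by (auto intro: sq_int_intros)
    let ?h = "\<lambda>x. (1/2) *\<^sub>R (G m x + G n x)"
    have "K ?h" by (intro closed_subspaceD(3,4)[OF K] G)
    then have 1: "d \<le> dd ?h" by (rule dle)
    have e1: "(\<lambda>x. G m x - G n x) = (\<lambda>x. ?b x - ?a x)" by auto
    have e2: "(\<lambda>x. V x - ?h x) = (\<lambda>x. (1/2) *\<^sub>R (?a x + ?b x))"
    proof
      fix x
      have "?a x + ?b x = 2 *\<^sub>R V x - (G m x + G n x)" by (simp add: scaleR_2)
      then have "(1/2) *\<^sub>R (?a x + ?b x) = (1/2) *\<^sub>R (2 *\<^sub>R V x) - ?h x"
        by (simp only: scaleR_diff_right)
      then show "V x - ?h x = (1/2) *\<^sub>R (?a x + ?b x)" by simp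
    qed
    have 2: "dd ?h = (nsq M ?a + 2 * ip M ?a ?b + nsq M ?b) / 4"
      unfolding dd_def e2 ip_scaleR_left ip_scaleR_right ip_expand_add[OF s] by simp
    have 3: "nsq M (\<lambda>x. G m x - G n x) = nsq M ?b - 2 * ip M ?a ?b + nsq M ?a"
      unfolding e1 ip_expand_diff[OF s(2,1)] by (simp add: ip_commute)
    have "nsq M ?a < d + inverse (real (Suc m))" "nsq M ?b < d + inverse (real (Suc n))"
      using G(2)[of m] G(2)[of n] by (auto simp: dd_def)
    moreover have "2 * ip M ?a ?b \<ge> 4 * d - nsq M ?a - nsq M ?b" using 1 unfolding 2 by simp
    ultimately show ?thesis unfolding 3 by linarith
  qed
  have "\<exists>F. sq_int M F \<and> L2_lim M G F"
  proof (rule Riesz_Fischer[OF Gs])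
    fix e :: real assume "e > 0"
    then obtain N where N: "inverse (real (Suc N)) < e / 4" using reals_Archimedean[of "e/4"] by auto
    have "nsq M (\<lambda>x. G m x - G n x) < e" if "m \<ge> N" "n \<ge> N" for m n
    proof -
      have "inverse (real (Suc m)) \<le> inverse (real (Suc N))" "inverse (real (Suc n)) \<le> inverse (real (Suc N))"
        using that by (auto intro!: le_imp_inverse_le)
      then show ?thesis using par[of m n] N by linarith
    qed
    then show "\<exists>N. \<forall>m\<ge>N. \<forall>n\<ge>N. nsq M (\<lambda>x. G m x - G n x) < e" by blast
  qed
  then obtain F where F: "sq_int M F" "L2_lim M G F" by blast
  have KF: "K F" using closed_subspaceD(6)[OF K G(1) F] .
  have "L2_lim M (\<lambda>n x. V x - G n x) (\<lambda>x. V x - F x)"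
    using L2_lim_minus[OF F(2)] by (simp add: L2_lim_def algebra_simps)
  then have "(\<lambda>n. dd (G n)) \<longlonglongrightarrow> dd F"
    unfolding dd_def using V F Gs by (intro L2_lim_ip_self) (auto intro: sq_int_intros)
  moreover have "(\<lambda>n. d + inverse (real (Suc n))) \<longlonglongrightarrow> d + 0"
    by (intro tendsto_intros LIMSEQ_inverse_real_of_nat)
  ultimately have "dd F \<le> d + 0" using G(2) by (intro LIMSEQ_le) (auto intro: less_imp_le)
  then have dF: "dd F = d" using dle[OF KF] by simp
  have "ip M (\<lambda>x. V x - F x) H = 0" if H: "K H" for H
  proof (rule ccontr)
    let ?a = "ip M (\<lambda>x. V x - F x) H" and ?h = "nsq M H"
    assume a: "?a \<noteq> 0"
    \<comment> \<open>The optimal step would divide by the squared norm of \<open>H\<close>; adding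
      1 also covers a null \<open>H\<close>, and the step still lowers the distance.\<close>
    define t where "t = ?a / (?h + 1)"
    have h: "?h + 1 > 0" using ip_nonneg[of M H] by linarith
    have s: "sq_int M (\<lambda>x. V x - F x)" "sq_int M H" using V F Ksq[OF H] by (auto intro: sq_int_intros)
    have "d \<le> dd (\<lambda>x. F x + t *\<^sub>R H x)" by (intro dle closed_subspaceD(3,4)[OF K] KF H)
    also have "\<dots> = nsq M (\<lambda>x. (V x - F x) - t *\<^sub>R H x)"
      unfolding dd_def by (simp add: algebra_simps)
    also have "\<dots> = d - 2 * t * ?a + t * (t * ?h)"
      using s dF by (simp add: ip_expand_diff sq_int_intros ip_scaleR_left ip_scaleR_right dd_def)
    finally have "2 * t * ?a \<le> t * (t * ?h)" by simp
    also have "\<dots> \<le> t * (t * (?h + 1))" by (simp add: mult_left_mono algebra_simps)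
    also have "\<dots> = t * ?a" using h by (simp add: t_def)
    finally have "t * ?a \<le> 0" by simp
    moreover have "t * ?a > 0" using a h by (simp add: t_def zero_less_divide_iff flip: power2_eq_square)
    ultimately show False by simp
  qed
  with KF show ?thesis by blast
qed

text \<open>Both sides are compared with the partial sums of the Fourier series of \<open>z\<close>: completeness
  gives Parseval's identity for \<open>z\<close>, whereas Bessel's inequality is enough for \<open>\<zeta>\<close>.\<close>

lemma Rayleigh_lower_bound:
  fixes e :: "nat \<Rightarrow> 'a \<Rightarrow> 'b::euclidean_space" and g :: "nat \<Rightarrow> 'a \<Rightarrow> 'c::euclidean_space"
  assumes K: "closed_subspace M K" and Ke: "\<And>j. j \<ge> 1 \<Longrightarrow> K (e j)"
    and on: "\<And>i j. i \<ge> 1 \<Longrightarrow> j \<ge> 1 \<Longrightarrow> ip M (e i) (e j) = (if i = j then 1 else 0)"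
    and compl: "\<And>f. K f \<Longrightarrow> (\<And>j. j \<ge> 1 \<Longrightarrow> ip M f (e j) = 0) \<Longrightarrow> AE x in M. f x = 0"
    and g: "\<And>j. j \<ge> 1 \<Longrightarrow> sq_int M (g j)"
    and gg: "\<And>i j. i \<ge> 1 \<Longrightarrow> j \<ge> 1 \<Longrightarrow> ip M (g i) (g j) = \<mu> j * ip M (e i) (e j)"
    and mono: "\<And>i j. 1 \<le> i \<Longrightarrow> i \<le> j \<Longrightarrow> \<mu> i \<le> \<mu> j"
    and z: "K z" and \<zeta>: "sq_int M \<zeta>"
    and z\<zeta>: "\<And>j. j \<ge> 1 \<Longrightarrow> ip M \<zeta> (g j) = \<mu> j * ip M z (e j)"
    and orth: "\<And>j. 1 \<le> j \<Longrightarrow> j < m \<Longrightarrow> ip M z (e j) = 0" and m: "m \<ge> 1"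
  shows "\<mu> m * nsq M z \<le> nsq M \<zeta>"
proof -
  note Ksq = closed_subspaceD(1)[OF K]
  define c where "c j = ip M z (e j)" for j
  define S where "S n = (\<lambda>x. \<Sum>j\<in>{1..n}. c j *\<^sub>R e j x)" for n
  define T where "T n = (\<lambda>x. \<Sum>j\<in>{1..n}. c j *\<^sub>R g j x)" for n
  have es: "sq_int M (e j)" if "j \<ge> 1" for j using Ksq Ke that by blast
  have KS: "K (S n)" for n unfolding S_def by (intro closed_subspace_sum[OF K] closed_subspaceD(4)[OF K] Ke) auto
  have Ss: "sq_int M (S n)" for n using Ksq KS by blast
  have Ts: "sq_int M (T n)" for n unfolding T_def by (intro sq_int_sum sq_int_scaleR g) auto
  have zs: "sq_int M z" using Ksq z by blast
  have ipS: "ip M f (S n) = (\<Sum>j\<in>{1..n}. c j * ip M f (e j))" if "sq_int M f" for f n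
    unfolding S_def by (subst ip_sum_right) (auto simp: that es sq_int_scaleR ip_scaleR_right)
  have ipT: "ip M f (T n) = (\<Sum>j\<in>{1..n}. c j * ip M f (g j))" if "sq_int M f" for f n
    unfolding T_def by (subst ip_sum_right) (auto simp: that g sq_int_scaleR ip_scaleR_right)
  have Se: "ip M (S n) (e j) = (if j \<le> n then c j else 0)" if "j \<ge> 1" for n j
  proof -
    have "ip M (S n) (e j) = (\<Sum>i\<in>{1..n}. c i * ip M (e j) (e i))"
      using ipS[OF es[OF that]] by (simp add: ip_commute)
    also have "\<dots> = (\<Sum>i\<in>{1..n}. if i = j then c i else 0)"
      using on[OF that] by (intro sum.cong) auto
    finally show ?thesis using that by simp
  qed
  have Tg: "ip M (T n) (g j) = (if j \<le> n then \<mu> j * c j else 0)" if "j \<ge> 1" for n j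
  proof -
    have "ip M (T n) (g j) = (\<Sum>i\<in>{1..n}. c i * ip M (g i) (g j))"
      using ipT[OF g[OF that]] by (simp add: ip_commute)
    also have "\<dots> = (\<Sum>i\<in>{1..n}. if i = j then \<mu> j * c i else 0)"
      using on[OF _ that] gg[OF _ that] by (intro sum.cong) auto
    finally show ?thesis using that by simp
  qed
  define Q where "Q n = (\<Sum>j\<in>{1..n}. (c j)^2)" for n
  have SS: "ip M (S n) (S k) = Q k" if "k \<le> n" for n k
    unfolding ipS[OF Ss] Q_def using that by (intro sum.cong) (auto simp: Se power2_eq_square)
  have zS: "ip M z (S n) = Q n" for n
    unfolding ipS[OF zs] Q_def by (simp add: c_def power2_eq_square)
  have Qle: "Q n \<le> nsq M z" for n
  proof -
    have "0 \<le> nsq M (\<lambda>x. z x - S n x)" by simp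
    also have "\<dots> = nsq M z - Q n" by (simp add: ip_expand_diff[OF zs Ss] zS SS)
    finally show ?thesis by simp
  qed
  have Qmono: "Q k \<le> Q n" if "k \<le> n" for k n
    unfolding Q_def using that by (intro sum_mono2) auto
  have dS: "nsq M (\<lambda>x. S n x - S k x) = \<bar>Q n - Q k\<bar>" for n k
  proof (cases "k \<le> n")
    case True
    then show ?thesis using Qmono[OF True] by (simp add: ip_expand_diff[OF Ss Ss] SS)
  next
    case False
    then show ?thesis using Qmono[of n k] SS[of n k] by (simp add: ip_expand_diff[OF Ss Ss] SS ip_commute[of M "S n" "S k"])
  qed
  have "Bseq Q"
  proof (rule BseqI')
    show "norm (Q n) \<le> nsq M z" for n using Qle[of n] Qmono[of 0 n] by (simp add: Q_def)
  qed
  moreover have "monoseq Q" by (intro monoI1) (simp add: Qmono)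
  ultimately have "Cauchy Q" by (intro convergent_Cauchy Bseq_monoseq_convergent)
  then have "\<exists>F. sq_int M F \<and> L2_lim M S F"
    by (intro Riesz_Fischer Ss) (simp add: dS Cauchy_def dist_real_def)
  then obtain F where F: "sq_int M F" "L2_lim M S F" by blast
  have KF: "K F" using closed_subspaceD(6)[OF K KS F] .
  have "ip M F (e j) = c j" if "j \<ge> 1" for j
  proof -
    have "(\<lambda>n. ip M (S n) (e j)) \<longlonglongrightarrow> ip M F (e j)" by (intro L2_lim_ip Ss F es that)
    moreover have "(\<lambda>n. ip M (S n) (e j)) \<longlonglongrightarrow> c j"
      by (rule tendsto_eventually, rule eventually_sequentiallyI[of j]) (simp add: Se[OF that])
    ultimately show ?thesis by (rule LIMSEQ_unique)
  qed
  then have "AE x in M. z x - F x = 0"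
    by (intro compl closed_subspaceD(5)[OF K] z KF) (simp add: ip_diff_left zs F es c_def)
  then have "AE x in M. F x = z x" by eventually_elim simp
  then have FF: "nsq M F = nsq M z" by (intro ip_cong_AE F zs)
  have "(\<lambda>n. nsq M (S n)) \<longlonglongrightarrow> nsq M F" by (intro L2_lim_ip_self Ss F)
  then have Qlim: "Q \<longlonglongrightarrow> nsq M z" by (simp add: SS FF)
  have Bessel: "(\<Sum>j\<in>{1..n}. \<mu> j * (c j)^2) \<le> nsq M \<zeta>" for n
  proof -
    have 1: "ip M \<zeta> (T n) = (\<Sum>j\<in>{1..n}. \<mu> j * (c j)^2)"
      unfolding ipT[OF \<zeta>] by (intro sum.cong) (auto simp: z\<zeta> c_def power2_eq_square)
    have 2: "nsq M (T n) = (\<Sum>j\<in>{1..n}. \<mu> j * (c j)^2)"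
      unfolding ipT[OF Ts] by (intro sum.cong) (auto simp: Tg power2_eq_square)
    have "0 \<le> nsq M (\<lambda>x. \<zeta> x - T n x)" by simp
    also have "\<dots> = nsq M \<zeta> - (\<Sum>j\<in>{1..n}. \<mu> j * (c j)^2)"
      by (simp add: ip_expand_diff[OF \<zeta> Ts] 1 2)
    finally show ?thesis by simp
  qed
  have "\<mu> m * Q n \<le> nsq M \<zeta>" for n
  proof -
    \<comment> \<open>The coefficients with \<open>j < m\<close> vanish by \<open>orth\<close>; for
      the others \<open>\<mu> m \<le> \<mu> j\<close>.\<close>
    have "\<mu> m * Q n \<le> (\<Sum>j\<in>{1..n}. \<mu> j * (c j)^2)"
      unfolding Q_def sum_distrib_left
    proof (rule sum_mono)
      fix j assume j: "j \<in> {1..n}"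
      show "\<mu> m * (c j)^2 \<le> \<mu> j * (c j)^2"
        using mono[of m j] orth[of j] j m by (cases "j < m") (auto simp: c_def intro: mult_right_mono)
    qed
    with Bessel[of n] show ?thesis by linarith
  qed
  moreover have "(\<lambda>n. \<mu> m * Q n) \<longlonglongrightarrow> \<mu> m * nsq M z" by (intro tendsto_intros Qlim)
  ultimately show ?thesis by (intro LIMSEQ_le_const2) auto
qed

section \<open>Smooth functions\<close>

lemma pd_eqI: "(f has_derivative D) (at x) \<Longrightarrow> pd i f x = D (axis i 1)"
  unfolding pd_def using frechet_derivative_at by metis

lemma Ck_differentiable: "Ck (Suc n) f \<Longrightarrow> f differentiable (at x)"
  by (simp add: differentiable_on_def)

lemma Ck_Suc_I: "(\<And>x. f differentiable (at x)) \<Longrightarrow> (\<And>i. Ck n (pd i f)) \<Longrightarrow> Ck (Suc n) f"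
  by (simp add: differentiable_imp_continuous_on differentiable_on_def)

lemma Ck_Suc_D: "Ck (Suc n) f \<Longrightarrow> Ck n f"
proof (induction n arbitrary: f)
  case (Suc n)
  then show ?case by (intro Ck_Suc_I) (auto simp: differentiable_on_def)
qed simp

lemma smooth_Ck: "smooth f \<Longrightarrow> Ck n f"
  by (simp add: smooth_def)

lemma smooth_differentiable: "smooth f \<Longrightarrow> f differentiable (at x)"
  using smooth_Ck[of f 1] Ck_differentiable[of 0 f] by simp

lemma smooth_continuous: "smooth f \<Longrightarrow> continuous_on S f"
  using smooth_Ck[of f 0] continuous_on_subset by auto

lemma smooth_pd: "smooth f \<Longrightarrow> smooth (pd i f)"
  unfolding smooth_def by (metis Ck.simps(2))

lemma smoothI: "(\<And>x. f differentiable (at x)) \<Longrightarrow> (\<And>i. smooth (pd i f)) \<Longrightarrow> smooth f"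
  unfolding smooth_def
proof
  fix n assume *: "\<And>x. f differentiable (at x)" "\<And>i. \<forall>n. Ck n (pd i f)"
  show "Ck n f"
  proof (cases n)
    case 0
    then show ?thesis using * by (simp add: differentiable_imp_continuous_on differentiable_on_def)
  next
    case (Suc m)
    then show ?thesis using * Ck_Suc_I by blast
  qed
qed

lemma has_derivative_pd:
  assumes "f differentiable (at x)"
  shows "(f has_derivative (\<lambda>h. \<Sum>i\<in>UNIV. h $ i * pd i f x)) (at x)"
proof -
  have D: "(f has_derivative frechet_derivative f (at x)) (at x)"
    using assms frechet_derivative_works by blast
  then have lin: "linear (frechet_derivative f (at x))" by (rule has_derivative_linear)
  have "frechet_derivative f (at x) h = (\<Sum>i\<in>UNIV. h $ i * pd i f x)" for h
  proof -
    have "h = (\<Sum>i\<in>UNIV. (h $ i) *\<^sub>R axis i 1)"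
      by (simp add: vec_eq_iff axis_def if_distrib cong: if_cong)
    then have "frechet_derivative f (at x) h = frechet_derivative f (at x) (\<Sum>i\<in>UNIV. (h $ i) *\<^sub>R axis i 1)" by simp
    also have "\<dots> = (\<Sum>i\<in>UNIV. h $ i * pd i f x)"
      by (simp add: linear_sum[OF lin] linear_scale[OF lin] pd_def)
    finally show ?thesis .
  qed
  with D show ?thesis by (metis (no_types, lifting) ext)
qed

lemma has_derivative_grad:
  assumes "f differentiable (at x)"
  shows "(f has_derivative (\<lambda>h. h \<bullet> grad f x)) (at x)"
  using has_derivative_pd[OF assms] by (simp add: inner_vec_def grad_def)

lemma line_has_derivative_direction:
  assumes "smooth f"
  shows "((\<lambda>t. f (x + t *\<^sub>R e)) has_real_derivative e \<bullet> grad f (x + t *\<^sub>R e)) (at t)"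
proof -
  have "((\<lambda>t. x + t *\<^sub>R e) has_derivative (\<lambda>h. h *\<^sub>R e)) (at t)"
    by (auto intro!: derivative_eq_intros)
  from has_derivative_compose[OF this has_derivative_grad[OF smooth_differentiable[OF assms]]]
  have "((\<lambda>t. f (x + t *\<^sub>R e)) has_derivative (\<lambda>h. h * (e \<bullet> grad f (x + t *\<^sub>R e)))) (at t)" by simp
  moreover have "(\<lambda>h. h * (e \<bullet> grad f (x + t *\<^sub>R e))) = (*) (e \<bullet> grad f (x + t *\<^sub>R e))"
    by (simp add: fun_eq_iff mult.commute)
  ultimately show ?thesis by (simp only: has_field_derivative_def)
qed

lemma pd_const [simp]: "pd i (\<lambda>x. c) = (\<lambda>x. 0)"
  by (rule ext, subst pd_eqI[of _ "\<lambda>_. 0"]) auto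

lemma pd_add: "f differentiable (at x) \<Longrightarrow> g differentiable (at x) \<Longrightarrow>
    pd i (\<lambda>x. f x + g x) x = pd i f x + pd i g x"
  by (rule pd_eqI[OF has_derivative_add[OF has_derivative_pd has_derivative_pd], THEN trans])
     (auto simp: axis_def if_distrib if_distribR cong: if_cong)

lemma pd_mult: "f differentiable (at x) \<Longrightarrow> g differentiable (at x) \<Longrightarrow>
    pd i (\<lambda>x. f x * g x) x = f x * pd i g x + pd i f x * g x"
  by (rule pd_eqI[OF has_derivative_mult[OF has_derivative_pd has_derivative_pd], THEN trans])
     (auto simp: axis_def if_distrib if_distribR cong: if_cong)

lemma pd_component: "pd i (\<lambda>x. x $ j) x = (if i = j then 1 else 0)"
  by (subst pd_eqI[of _ "\<lambda>h. h $ j"])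
     (auto simp: axis_def intro!: bounded_linear_imp_has_derivative bounded_linear_vec_nth)

lemma smooth_const: "smooth (\<lambda>x. c)"
proof -
  have "Ck n (\<lambda>x. c)" for n c by (induction n arbitrary: c) auto
  then show ?thesis by (simp add: smooth_def)
qed

lemma smooth_component: "smooth (\<lambda>x. x $ j)"
proof (rule smoothI)
  show "(\<lambda>x. x $ j) differentiable (at x)" for x :: "real^3"
    by (intro bounded_linear_imp_differentiable bounded_linear_vec_nth)
  show "smooth (pd i (\<lambda>x. x $ j))" for i
    by (subst ext[where f = "pd i (\<lambda>x. x $ j)", OF pd_component]) (rule smooth_const)
qed

lemma Ck_add: "Ck n f \<Longrightarrow> Ck n g \<Longrightarrow> Ck n (\<lambda>x. f x + g x)"
proof (induction n arbitrary: f g)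
  case (Suc n)
  have "pd i (\<lambda>x. f x + g x) = (\<lambda>x. pd i f x + pd i g x)" for i
    using Ck_differentiable[OF Suc.prems(1)] Ck_differentiable[OF Suc.prems(2)] by (intro ext pd_add)
  with Suc show ?case
    by (intro Ck_Suc_I) (auto simp: differentiable_on_def)
qed (auto intro: continuous_intros)

lemma Ck_mult: "Ck n f \<Longrightarrow> Ck n g \<Longrightarrow> Ck n (\<lambda>x. f x * g x)"
proof (induction n arbitrary: f g)
  case (Suc n)
  have "pd i (\<lambda>x. f x * g x) = (\<lambda>x. f x * pd i g x + pd i f x * g x)" for i
    using Ck_differentiable[OF Suc.prems(1)] Ck_differentiable[OF Suc.prems(2)] by (intro ext pd_mult)
  moreover have "Ck n (\<lambda>x. f x * pd i g x + pd i f x * g x)" for i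
    using Suc.prems Suc.prems[THEN Ck_Suc_D] by (intro Ck_add Suc.IH) auto
  ultimately show ?case using Ck_differentiable[OF Suc.prems(1)] Ck_differentiable[OF Suc.prems(2)]
    by (intro Ck_Suc_I differentiable_mult) simp_all
qed (auto intro: continuous_intros)

lemma smooth_add: "smooth f \<Longrightarrow> smooth g \<Longrightarrow> smooth (\<lambda>x. f x + g x)"
  by (simp add: smooth_def Ck_add)

lemma smooth_mult: "smooth f \<Longrightarrow> smooth g \<Longrightarrow> smooth (\<lambda>x. f x * g x)"
  by (simp add: smooth_def Ck_mult)

lemma smooth_cmult: "smooth f \<Longrightarrow> smooth (\<lambda>x. c * f x)"
  by (intro smooth_mult smooth_const)

lemma smooth_uminus: "smooth f \<Longrightarrow> smooth (\<lambda>x. - f x)"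
  using smooth_cmult[of f "-1"] by simp

lemma smooth_diff: "smooth f \<Longrightarrow> smooth g \<Longrightarrow> smooth (\<lambda>x. f x - g x)"
  using smooth_add[OF _ smooth_uminus] by simp

lemma smooth_sum: "(\<And>i. i \<in> I \<Longrightarrow> smooth (f i)) \<Longrightarrow> smooth (\<lambda>x. \<Sum>i\<in>I. f i x)"
  by (induction I rule: infinite_finite_induct) (auto intro: smooth_add smooth_const)

lemma smooth_prod: "(\<And>i. i \<in> I \<Longrightarrow> smooth (f i)) \<Longrightarrow> smooth (\<lambda>x. \<Prod>i\<in>I. f i x)"
  by (induction I rule: infinite_finite_induct) (auto intro: smooth_mult smooth_const)

lemma smooth_inner: "smooth (\<lambda>x. x \<bullet> b)"
  unfolding inner_vec_def by (auto intro!: smooth_sum smooth_mult smooth_const smooth_component)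

lemma smooth_inner_self: "smooth (\<lambda>x. (x - p) \<bullet> (x - p))"
  unfolding inner_vec_def by (auto intro!: smooth_sum smooth_mult smooth_diff smooth_const smooth_component)

lemmas smooth_intros = smooth_const smooth_component smooth_add smooth_mult smooth_uminus smooth_diff
  smooth_sum smooth_prod smooth_pd

lemma pd_smooth_add: "smooth f \<Longrightarrow> smooth g \<Longrightarrow> pd i (\<lambda>x. f x + g x) = (\<lambda>x. pd i f x + pd i g x)"
  by (intro ext pd_add smooth_differentiable)

lemma pd_smooth_mult: "smooth f \<Longrightarrow> smooth g \<Longrightarrow> pd i (\<lambda>x. f x * g x) = (\<lambda>x. f x * pd i g x + pd i f x * g x)"
  by (intro ext pd_mult smooth_differentiable)

lemma pd_cmult: "smooth f \<Longrightarrow> pd i (\<lambda>x. c * f x) = (\<lambda>x. c * pd i f x)"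
  by (simp add: pd_smooth_mult smooth_const)

lemma pd_uminus: "smooth f \<Longrightarrow> pd i (\<lambda>x. - f x) = (\<lambda>x. - pd i f x)"
  using pd_cmult[of f i "-1"] by simp

lemma pd_diff: "smooth f \<Longrightarrow> smooth g \<Longrightarrow> pd i (\<lambda>x. f x - g x) = (\<lambda>x. pd i f x - pd i g x)"
  using pd_smooth_add[of f "\<lambda>x. - g x"] by (simp add: smooth_uminus pd_uminus)

lemma pd_inner: "pd i (\<lambda>x. x \<bullet> b) x = b $ i"
  by (subst pd_eqI[of _ "\<lambda>h. h \<bullet> b"])
     (auto intro!: bounded_linear_imp_has_derivative bounded_linear_inner_left simp: inner_axis')

lemma pd_affine:
  assumes "f differentiable (at (a + c *\<^sub>R x))"
  shows "pd i (\<lambda>x. f (a + c *\<^sub>R x)) x = c * pd i f (a + c *\<^sub>R x)"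
proof -
  have 1: "((\<lambda>x. a + c *\<^sub>R x) has_derivative (\<lambda>h. c *\<^sub>R h)) (at x)"
    by (auto intro!: derivative_eq_intros)
  have "((\<lambda>x. f (a + c *\<^sub>R x)) has_derivative (\<lambda>h. \<Sum>i\<in>UNIV. (c *\<^sub>R h) $ i * pd i f (a + c *\<^sub>R x))) (at x)"
    using has_derivative_compose[OF 1 has_derivative_pd[OF assms]] .
  from pd_eqI[OF this, of i] show ?thesis
    by (simp add: axis_def if_distrib if_distribR cong: if_cong)
qed

lemma differentiable_affine:
  fixes f :: "real^3 \<Rightarrow> real"
  assumes "\<And>x. f differentiable (at x)"
  shows "(\<lambda>x. f (a + c *\<^sub>R x)) differentiable (at x)"
  by (rule differentiable_compose[OF assms]) (auto intro!: derivative_intros)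

lemma smooth_affine: assumes "smooth f" shows "smooth (\<lambda>x. f (a + c *\<^sub>R x))"
proof -
  have "Ck n (\<lambda>x. f (a + c *\<^sub>R x))" if "smooth f" for f n
    using that
  proof (induction n arbitrary: f)
    case 0
    have "continuous_on UNIV f" by (rule smooth_continuous[OF 0])
    then show ?case by (auto intro!: continuous_on_compose2[of UNIV f] continuous_intros)
  next
    case (Suc n)
    have "pd i (\<lambda>x. f (a + c *\<^sub>R x)) = (\<lambda>x. c * pd i f (a + c *\<^sub>R x))" for i
      by (intro ext pd_affine smooth_differentiable Suc)
    moreover have "Ck n (\<lambda>x. c * pd i f (a + c *\<^sub>R x))" for i
      by (intro Ck_mult Suc.IH smooth_pd Suc.prems smooth_Ck[OF smooth_const])
    ultimately show ?case
      by (intro Ck_Suc_I differentiable_affine smooth_differentiable Suc.prems) auto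
  qed
  with assms show ?thesis by (simp add: smooth_def)
qed

lemma line_has_derivative:
  assumes "smooth f"
  shows "((\<lambda>t. f (x + t *\<^sub>R axis i 1)) has_real_derivative pd i f (x + t *\<^sub>R axis i 1)) (at t)"
  using line_has_derivative_direction[OF assms, of x "axis i 1" t] by (simp add: inner_axis' grad_def)

text \<open>Both iterated derivatives are limits of the symmetric second difference.\<close>

lemma second_difference:
  assumes f: "smooth f" and h: "h > 0"
  shows "\<exists>y. norm (y - x) \<le> 2 * h \<and>
    f (x + h *\<^sub>R axis i 1 + h *\<^sub>R axis j 1) - f (x + h *\<^sub>R axis i 1) - f (x + h *\<^sub>R axis j 1) + f x
      = h * h * pd j (pd i f) y"
proof -
  let ?e = "axis i (1::real)" and ?d = "axis j (1::real)"
  define \<phi> where "\<phi> t = f ((x + h *\<^sub>R ?d) + t *\<^sub>R ?e) - f (x + t *\<^sub>R ?e)" for t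
  have "(\<phi> has_real_derivative (pd i f ((x + h *\<^sub>R ?d) + t *\<^sub>R ?e) - pd i f (x + t *\<^sub>R ?e))) (at t)" for t
    unfolding \<phi>_def by (intro DERIV_diff line_has_derivative f)
  from MVT2[OF h this]
  obtain s where s: "0 < s" "s < h" "\<phi> h - \<phi> 0 = h * (pd i f ((x + h *\<^sub>R ?d) + s *\<^sub>R ?e) - pd i f (x + s *\<^sub>R ?e))"
    by auto
  from MVT2[OF h line_has_derivative[OF smooth_pd[OF f, of i], of "x + s *\<^sub>R ?e" j]]
  obtain t where t: "0 < t" "t < h"
    "pd i f (x + s *\<^sub>R ?e + h *\<^sub>R ?d) - pd i f (x + s *\<^sub>R ?e) = h * pd j (pd i f) (x + s *\<^sub>R ?e + t *\<^sub>R ?d)"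
    by auto
  have "norm (s *\<^sub>R ?e + t *\<^sub>R ?d) \<le> norm (s *\<^sub>R ?e) + norm (t *\<^sub>R ?d)" by (rule norm_triangle_ineq)
  then have "norm (x + s *\<^sub>R ?e + t *\<^sub>R ?d - x) \<le> 2 * h" using s t by (simp add: algebra_simps)
  moreover have "f (x + h *\<^sub>R ?e + h *\<^sub>R ?d) - f (x + h *\<^sub>R ?e) - f (x + h *\<^sub>R ?d) + f x = \<phi> h - \<phi> 0"
    unfolding \<phi>_def by (simp add: algebra_simps)
  moreover have "\<phi> h - \<phi> 0 = h * h * pd j (pd i f) (x + s *\<^sub>R ?e + t *\<^sub>R ?d)"
    using s(3) t(3) by (simp add: algebra_simps)
  ultimately show ?thesis by metis
qed

lemma pd_commute:
  assumes f: "smooth f"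
  shows "pd i (pd j f) = pd j (pd i f)"
proof
  fix x
  define g where "g n = inverse (real (Suc n))" for n
  have g: "g n > 0" for n by (simp add: g_def)
  have "\<forall>n. \<exists>y. norm (y - x) \<le> 2 * g n \<and>
    f (x + g n *\<^sub>R axis i 1 + g n *\<^sub>R axis j 1) - f (x + g n *\<^sub>R axis i 1) - f (x + g n *\<^sub>R axis j 1) + f x
      = g n * g n * pd j (pd i f) y" using second_difference[OF f g] by blast
  then obtain y where y: "\<And>n. norm (y n - x) \<le> 2 * g n" "\<And>n.
    f (x + g n *\<^sub>R axis i 1 + g n *\<^sub>R axis j 1) - f (x + g n *\<^sub>R axis i 1) - f (x + g n *\<^sub>R axis j 1) + f x
      = g n * g n * pd j (pd i f) (y n)" by metis
  have "\<forall>n. \<exists>y. norm (y - x) \<le> 2 * g n \<and>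
    f (x + g n *\<^sub>R axis j 1 + g n *\<^sub>R axis i 1) - f (x + g n *\<^sub>R axis j 1) - f (x + g n *\<^sub>R axis i 1) + f x
      = g n * g n * pd i (pd j f) y" using second_difference[OF f g] by blast
  then obtain z where z: "\<And>n. norm (z n - x) \<le> 2 * g n" "\<And>n.
    f (x + g n *\<^sub>R axis j 1 + g n *\<^sub>R axis i 1) - f (x + g n *\<^sub>R axis j 1) - f (x + g n *\<^sub>R axis i 1) + f x
      = g n * g n * pd i (pd j f) (z n)" by metis
  have eq: "pd j (pd i f) (y n) = pd i (pd j f) (z n)" for n
  proof -
    have "g n * g n * pd j (pd i f) (y n) = g n * g n * pd i (pd j f) (z n)"
      unfolding y(2)[symmetric] z(2)[symmetric] by (simp add: algebra_simps)
    then show ?thesis using g[of n] by simp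
  qed
  have g0: "(\<lambda>n. 2 * g n) \<longlonglongrightarrow> 0"
    unfolding g_def using tendsto_mult_left[OF LIMSEQ_inverse_real_of_nat, of 2] by simp
  have lim: "w \<longlonglongrightarrow> x" if "\<And>n. norm (w n - x) \<le> 2 * g n" for w
    using Lim_null_comparison[OF _ g0, of "\<lambda>n. w n - x"] that by (simp add: LIM_zero_iff)
  have c: "(\<lambda>n. F (w n)) \<longlonglongrightarrow> F x" if "smooth F" "\<And>n. norm (w n - x) \<le> 2 * g n" for F w
    using continuous_on_tendsto_compose[OF smooth_continuous[OF that(1), of UNIV] lim[OF that(2)]] by simp
  have "(\<lambda>n. pd j (pd i f) (y n)) \<longlonglongrightarrow> pd j (pd i f) x"
    by (intro c smooth_pd f y)
  moreover have "(\<lambda>n. pd j (pd i f) (y n)) \<longlonglongrightarrow> pd i (pd j f) x"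
    unfolding eq by (intro c smooth_pd f z)
  ultimately show "pd i (pd j f) x = pd j (pd i f) x" by (metis LIMSEQ_unique)
qed

section \<open>Test functions\<close>

text \<open>Regularity of one-variable profiles. The existential derivative lets a closed formula be
  supplied at each order, and composition with a smooth function of \<open>x\<close> then lands in
  \<open>Ck\<close>.\<close>

fun Ck1 :: "nat \<Rightarrow> (real \<Rightarrow> real) \<Rightarrow> bool" where
  "Ck1 0 h = continuous_on UNIV h"
| "Ck1 (Suc n) h = (\<exists>h'. (\<forall>t. (h has_real_derivative h' t) (at t)) \<and> Ck1 n h')"

lemma Ck1_compose:
  assumes "Ck1 n h" "smooth s"
  shows "Ck n (\<lambda>x. h (s x))"
  using assms(1)
proof (induction n arbitrary: h)
  case 0
  then show ?case using smooth_continuous[OF assms(2), of UNIV]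
    by (auto intro: continuous_on_compose2)
next
  case (Suc n)
  then obtain h' where h': "\<And>t. (h has_real_derivative h' t) (at t)" "Ck1 n h'" by auto
  have D: "((\<lambda>x. h (s x)) has_derivative (\<lambda>k. h' (s x) * (\<Sum>i\<in>UNIV. k $ i * pd i s x))) (at x)" for x
    using has_derivative_compose[OF has_derivative_pd[OF smooth_differentiable[OF assms(2)]]
        h'(1)[unfolded has_field_derivative_def]] .
  have "pd i (\<lambda>x. h (s x)) x = h' (s x) * pd i s x" for i x
    using pd_eqI[OF D, of i x] by (simp add: axis_def if_distrib if_distribR cong: if_cong)
  then have "pd i (\<lambda>x. h (s x)) = (\<lambda>x. h' (s x) * pd i s x)" for i by auto
  moreover have "Ck n (\<lambda>x. h' (s x) * pd i s x)" for i
    by (intro Ck_mult Suc.IH h' smooth_Ck smooth_pd assms)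
  ultimately show ?case
    using D by (intro Ck_Suc_I) (auto simp: differentiable_def)
qed

lemma Ck1_affine:
  assumes "Ck1 n h" shows "Ck1 n (\<lambda>t. c * h (a + b * t) + d)"
  using assms
proof (induction n arbitrary: h c d)
  case 0
  then show ?case by (auto intro!: continuous_intros continuous_on_compose2[of UNIV h])
next
  case (Suc n)
  then obtain h' where h': "\<And>t. (h has_real_derivative h' t) (at t)" "Ck1 n h'" by auto
  have "((\<lambda>t. c * h (a + b * t) + d) has_real_derivative (c * b) * h' (a + b * t) + 0) (at t)" for t
  proof -
    have "((\<lambda>t. a + b * t) has_real_derivative b) (at t)" by (auto intro!: derivative_eq_intros)
    from DERIV_chain2[OF h'(1) this]
    show ?thesis by (auto intro!: derivative_eq_intros)
  qed
  moreover have "Ck1 n (\<lambda>t. (c * b) * h' (a + b * t) + 0)" by (intro Suc.IH h')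
  ultimately show ?case by (auto intro!: exI[of _ "\<lambda>t. c * b * h' (a + b * t)"])
qed

lemma Ck1_add:
  assumes "Ck1 n h" "Ck1 n k" shows "Ck1 n (\<lambda>t. h t + k t)"
  using assms
proof (induction n arbitrary: h k)
  case (Suc n)
  then obtain h' k' where "\<And>t. (h has_real_derivative h' t) (at t)" "Ck1 n h'"
    "\<And>t. (k has_real_derivative k' t) (at t)" "Ck1 n k'" by auto
  then have "\<And>t. ((\<lambda>t. h t + k t) has_real_derivative h' t + k' t) (at t)" "Ck1 n (\<lambda>t. h' t + k' t)"
    by (auto intro!: DERIV_add Suc.IH)
  then show ?case by (auto intro!: exI[of _ "\<lambda>t. h' t + k' t"])
qed (auto intro: continuous_intros)

lemma Ck1_Suc_D: "Ck1 (Suc n) h \<Longrightarrow> Ck1 n h"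
proof (induction n arbitrary: h)
  case 0
  then obtain h' where "\<And>t. (h has_real_derivative h' t) (at t)" by auto
  then have "continuous_on UNIV h" by (rule DERIV_continuous_on)
  then show ?case by simp
qed fastforce

lemma Ck1_mult:
  assumes "Ck1 n h" "Ck1 n k" shows "Ck1 n (\<lambda>t. h t * k t)"
  using assms
proof (induction n arbitrary: h k)
  case (Suc n)
  then obtain h' k' where *: "\<And>t. (h has_real_derivative h' t) (at t)" "Ck1 n h'"
    "\<And>t. (k has_real_derivative k' t) (at t)" "Ck1 n k'" by auto
  then have "((\<lambda>t. h t * k t) has_real_derivative h' t * k t + k' t * h t) (at t)" for t
    by (intro DERIV_mult)
  moreover have "Ck1 n (\<lambda>t. h' t * k t + k' t * h t)"
    using Suc.prems[THEN Ck1_Suc_D] * by (intro Ck1_add Suc.IH)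
  ultimately show ?case by (auto intro!: exI[of _ "\<lambda>t. h' t * k t + k' t * h t"])
qed (auto intro: continuous_intros)

text \<open>For \<open>p = 1\<close> this is the classical smooth, non-analytic
  \<open>exp (- 1 / t)\<close>. Allowing all polynomials in \<open>1 / t\<close> makes the family
  closed under differentiation, so smoothness is a plain induction.\<close>

definition flat :: "real poly \<Rightarrow> real \<Rightarrow> real" where
  "flat p t = (if t > 0 then poly p (1 / t) * exp (- 1 / t) else 0)"

lemma flat_tendsto_0: fixes p :: "real poly" shows "((\<lambda>t. poly p (1 / t) * exp (- 1 / t)) \<longlongrightarrow> 0) (at_right 0)"
proof -
  have "((\<lambda>x::real. \<Sum>i\<le>degree p. coeff p i * (x ^ i / exp x)) \<longlongrightarrow> 0) at_top"
    by (intro tendsto_null_sum tendsto_mult_right_zero tendsto_power_div_exp_0)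
  then have "((\<lambda>x. poly p x / exp x) \<longlongrightarrow> 0) at_top"
    by (simp add: poly_altdef sum_divide_distrib)
  then have "((\<lambda>t. poly p (inverse t) / exp (inverse t)) \<longlongrightarrow> 0) (at_right 0)"
    by (rule filterlim_compose[OF _ filterlim_inverse_at_top_right])
  then show ?thesis by (simp add: exp_minus field_simps)
qed

lemma flat_has_derivative:
  "(flat p has_real_derivative flat ([:0, 0, 1:] * (p - pderiv p)) t) (at t)"
proof -
  consider "t > 0" | "t < 0" | "t = 0" by linarith
  then show ?thesis
  proof cases
    case 1
    have D: "((\<lambda>t. poly p (1 / t) * exp (- 1 / t)) has_real_derivative
        flat ([:0, 0, 1:] * (p - pderiv p)) t) (at t)"
      using 1 by (auto intro!: derivative_eq_intros DERIV_chain'[OF _ poly_DERIV]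
          simp: flat_def field_simps power2_eq_square)
    have "\<forall>\<^sub>F s in nhds t. flat p s = poly p (1 / s) * exp (- 1 / s)"
      using 1 eventually_nhds_in_open[of "{0<..}" t] by (auto simp: flat_def elim!: eventually_mono)
    from DERIV_cong_ev[OF refl this refl, THEN iffD2, OF D] show ?thesis .
  next
    case 2
    have "\<forall>\<^sub>F s in nhds t. flat p s = 0"
      using 2 eventually_nhds_in_open[of "{..<0}" t] by (auto simp: flat_def elim!: eventually_mono)
    from DERIV_cong_ev[OF refl this refl, THEN iffD2, OF DERIV_const[of 0]]
    have "(flat p has_real_derivative 0) (at t)" .
    moreover have "flat ([:0, 0, 1:] * (p - pderiv p)) t = 0" using 2 by (simp add: flat_def)
    ultimately show ?thesis by simp
  next
    case 3
    \<comment> \<open>Dividing by \<open>h\<close> multiplies the polynomial in \<open>1 / h\<close>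
      by its variable, so the quotient is again of the flat form, with
      \<open>pCons 0 p\<close>.\<close>
    have "((\<lambda>h. flat p h / h) \<longlongrightarrow> 0) (at_right 0)"
    proof (rule Lim_transform_eventually[OF flat_tendsto_0[of "pCons 0 p"]])
      show "\<forall>\<^sub>F h in at_right 0. poly (pCons 0 p) (1 / h) * exp (- 1 / h) = flat p h / h"
        by (auto simp: flat_def eventually_at_filter)
    qed
    moreover have "((\<lambda>h. flat p h / h) \<longlongrightarrow> 0) (at_left 0)"
      by (rule tendsto_eventually) (auto simp: flat_def eventually_at_filter)
    ultimately have "((\<lambda>h. flat p h / h) \<longlongrightarrow> 0) (at 0)" by (simp add: filterlim_split_at)
    then show ?thesis using 3 by (simp add: DERIV_def flat_def)
  qed
qed

lemma Ck1_flat: "Ck1 n (flat p)"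
proof (induction n arbitrary: p)
  case 0
  then show ?case using flat_has_derivative by (auto intro!: DERIV_continuous_on)
next
  case (Suc n)
  then show ?case using flat_has_derivative by auto
qed

text \<open>The step is the normalised antiderivative of the bump
  \<open>flat 1 t * flat 1 (1 - t)\<close>, which lives on the unit interval.\<close>

lemma exists_smooth_step:
  "\<exists>H :: real \<Rightarrow> real. (\<forall>n. Ck1 n H) \<and> (\<forall>t\<le>0. H t = 0) \<and> (\<forall>t\<ge>1. H t = 1)"
proof -
  define g where "g t = flat 1 t * flat 1 (1 + (-1) * t)" for t
  have g: "Ck1 n g" for n
  proof -
    have "Ck1 n (\<lambda>t. 1 * flat 1 (1 + (-1) * t) + 0)" by (intro Ck1_affine Ck1_flat)
    then show ?thesis unfolding g_def by (intro Ck1_mult Ck1_flat) simp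
  qed
  have g0: "g t = 0" if "t \<le> 0 \<or> t \<ge> 1" for t using that by (auto simp: g_def flat_def)
  have gp: "g t > 0" if "0 < t" "t < 1" for t using that by (auto simp: g_def flat_def)
  have cont: "isCont g t" for t using g[of 0] by (simp add: continuous_on_eq_continuous_at)
  obtain F where "\<And>t. (F has_vector_derivative g t) (at t)"
    using einterval_antiderivative[of "-\<infinity>" \<infinity> g] cont by auto
  then have F: "(F has_real_derivative g t) (at t)" for t
    by (simp add: has_real_derivative_iff_has_vector_derivative)
  have F0: "F t = F 0" if "t \<le> 0" for t
  proof (cases "t = 0")
    case False
    then have "t < 0" using that by simp
    from MVT2[OF this F] obtain z where "z < 0" "F 0 - F t = (0 - t) * g z" by auto
    then show ?thesis using g0[of z] by simp
  qed simp
  have F1: "F t = F 1" if "t \<ge> 1" for t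
  proof (cases "t = 1")
    case False
    then have "1 < t" using that by simp
    from MVT2[OF this F] obtain z where "1 < z" "F t - F 1 = (t - 1) * g z" by auto
    then show ?thesis using g0[of z] by simp
  qed simp
  have "F 0 < F 1"
    using MVT2[of 0 1 F g] F gp by force
  define H where "H t = inverse (F 1 - F 0) * F (0 + 1 * t) + (- F 0 * inverse (F 1 - F 0))" for t
  have "Ck1 n F" for n
  proof (cases n)
    case 0
    then show ?thesis using F by (auto intro!: DERIV_continuous_on)
  next
    case (Suc m)
    then show ?thesis using F g by auto
  qed
  then have "Ck1 n H" for n unfolding H_def by (intro Ck1_affine)
  moreover have *: "H t = (F t - F 0) / (F 1 - F 0)" for t by (simp add: H_def divide_inverse algebra_simps)
  have "H t = 0" if "t \<le> 0" for t unfolding * F0[OF that] by simp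
  moreover have "H t = 1" if "t \<ge> 1" for t unfolding * F1[OF that] using \<open>F 0 < F 1\<close> by simp
  ultimately show ?thesis by blast
qed

lemma test_fun_iff:
  "test_fun \<Omega> f \<longleftrightarrow> smooth f \<and> (\<exists>K. compact K \<and> K \<subseteq> \<Omega> \<and> (\<forall>x. x \<notin> K \<longrightarrow> f x = 0))"
proof
  assume "test_fun \<Omega> f"
  then show "smooth f \<and> (\<exists>K. compact K \<and> K \<subseteq> \<Omega> \<and> (\<forall>x. x \<notin> K \<longrightarrow> f x = 0))"
    unfolding test_fun_def using closure_subset[of "{x. f x \<noteq> 0}"] by blast
next
  assume "smooth f \<and> (\<exists>K. compact K \<and> K \<subseteq> \<Omega> \<and> (\<forall>x. x \<notin> K \<longrightarrow> f x = 0))"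
  then obtain K where K: "smooth f" "compact K" "K \<subseteq> \<Omega>" "\<And>x. x \<notin> K \<Longrightarrow> f x = 0" by blast
  then have "closure {x. f x \<noteq> 0} \<subseteq> K" by (intro closure_minimal compact_imp_closed) auto
  moreover have "closure {x. f x \<noteq> 0} = K \<inter> closure {x. f x \<noteq> 0}" using calculation by blast
  then have "compact (closure {x. f x \<noteq> 0})" using compact_Int_closed[OF K(2) closed_closure] by metis
  ultimately show "test_fun \<Omega> f" using K by (auto simp: test_fun_def)
qed

lemma test_fun_smooth: "test_fun \<Omega> f \<Longrightarrow> smooth f"
  by (simp add: test_fun_def)

lemma test_fun_mono: "test_fun A f \<Longrightarrow> A \<subseteq> B \<Longrightarrow> test_fun B f"
  by (auto simp: test_fun_def)

lemma test_fun_zero: "test_fun \<Omega> (\<lambda>x. 0)"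
  by (simp add: test_fun_def smooth_const)

lemma test_fun_mult_right: "test_fun \<Omega> f \<Longrightarrow> smooth g \<Longrightarrow> test_fun \<Omega> (\<lambda>x. f x * g x)"
  unfolding test_fun_iff by (auto intro: smooth_mult)

lemma test_fun_mult_left: "test_fun \<Omega> f \<Longrightarrow> smooth g \<Longrightarrow> test_fun \<Omega> (\<lambda>x. g x * f x)"
  unfolding test_fun_iff by (auto intro: smooth_mult)

lemma test_fun_add: "test_fun \<Omega> f \<Longrightarrow> test_fun \<Omega> g \<Longrightarrow> test_fun \<Omega> (\<lambda>x. f x + g x)"
proof -
  assume "test_fun \<Omega> f" "test_fun \<Omega> g"
  then obtain K L where "smooth f" "compact K" "K \<subseteq> \<Omega>" "\<forall>x. x \<notin> K \<longrightarrow> f x = 0"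
    "smooth g" "compact L" "L \<subseteq> \<Omega>" "\<forall>x. x \<notin> L \<longrightarrow> g x = 0" unfolding test_fun_iff by blast
  then show ?thesis unfolding test_fun_iff
    by (intro conjI exI[of _ "K \<union> L"] smooth_add) auto
qed

lemma test_fun_cmult: "test_fun \<Omega> f \<Longrightarrow> test_fun \<Omega> (\<lambda>x. c * f x)"
  by (intro test_fun_mult_left smooth_const)

lemma pd_cong_open:
  assumes "open S" "x \<in> S" "\<And>y. y \<in> S \<Longrightarrow> f y = g y" "g differentiable (at x)"
  shows "pd i f x = pd i g x"
proof (rule pd_eqI[THEN trans])
  show "(f has_derivative frechet_derivative g (at x)) (at x)"
    using assms(4)[unfolded frechet_derivative_works] assms(1,2)
    by (rule has_derivative_transform_within_open) (simp add: assms(3))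
qed (simp add: pd_def)

lemma test_fun_pd: assumes "test_fun \<Omega> f" shows "test_fun \<Omega> (pd i f)"
proof -
  obtain K where K: "smooth f" "compact K" "K \<subseteq> \<Omega>" "\<And>x. x \<notin> K \<Longrightarrow> f x = 0"
    using assms unfolding test_fun_iff by blast
  have "pd i f x = 0" if "x \<notin> K" for x
    using pd_cong_open[of "- K" x f "\<lambda>_. 0" i] K that compact_imp_closed[OF K(2)] by auto
  with K show ?thesis unfolding test_fun_iff by (auto intro: smooth_pd)
qed

lemma exists_plateau:
  assumes "r > 0"
  shows "\<exists>\<eta>. test_fun (ball p r) \<eta> \<and> (\<forall>x\<in>ball p (r/2). \<eta> x = 1)"
proof -
  obtain H :: "real \<Rightarrow> real" where H: "\<And>n. Ck1 n H" "\<And>t. t \<le> 0 \<Longrightarrow> H t = 0" "\<And>t. t \<ge> 1 \<Longrightarrow> H t = 1"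
    using exists_smooth_step by auto
  \<comment> \<open>The affine function of the squared distance with value 1 at radius
    \<open>r/2\<close> and 0 at radius \<open>sqrt (3/4) * r\<close>; the latter is below
    \<open>r\<close>, so the support is compact inside the ball.\<close>
  define s where "s x = (2 / r^2) * (3/4 * r^2 - (x - p) \<bullet> (x - p))" for x :: "real^3"
  have s: "smooth s" unfolding s_def by (intro smooth_cmult smooth_diff smooth_const smooth_inner_self)
  have 1: "H (s x) = 1" if "x \<in> ball p (r/2)" for x
  proof (rule H(3))
    have "norm (x - p) < r/2" using that by (simp add: dist_norm norm_minus_commute)
    then have "(norm (x - p))^2 \<le> (r/2)^2" by (intro power_mono) auto
    then have "(x - p) \<bullet> (x - p) \<le> 1/4 * r^2" by (simp add: power2_norm_eq_inner power_divide)
    then show "s x \<ge> 1" using assms by (simp add: s_def field_simps)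
  qed
  have "smooth (\<lambda>x. H (s x))" using Ck1_compose[OF H(1) s] by (simp add: smooth_def)
  moreover have "H (s x) = 0" if "x \<notin> cball p (sqrt (3/4) * r)" for x
  proof (rule H(2))
    have "sqrt (3/4) * r < norm (x - p)" using that by (simp add: dist_norm norm_minus_commute)
    then have "(sqrt (3/4) * r)^2 \<le> (norm (x - p))^2" using assms by (intro power_mono) auto
    then have "3/4 * r^2 \<le> (x - p) \<bullet> (x - p)" by (simp add: power_mult_distrib power2_norm_eq_inner)
    then show "s x \<le> 0" unfolding s_def by (intro mult_nonneg_nonpos) auto
  qed
  moreover have "cball p (sqrt (3/4) * r) \<subseteq> ball p r"
  proof -
    have "sqrt (3/4) < (1::real)" by (simp add: real_sqrt_lt_1_iff)
    then have "sqrt (3/4) * r < r" using assms by simp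
    then show ?thesis by auto
  qed
  ultimately have "test_fun (ball p r) (\<lambda>x. H (s x))"
    unfolding test_fun_iff using compact_cball by blast
  with 1 show ?thesis by blast
qed

section \<open>Integration by parts\<close>

lemma L2_iff_sq_int: "L2 \<Omega> f \<longleftrightarrow> sq_int (lebesgue_on \<Omega>) f"
  by (simp add: L2_def sq_int_def)

lemma L2v_iff_sq_int: "L2v \<Omega> f \<longleftrightarrow> sq_int (lebesgue_on \<Omega>) f"
  by (simp add: L2v_def sq_int_def)

lemma sq_int_bounded_by:
  assumes "g \<in> borel_measurable M" "sq_int M f" "\<And>x. x \<in> space M \<Longrightarrow> norm (g x) \<le> c * norm (f x)"
  shows "sq_int M g"
proof -
  have "norm ((norm (g x))^2) \<le> norm (c^2 * (norm (f x))^2)" if "x \<in> space M" for x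
    using power_mono[OF assms(3)[OF that], of 2] by (simp add: power_mult_distrib)
  moreover have "(\<lambda>x. (norm (g x))^2) \<in> borel_measurable M" using assms(1) by auto
  moreover have "integrable M (\<lambda>x. c^2 * (norm (f x))^2)" using assms(2) by (simp add: sq_int_def)
  ultimately have "integrable M (\<lambda>x. (norm (g x))\<^sup>2)"
    using Bochner_Integration.integrable_bound[of M "\<lambda>x. c^2 * (norm (f x))^2" "\<lambda>x. (norm (g x))\<^sup>2"] AE_I2[of M]
    by blast
  with assms(1) show ?thesis by (simp add: sq_int_def)
qed

lemma ip_self_mono:
  assumes "sq_int M f" "sq_int M g" "\<And>x. x \<in> space M \<Longrightarrow> norm (g x) \<le> c * norm (f x)"
  shows "nsq M g \<le> c^2 * nsq M f"
proof -
  have "nsq M g \<le> (LINT x|M. c^2 * (norm (f x))^2)"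
    unfolding ip_self_norm
  proof (rule integral_mono)
    show "(norm (g x))^2 \<le> c^2 * (norm (f x))^2" if "x \<in> space M" for x
      using power_mono[OF assms(3)[OF that], of 2] by (simp add: power_mult_distrib)
  qed (use assms in \<open>auto simp: sq_int_def\<close>)
  then show ?thesis by (simp add: ip_self_norm)
qed

lemma L2_lim_bounded_by:
  assumes "L2_lim M f F" "\<And>n. sq_int M (f n)" "sq_int M F" "\<And>n. sq_int M (g n)" "sq_int M G"
    "\<And>n x. x \<in> space M \<Longrightarrow> norm (g n x - G x) \<le> c * norm (f n x - F x)"
  shows "L2_lim M g G"
  unfolding L2_lim_def
proof (rule Lim_null_comparison)
  show "\<forall>\<^sub>F n in sequentially. norm (nsq M (\<lambda>x. g n x - G x)) \<le>
      c^2 * nsq M (\<lambda>x. f n x - F x)"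
    using assms by (intro always_eventually allI) (auto intro!: ip_self_mono sq_int_intros)
  show "(\<lambda>n. c^2 * nsq M (\<lambda>x. f n x - F x)) \<longlonglongrightarrow> 0"
    using assms(1) unfolding L2_lim_def by (rule tendsto_mult_right_zero)
qed

lemma sq_int_component: "sq_int M f \<Longrightarrow> sq_int M (\<lambda>x. f x $ i)" for f :: "'a \<Rightarrow> real^'n"
  by (rule sq_int_bounded_by[of _ _ f 1])
     (auto dest!: sq_int_measurable simp: component_le_norm_cart
       intro!: borel_measurable_continuous_on[OF continuous_on_component[OF continuous_on_id]])

lemma L2_lim_component:
  fixes F :: "'a \<Rightarrow> real^'n"
  assumes "L2_lim M f F" "\<And>n. sq_int M (f n)" "sq_int M F"
  shows "L2_lim M (\<lambda>n x. f n x $ i) (\<lambda>x. F x $ i)"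
  by (rule L2_lim_bounded_by[OF assms, of _ _ 1])
     (use assms in \<open>auto intro: sq_int_component simp: component_le_norm_cart simp flip: vector_minus_component\<close>)

lemma sq_int_vec:
  fixes f :: "'a \<Rightarrow> real^'n"
  assumes "\<And>i. sq_int M (\<lambda>x. f x $ i)"
  shows "sq_int M f"
proof -
  have "sq_int M (\<lambda>x. \<Sum>i\<in>UNIV. f x $ i *\<^sub>R axis i (1::real))"
  proof (rule sq_int_sum)
    fix i
    have "(\<lambda>x. f x $ i) \<in> borel_measurable M" using assms sq_int_measurable by blast
    then show "sq_int M (\<lambda>x. f x $ i *\<^sub>R axis i (1::real))"
      by (intro sq_int_bounded_by[OF _ assms[of i], of _ 1]) auto
  qed
  moreover have "(\<Sum>i\<in>UNIV. f x $ i *\<^sub>R axis i (1::real)) = f x" for x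
    by (simp add: vec_eq_iff axis_def if_distrib cong: if_cong)
  ultimately show ?thesis by simp
qed

lemma ip_vec_sum:
  fixes f g :: "'a \<Rightarrow> real^'n"
  assumes "sq_int M f" "sq_int M g"
  shows "ip M f g = (\<Sum>i\<in>UNIV. ip M (\<lambda>x. f x $ i) (\<lambda>x. g x $ i))"
  unfolding ip_def inner_vec_def
  by (subst Bochner_Integration.integral_sum)
     (use sq_int_inner_integrable[OF sq_int_component[OF assms(1)] sq_int_component[OF assms(2)]] in auto)

section \<open>Integrals of derivatives of compactly supported functions\<close>

lemma integral_lebesgue_on_superset:
  fixes f :: "'a::euclidean_space \<Rightarrow> real"
  assumes "S \<in> sets lebesgue" "T \<in> sets lebesgue" "S \<subseteq> T" "\<And>x. x \<in> T - S \<Longrightarrow> f x = 0"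
  shows "(LINT x|lebesgue_on T. f x) = (LINT x|lebesgue_on S. f x)"
proof -
  have "indicator T x *\<^sub>R f x = indicator S x *\<^sub>R f x" for x
    using assms(3,4) by (auto simp: indicator_def)
  then have "(LINT x|lebesgue. indicator T x *\<^sub>R f x) = (LINT x|lebesgue. indicator S x *\<^sub>R f x)"
    by presburger
  then show ?thesis using assms(1,2) by (simp add: integral_restrict_space)
qed

lemma continuous_bounded_support:
  fixes f :: "'a::euclidean_space \<Rightarrow> 'b::real_normed_vector"
  assumes "continuous_on UNIV f" "compact K" "\<And>x. x \<notin> K \<Longrightarrow> f x = 0"
  shows "\<exists>C>0. \<forall>x. norm (f x) \<le> C"
proof -
  have "compact (f ` K)" by (intro compact_continuous_image continuous_on_subset[OF assms(1)] assms) auto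
  then obtain C where "C > 0" "\<forall>y\<in>f ` K. norm y \<le> C" using compact_imp_bounded bounded_pos by metis
  then show ?thesis using assms(3) by (metis image_eqI less_eq_real_def norm_zero)
qed

lemma continuous_sq_int:
  fixes f :: "'a::euclidean_space \<Rightarrow> 'b::euclidean_space"
  assumes "continuous_on UNIV f" "bounded \<Omega>" "open \<Omega>"
  shows "sq_int (lebesgue_on \<Omega>) f"
proof -
  have "compact (f ` closure \<Omega>)"
    using assms by (intro compact_continuous_image continuous_on_subset[OF assms(1)]) auto
  then obtain C where C: "\<And>x. x \<in> \<Omega> \<Longrightarrow> norm (f x) \<le> C"
    using compact_imp_bounded bounded_pos closure_subset by (metis image_eqI subset_iff)
  have L: "\<Omega> \<in> lmeasurable" using assms by (intro lmeasurable_open)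
  then have S: "\<Omega> \<in> sets lebesgue" by (simp add: fmeasurableD)
  interpret finite_measure "lebesgue_on \<Omega>" using L by (rule finite_measure_lebesgue_on)
  have "f \<in> borel_measurable (lebesgue_on \<Omega>)"
    by (intro continuous_imp_measurable_on_sets_lebesgue continuous_on_subset[OF assms(1)] S) auto
  moreover have "sq_int (lebesgue_on \<Omega>) (\<lambda>x. 1::real)" by (simp add: sq_int_def)
  ultimately show ?thesis using C by (intro sq_int_bounded_by[of f _ "\<lambda>x. 1::real" C]) auto
qed

lemma integrable_continuous_compact_support:
  fixes f :: "'a::euclidean_space \<Rightarrow> real"
  assumes "continuous_on UNIV f" "compact K" "\<And>x. x \<notin> K \<Longrightarrow> f x = 0"
  shows "integrable lebesgue f"
proof -
  have "integrable lborel f"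
  proof -
    have "integrable lborel (\<lambda>x. indicator K x *\<^sub>R f x)"
      using borel_integrable_compact[OF assms(2) continuous_on_subset[OF assms(1)]]
      by (auto simp: indicator_def if_distrib if_distribR cong: if_cong)
    moreover have "(\<lambda>x. indicator K x *\<^sub>R f x) = f"
      using assms(3) by (intro ext) (auto simp: indicator_def)
    ultimately show ?thesis by argo
  qed
  then show ?thesis by (simp add: integrable_completion)
qed

lemma integral_translation:
  fixes f :: "'a::euclidean_space \<Rightarrow> real"
  assumes "f \<in> borel_measurable borel"
  shows "(LINT x|lborel. f (x + a)) = (LINT x|lborel. f x)"
  by (subst (2) lborel_distr_plus[of a, symmetric])
     (simp add: integral_distr assms add.commute)

text \<open>The difference quotients in direction \<open>e\<close> have integral zero over a set invariant under
  translation by \<open>e\<close>.\<close>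

lemma integral_directional_derivative_zero:
  assumes H: "H \<in> sets borel" "\<And>x t. x + t *\<^sub>R e \<in> H \<longleftrightarrow> x \<in> H"
    and f: "smooth f" "compact K" "\<And>x. x \<notin> K \<Longrightarrow> f x = 0"
  shows "(LINT x|lebesgue_on H. e \<bullet> grad f x) = 0"
proof -
  define d where "d n x = real (Suc n) * (f (x + inverse (real (Suc n)) *\<^sub>R e) - f x)" for n x
  have cg: "continuous_on UNIV (\<lambda>x. e \<bullet> grad f x)"
    unfolding grad_def by (intro continuous_intros smooth_continuous smooth_pd f)
  have g0: "e \<bullet> grad f x = 0" if "x \<notin> K" for x
  proof -
    have "pd i f x = 0" for i
      using pd_cong_open[of "- K" x f "\<lambda>_. 0" i] f that compact_imp_closed[OF f(2)] by auto
    then have "grad f x = 0" by (simp add: grad_def vec_eq_iff)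
    then show ?thesis by simp
  qed
  obtain C where C: "C > 0" "\<And>x. norm (e \<bullet> grad f x) \<le> C"
    using continuous_bounded_support[OF cg f(2) g0] by auto
  have mvt: "\<exists>t. 0 < t \<and> t < inverse (real (Suc n)) \<and> d n x = e \<bullet> grad f (x + t *\<^sub>R e)" for n x
  proof -
    have p: "0 < inverse (real (Suc n))" by simp
    from MVT2[OF p line_has_derivative_direction[OF f(1)]] obtain t where t: "0 < t" "t < inverse (real (Suc n))"
      "f (x + inverse (real (Suc n)) *\<^sub>R e) - f (x + 0 *\<^sub>R e) = (inverse (real (Suc n)) - 0) * (e \<bullet> grad f (x + t *\<^sub>R e))"
      by blast
    then have "d n x = real (Suc n) * inverse (real (Suc n)) * (e \<bullet> grad f (x + t *\<^sub>R e))"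
      by (simp add: d_def)
    with t show ?thesis by (auto intro!: exI[of _ t])
  qed
  have dlim: "(\<lambda>n. d n x) \<longlonglongrightarrow> e \<bullet> grad f x" for x
  proof -
    have "\<exists>t. \<forall>n. 0 < t n \<and> t n < inverse (real (Suc n)) \<and> d n x = e \<bullet> grad f (x + t n *\<^sub>R e)"
      by (intro choice allI) (rule mvt)
    then obtain t where t: "\<And>n. 0 < t n \<and> t n < inverse (real (Suc n)) \<and> d n x = e \<bullet> grad f (x + t n *\<^sub>R e)" by blast
    have "t \<longlonglongrightarrow> 0"
      using t by (intro Lim_null_comparison[OF _ LIMSEQ_inverse_real_of_nat] always_eventually allI)
        (metis abs_of_pos less_imp_le real_norm_def)
    then have "(\<lambda>n. x + t n *\<^sub>R e) \<longlonglongrightarrow> x + 0 *\<^sub>R e" by (intro tendsto_intros)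
    then have "(\<lambda>n. e \<bullet> grad f (x + t n *\<^sub>R e)) \<longlonglongrightarrow> e \<bullet> grad f x"
      using continuous_on_tendsto_compose[OF cg, of "\<lambda>n. x + t n *\<^sub>R e" x sequentially] by simp
    then show ?thesis using t by simp
  qed
  \<comment> \<open>All points from which \<open>K\<close> is reached by a shift of at most 1 along
    \<open>e\<close>; the difference quotients vanish off this compact set, which supplies the
    dominating function.\<close>
  define B where "B = (\<lambda>(t, x). x - t *\<^sub>R e) ` ({0..1::real} \<times> K)"
  have B: "compact B"
    unfolding B_def by (intro compact_continuous_image compact_Times f) (auto intro!: continuous_intros simp: case_prod_unfold)
  have dB: "norm (d n x) \<le> C * indicator B x" for n x
  proof -
    from mvt[of n x] obtain t where t: "0 < t" "t < inverse (real (Suc n))" "d n x = e \<bullet> grad f (x + t *\<^sub>R e)" by auto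
    have "inverse (real (Suc n)) \<le> 1" by (simp add: inverse_le_1_iff)
    then have t1: "t \<in> {0..1}" using t by auto
    show ?thesis
    proof (cases "x + t *\<^sub>R e \<in> K")
      case True
      then have "x \<in> B" unfolding B_def using t1 by (intro image_eqI[of _ _ "(t, x + t *\<^sub>R e)"]) auto
      then show ?thesis using C t by simp
    next
      case False
      then show ?thesis using g0 t C by (simp add: indicator_def)
    qed
  qed
  have fc: "continuous_on UNIV f" by (rule smooth_continuous[OF f(1)])
  have fm[measurable]: "f \<in> borel_measurable borel" using fc by (rule borel_measurable_continuous_onI)
  have gm[measurable]: "(\<lambda>x. e \<bullet> grad f x) \<in> borel_measurable borel" using cg by (rule borel_measurable_continuous_onI)
  have Hm[measurable]: "H \<in> sets borel" by (rule H)
  have Kint: "integrable lborel (\<lambda>x. indicator H x * f x)"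
  proof (rule Bochner_Integration.integrable_bound)
    show "integrable lborel f" using integrable_continuous_compact_support[OF fc f(2,3)] by (simp add: integrable_completion)
  qed (auto simp: indicator_def)
  have dz: "(LINT x|lborel. indicator H x * d n x) = 0" for n
  proof -
    let ?a = "inverse (real (Suc n)) *\<^sub>R e"
    have eq: "indicator H x * f (x + ?a) = (\<lambda>y. indicator H y * f y) (x + ?a)" for x
      using H(2)[of x "inverse (real (Suc n))"] by (simp add: indicator_def)
    have i: "integrable lborel (\<lambda>x. indicator H x * f (x + ?a))"
    proof -
      have "integrable (distr lborel borel ((+) ?a)) (\<lambda>y. indicator H y * f y)"
        using Kint by (simp add: lborel_distr_plus)
      then have "integrable lborel (\<lambda>x. (\<lambda>y. indicator H y * f y) (?a + x))"
        by (subst (asm) integrable_distr_eq) auto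
      then show ?thesis unfolding eq by (simp add: add.commute)
    qed
    have "(LINT x|lborel. indicator H x * f (x + ?a)) = (LINT x|lborel. indicator H x * f x)"
      unfolding eq by (rule integral_translation) measurable
    moreover have "indicator H x * d n x = real (Suc n) * (indicator H x * f (x + ?a) - indicator H x * f x)" for x
      by (simp add: d_def indicator_def)
    ultimately show ?thesis using i Kint by simp
  qed
  have "(\<lambda>n. LINT x|lborel. indicator H x * d n x) \<longlonglongrightarrow> (LINT x|lborel. indicator H x * (e \<bullet> grad f x))"
  proof (rule integral_dominated_convergence[where w = "\<lambda>x. C * indicator B x"])
    show "integrable lborel (\<lambda>x. C * indicator B x)"
      using emeasure_bounded_finite[OF compact_imp_bounded[OF B]] borel_compact[OF B]
      by (intro integrable_mult_right integrable_real_indicator) auto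
    show "AE x in lborel. (\<lambda>n. indicator H x * d n x) \<longlonglongrightarrow> indicator H x * (e \<bullet> grad f x)"
      by (intro AE_I2 tendsto_intros dlim)
    show "AE x in lborel. norm (indicator H x * d n x) \<le> C * indicator B x" for n
    proof (rule AE_I2)
      fix x
      have "norm (indicator H x * d n x) \<le> norm (d n x)" by (simp add: indicator_def)
      then show "norm (indicator H x * d n x) \<le> C * indicator B x" using dB[of n x] by linarith
    qed
    show "(\<lambda>x. indicator H x * d n x) \<in> borel_measurable lborel" for n
      unfolding d_def by measurable
  qed measurable
  then have "(LINT x|lborel. indicator H x * (e \<bullet> grad f x)) = 0"
    by (simp add: dz LIMSEQ_const_iff)
  then show ?thesis using H(1)
    by (simp add: integral_restrict_space integral_completion)
qed

lemma grad_component: "grad f x $ i = pd i f x"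
  by (simp add: grad_def)

lemma smooth_grad_continuous: "smooth f \<Longrightarrow> continuous_on S (grad f)"
  unfolding grad_def by (intro continuous_intros smooth_continuous smooth_pd)

section \<open>The space \<open>H10\<close> on a bounded open set\<close>

locale bounded_open =
  fixes \<Omega> :: "(real^3) set"
  assumes open_Omega: "open \<Omega>" and bounded_Omega: "bounded \<Omega>"
begin

abbreviation "M \<equiv> lebesgue_on \<Omega>"

lemma Omega_sets: "\<Omega> \<in> sets lebesgue"
  using open_Omega by (simp add: borel_open)

lemma smooth_sq_int: "smooth f \<Longrightarrow> sq_int M f"
  by (intro continuous_sq_int smooth_continuous bounded_Omega open_Omega)

lemma smooth_grad_sq_int: "smooth f \<Longrightarrow> sq_int M (grad f)"
  by (intro continuous_sq_int smooth_grad_continuous bounded_Omega open_Omega)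

lemma smooth_bounded_Omega:
  assumes "smooth s" shows "\<exists>C. \<forall>x\<in>\<Omega>. \<bar>s x\<bar> \<le> C"
proof -
  have "compact (s ` closure \<Omega>)"
    using bounded_Omega by (intro compact_continuous_image smooth_continuous assms) auto
  then have "bounded (s ` closure \<Omega>)" by (rule compact_imp_bounded)
  then show ?thesis unfolding bounded_iff using closure_subset[of \<Omega>] by auto
qed

lemma sq_int_smooth_mult:
  fixes s f :: "real^3 \<Rightarrow> real"
  assumes "smooth s" "sq_int M f" shows "sq_int M (\<lambda>x. s x * f x)"
proof -
  obtain C where C: "\<And>x. x \<in> \<Omega> \<Longrightarrow> \<bar>s x\<bar> \<le> C" using smooth_bounded_Omega[OF assms(1)] by auto
  show ?thesis
  proof (rule sq_int_bounded_by[OF _ assms(2), of _ C])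
    show "(\<lambda>x. s x * f x) \<in> borel_measurable M"
      using assms(2) smooth_sq_int[OF assms(1)] by (auto dest!: sq_int_measurable)
    show "norm (s x * f x) \<le> C * norm (f x)" if "x \<in> space M" for x
      using C[of x] that by (simp add: abs_mult mult_right_mono)
  qed
qed

lemma L2_lim_smooth_mult:
  fixes s F :: "real^3 \<Rightarrow> real"
  assumes "smooth s" "L2_lim M f F" "\<And>n. sq_int M (f n)" "sq_int M F"
  shows "L2_lim M (\<lambda>n x. s x * f n x) (\<lambda>x. s x * F x)"
proof -
  obtain C where C: "\<And>x. x \<in> \<Omega> \<Longrightarrow> \<bar>s x\<bar> \<le> C" using smooth_bounded_Omega[OF assms(1)] by auto
  show ?thesis
  proof (rule L2_lim_bounded_by[OF assms(2-4), of _ _ C])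
    show "norm (s x * f n x - s x * F x) \<le> C * norm (f n x - F x)" if "x \<in> space M" for x n
      using C[of x] that by (simp add: abs_mult mult_right_mono flip: right_diff_distrib)
  qed (auto intro: sq_int_smooth_mult assms)
qed

lemma integral_pd_test_fun:
  assumes "test_fun \<Omega> \<theta>"
  shows "(LINT x|M. pd i \<theta> x) = 0"
proof -
  obtain K where K: "smooth \<theta>" "compact K" "K \<subseteq> \<Omega>" "\<And>x. x \<notin> K \<Longrightarrow> \<theta> x = 0"
    using assms unfolding test_fun_iff by blast
  have e: "axis i 1 \<bullet> grad \<theta> x = pd i \<theta> x" for x by (simp add: inner_axis' grad_def)
  have "pd i \<theta> x = 0" if "x \<notin> \<Omega>" for x
    using test_fun_pd[OF assms, of i] that unfolding test_fun_iff by blast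
  then have "(LINT x|M. pd i \<theta> x) = (LINT x|lebesgue_on UNIV. pd i \<theta> x)"
    by (intro integral_lebesgue_on_superset[symmetric] Omega_sets) auto
  also have "\<dots> = 0"
    using integral_directional_derivative_zero[OF _ _ K(1,2,4), of UNIV "axis i 1"] by (simp add: e)
  finally show ?thesis .
qed

lemma test_fun_by_parts:
  assumes \<theta>: "test_fun \<Omega> \<theta>" and f: "smooth f"
  shows "ip M (pd i \<theta>) f = - ip M \<theta> (pd i f)"
proof -
  note s = test_fun_smooth[OF \<theta>]
  have "0 = (LINT x|M. pd i (\<lambda>x. \<theta> x * f x) x)"
    by (rule integral_pd_test_fun[OF test_fun_mult_right[OF \<theta> f], symmetric])
  also have "\<dots> = (LINT x|M. \<theta> x \<bullet> pd i f x + pd i \<theta> x \<bullet> f x)"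
    by (simp add: pd_smooth_mult s f)
  also have "\<dots> = ip M \<theta> (pd i f) + ip M (pd i \<theta>) f"
    unfolding ip_def by (intro Bochner_Integration.integral_add sq_int_inner_integrable smooth_sq_int smooth_pd s f)
  finally show ?thesis by simp
qed

text \<open>The weak gradient identity passes to the limit from the approximating test functions, so
  only approximability remains to be checked.\<close>

lemma H10_iff:
  "H10 \<Omega> \<phi> G \<longleftrightarrow> sq_int M \<phi> \<and> sq_int M G \<and>
     (\<exists>\<psi>. (\<forall>n. test_fun \<Omega> (\<psi> n)) \<and> L2_lim M \<psi> \<phi> \<and> L2_lim M (\<lambda>n. grad (\<psi> n)) G)"
proof
  assume "H10 \<Omega> \<phi> G"
  then show "sq_int M \<phi> \<and> sq_int M G \<and>
     (\<exists>\<psi>. (\<forall>n. test_fun \<Omega> (\<psi> n)) \<and> L2_lim M \<psi> \<phi> \<and> L2_lim M (\<lambda>n. grad (\<psi> n)) G)"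
    unfolding H10_def weak_grad_def L2_iff_sq_int L2v_iff_sq_int L2_lim_def ip_self_norm by simp
next
  assume "sq_int M \<phi> \<and> sq_int M G \<and>
     (\<exists>\<psi>. (\<forall>n. test_fun \<Omega> (\<psi> n)) \<and> L2_lim M \<psi> \<phi> \<and> L2_lim M (\<lambda>n. grad (\<psi> n)) G)"
  then obtain \<psi> where *: "sq_int M \<phi>" "sq_int M G" "\<And>n. test_fun \<Omega> (\<psi> n)" "L2_lim M \<psi> \<phi>" "L2_lim M (\<lambda>n. grad (\<psi> n)) G"
    by blast
  note s = test_fun_smooth[OF *(3)]
  have "(LINT x|M. \<phi> x * pd i \<theta> x) = - (LINT x|M. G x $ i * \<theta> x)" if \<theta>: "test_fun \<Omega> \<theta>" for \<theta> i
  proof -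
    note t = test_fun_smooth[OF \<theta>]
    have 1: "(\<lambda>n. ip M (\<psi> n) (pd i \<theta>)) \<longlonglongrightarrow> ip M \<phi> (pd i \<theta>)"
      by (intro L2_lim_ip * smooth_sq_int smooth_pd s t)
    have "L2_lim M (\<lambda>n x. grad (\<psi> n) x $ i) (\<lambda>x. G x $ i)"
      by (intro L2_lim_component * smooth_grad_sq_int s)
    then have "(\<lambda>n. - ip M (\<lambda>x. grad (\<psi> n) x $ i) \<theta>) \<longlonglongrightarrow> - ip M (\<lambda>x. G x $ i) \<theta>"
      by (intro tendsto_minus L2_lim_ip sq_int_component * smooth_sq_int smooth_grad_sq_int s t)
    moreover have "ip M (\<psi> n) (pd i \<theta>) = - ip M (\<lambda>x. grad (\<psi> n) x $ i) \<theta>" for n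
      using test_fun_by_parts[OF *(3)[of n] t, of i] by (simp add: grad_component[abs_def])
    ultimately have "ip M \<phi> (pd i \<theta>) = - ip M (\<lambda>x. G x $ i) \<theta>"
      using LIMSEQ_unique[OF 1] by simp
    then show ?thesis by (simp add: ip_def)
  qed
  then show "H10 \<Omega> \<phi> G"
    using * unfolding H10_def weak_grad_def L2_iff_sq_int L2v_iff_sq_int L2_lim_def ip_self_norm
    by (auto intro!: exI[of _ \<psi>])
qed

lemma H10_sq_int: "H10 \<Omega> \<phi> G \<Longrightarrow> sq_int M \<phi>" "H10 \<Omega> \<phi> G \<Longrightarrow> sq_int M G"
  by (simp_all add: H10_iff)

lemma H10_approx:
  assumes "H10 \<Omega> \<phi> G"
  obtains \<psi> where "\<And>n. test_fun \<Omega> (\<psi> n)" "\<And>n. smooth (\<psi> n)" "L2_lim M \<psi> \<phi>"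
    "L2_lim M (\<lambda>n. grad (\<psi> n)) G" "\<And>i. L2_lim M (\<lambda>n. pd i (\<psi> n)) (\<lambda>x. G x $ i)"
proof -
  obtain \<psi> where *: "sq_int M G" "\<And>n. test_fun \<Omega> (\<psi> n)" "L2_lim M \<psi> \<phi>" "L2_lim M (\<lambda>n. grad (\<psi> n)) G"
    using assms unfolding H10_iff by blast
  have "L2_lim M (\<lambda>n x. grad (\<psi> n) x $ i) (\<lambda>x. G x $ i)" for i
    by (intro L2_lim_component * smooth_grad_sq_int test_fun_smooth[OF *(2)])
  then have "L2_lim M (\<lambda>n. pd i (\<psi> n)) (\<lambda>x. G x $ i)" for i by (simp add: grad_component)
  with * show ?thesis using that test_fun_smooth by blast
qed

lemma L2_lim_const: "L2_lim M (\<lambda>n. f) f"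
  by (simp add: L2_lim_def)

lemma test_fun_H10: "test_fun \<Omega> \<theta> \<Longrightarrow> H10 \<Omega> \<theta> (grad \<theta>)"
  unfolding H10_iff
  by (intro conjI exI[of _ "\<lambda>n. \<theta>"] allI L2_lim_const) (auto intro: smooth_sq_int smooth_grad_sq_int test_fun_smooth)

lemma grad_add: "smooth f \<Longrightarrow> smooth g \<Longrightarrow> grad (\<lambda>x. f x + g x) = (\<lambda>x. grad f x + grad g x)"
  by (simp add: grad_def fun_eq_iff vec_eq_iff pd_smooth_add)

lemma grad_cmult: "smooth f \<Longrightarrow> grad (\<lambda>x. c * f x) = (\<lambda>x. c *\<^sub>R grad f x)"
  by (simp add: grad_def fun_eq_iff vec_eq_iff pd_cmult)

lemma H10_add:
  assumes "H10 \<Omega> \<phi> G" "H10 \<Omega> \<psi> H"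
  shows "H10 \<Omega> (\<lambda>x. \<phi> x + \<psi> x) (\<lambda>x. G x + H x)"
proof -
  from H10_approx[OF assms(1)] obtain a where a: "\<And>n. test_fun \<Omega> (a n)" "\<And>n. smooth (a n)" "L2_lim M a \<phi>"
    "L2_lim M (\<lambda>n. grad (a n)) G" by metis
  from H10_approx[OF assms(2)] obtain b where b: "\<And>n. test_fun \<Omega> (b n)" "\<And>n. smooth (b n)" "L2_lim M b \<psi>"
    "L2_lim M (\<lambda>n. grad (b n)) H" by metis
  have "L2_lim M (\<lambda>n. grad (\<lambda>x. a n x + b n x)) (\<lambda>x. G x + H x)"
    unfolding grad_add[OF a(2) b(2)] by (intro L2_lim_add a b smooth_grad_sq_int H10_sq_int[OF assms(1)] H10_sq_int[OF assms(2)])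
  moreover have "L2_lim M (\<lambda>n x. a n x + b n x) (\<lambda>x. \<phi> x + \<psi> x)"
    by (intro L2_lim_add a b smooth_sq_int H10_sq_int[OF assms(1)] H10_sq_int[OF assms(2)])
  ultimately show ?thesis unfolding H10_iff
    using a b H10_sq_int[OF assms(1)] H10_sq_int[OF assms(2)]
    by (intro conjI sq_int_add exI[of _ "\<lambda>n x. a n x + b n x"] allI test_fun_add)
qed

lemma H10_cmult:
  assumes "H10 \<Omega> \<phi> G"
  shows "H10 \<Omega> (\<lambda>x. c * \<phi> x) (\<lambda>x. c *\<^sub>R G x)"
proof -
  from H10_approx[OF assms(1)] obtain a where a: "\<And>n. test_fun \<Omega> (a n)" "\<And>n. smooth (a n)" "L2_lim M a \<phi>"
    "L2_lim M (\<lambda>n. grad (a n)) G" by metis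
  have "L2_lim M (\<lambda>n. grad (\<lambda>x. c * a n x)) (\<lambda>x. c *\<^sub>R G x)"
    unfolding grad_cmult[OF a(2)] by (intro L2_lim_scaleR a)
  moreover have "L2_lim M (\<lambda>n x. c * a n x) (\<lambda>x. c * \<phi> x)"
    using L2_lim_scaleR[OF a(3), of c] by simp
  ultimately show ?thesis unfolding H10_iff
    using a H10_sq_int[OF assms(1)]
    by (intro conjI sq_int_mult sq_int_scaleR exI[of _ "\<lambda>n x. c * a n x"] allI test_fun_cmult)
qed

lemma H10_zero: "H10 \<Omega> (\<lambda>x. 0) (\<lambda>x. 0)"
proof -
  have "grad (\<lambda>x. 0) = (\<lambda>x. 0)" by (simp add: grad_def fun_eq_iff vec_eq_iff)
  then show ?thesis using test_fun_H10[OF test_fun_zero] by simp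
qed

lemma H10_diff:
  assumes "H10 \<Omega> \<phi> G" "H10 \<Omega> \<psi> H"
  shows "H10 \<Omega> (\<lambda>x. \<phi> x - \<psi> x) (\<lambda>x. G x - H x)"
  using H10_add[OF assms(1) H10_cmult[OF assms(2), of "-1"]] by simp

lemma H10_sum:
  "(\<And>j. j \<in> J \<Longrightarrow> H10 \<Omega> (\<phi> j) (G j)) \<Longrightarrow> H10 \<Omega> (\<lambda>x. \<Sum>j\<in>J. \<phi> j x) (\<lambda>x. \<Sum>j\<in>J. G j x)"
  by (induction J rule: infinite_finite_induct) (auto intro: H10_add H10_zero)

lemma L2_lim_diagonal:
  assumes "\<And>n. sq_int M (f n)" "\<And>n. sq_int M (p n)" "sq_int M P" "L2_lim M p P"
    "\<And>n. nsq M (\<lambda>x. f n x - p n x) < inverse (real (Suc n))"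
  shows "L2_lim M f P"
proof -
  have "L2_lim M (\<lambda>n x. f n x - p n x) (\<lambda>x. 0)"
    unfolding L2_lim_def
    by (rule Lim_null_comparison[OF _ LIMSEQ_inverse_real_of_nat])
       (use assms(5) in \<open>auto intro!: always_eventually less_imp_le\<close>)
  then have "L2_lim M (\<lambda>n x. (f n x - p n x) + p n x) (\<lambda>x. 0 + P x)"
    by (intro L2_lim_add assms sq_int_diff sq_int_zero)
  then show ?thesis by simp
qed

text \<open>Diagonal choice: for each \<open>n\<close> a single test function approximates both
  \<open>P n\<close> and \<open>G n\<close> to within \<open>inverse (real (Suc n))\<close>.\<close>

lemma H10_closed:
  assumes P: "\<And>n. H10 \<Omega> (P n) (G n)" and "sq_int M Q" "sq_int M H" "L2_lim M P Q" "L2_lim M G H"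
  shows "H10 \<Omega> Q H"
proof -
  have "\<forall>n. \<exists>\<theta>. test_fun \<Omega> \<theta> \<and> nsq M (\<lambda>x. \<theta> x - P n x) < inverse (real (Suc n)) \<and>
     nsq M (\<lambda>x. grad \<theta> x - G n x) < inverse (real (Suc n))"
  proof
    fix n
    from H10_approx[OF P[of n]] obtain a where a: "\<And>k. test_fun \<Omega> (a k)" "L2_lim M a (P n)"
      "L2_lim M (\<lambda>k. grad (a k)) (G n)" by metis
    have "\<forall>\<^sub>F k in sequentially. nsq M (\<lambda>x. a k x - P n x) < inverse (real (Suc n))"
      "\<forall>\<^sub>F k in sequentially. nsq M (\<lambda>x. grad (a k) x - G n x) < inverse (real (Suc n))"
      using a(2,3) unfolding L2_lim_def by (auto intro!: order_tendstoD)
    from eventually_happens'[OF sequentially_bot eventually_conj[OF this]]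
    obtain k where "nsq M (\<lambda>x. a k x - P n x) < inverse (real (Suc n))"
      "nsq M (\<lambda>x. grad (a k) x - G n x) < inverse (real (Suc n))" by blast
    with a(1) show "\<exists>\<theta>. test_fun \<Omega> \<theta> \<and> nsq M (\<lambda>x. \<theta> x - P n x) < inverse (real (Suc n)) \<and>
      nsq M (\<lambda>x. grad \<theta> x - G n x) < inverse (real (Suc n))" by blast
  qed
  from choice[OF this] obtain \<theta> where \<theta>: "\<And>n. test_fun \<Omega> (\<theta> n)"
    "\<And>n. nsq M (\<lambda>x. \<theta> n x - P n x) < inverse (real (Suc n))"
    "\<And>n. nsq M (\<lambda>x. grad (\<theta> n) x - G n x) < inverse (real (Suc n))" by blast
  have "L2_lim M \<theta> Q"
    by (rule L2_lim_diagonal[OF _ H10_sq_int(1)[OF P] assms(2,4) \<theta>(2)]) (intro smooth_sq_int test_fun_smooth[OF \<theta>(1)])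
  moreover have "L2_lim M (\<lambda>n. grad (\<theta> n)) H"
    by (rule L2_lim_diagonal[OF _ H10_sq_int(2)[OF P] assms(3,5) \<theta>(3)]) (intro smooth_grad_sq_int test_fun_smooth[OF \<theta>(1)])
  ultimately show ?thesis unfolding H10_iff using assms \<theta> by blast
qed

text \<open>The approximants of \<open>u\<close> have compact support in \<Omega>, so no boundary
  term appears whatever \<open>f\<close> does on the boundary. This is how the zero trace of
  \<open>u\<close> is used.\<close>

lemma H10_by_parts:
  assumes u: "H10 \<Omega> u G" and f: "smooth f"
  shows "ip M (\<lambda>x. G x $ i) f = - ip M u (pd i f)"
proof -
  from H10_approx[OF u] obtain a where a: "\<And>n. test_fun \<Omega> (a n)" "\<And>n. smooth (a n)" "L2_lim M a u"
    "\<And>i. L2_lim M (\<lambda>n. pd i (a n)) (\<lambda>x. G x $ i)" by metis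
  have "(\<lambda>n. ip M (pd i (a n)) f) \<longlonglongrightarrow> ip M (\<lambda>x. G x $ i) f"
    by (intro L2_lim_ip a smooth_sq_int smooth_pd f sq_int_component H10_sq_int[OF u])
  moreover have "(\<lambda>n. - ip M (a n) (pd i f)) \<longlonglongrightarrow> - ip M u (pd i f)"
    by (intro tendsto_minus L2_lim_ip a smooth_sq_int smooth_pd f H10_sq_int[OF u])
  ultimately show ?thesis
    unfolding test_fun_by_parts[OF a(1) f] by (rule LIMSEQ_unique)
qed

text \<open>Moving the derivative off \<open>u\<close> gives a second derivative of \<open>f\<close>
  on both sides, and those commute. In weak form this says that the curl of a gradient is
  zero.\<close>

lemma H10_pd_swap:
  assumes u: "H10 \<Omega> u G" and f: "smooth f"
  shows "ip M (\<lambda>x. G x $ i) (pd j f) = ip M (\<lambda>x. G x $ j) (pd i f)"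
  using H10_by_parts[OF u smooth_pd[OF f]] pd_commute[OF f, of i j] by simp

text \<open>The preceding exchange survives the limit because its statement contains first
  derivatives only.\<close>

lemma H10_component_swap:
  assumes u: "H10 \<Omega> u G" and v: "H10 \<Omega> v H"
  shows "ip M (\<lambda>x. G x $ i) (\<lambda>x. H x $ j) = ip M (\<lambda>x. G x $ j) (\<lambda>x. H x $ i)"
proof -
  from H10_approx[OF v] obtain a where a: "\<And>n. smooth (a n)" 
    "\<And>i. L2_lim M (\<lambda>n. pd i (a n)) (\<lambda>x. H x $ i)" by metis
  have lim: "(\<lambda>n. ip M (\<lambda>x. G x $ k) (pd l (a n))) \<longlonglongrightarrow> ip M (\<lambda>x. G x $ k) (\<lambda>x. H x $ l)" for k l
    by (subst (1 2) ip_commute, intro L2_lim_ip a smooth_sq_int smooth_pd sq_int_component H10_sq_int[OF u] H10_sq_int[OF v])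
  from lim[of i j] lim[of j i] show ?thesis
    unfolding H10_pd_swap[OF u a(1), of i j] by (rule LIMSEQ_unique)
qed

text \<open>The integral of the \<open>i\<close>-th derivative of \<open>s g h\<close> is zero. The
  weight \<open>s\<close> will be constant, giving plain integration by parts, or linear, giving
  Poincare and Rellich type identities.\<close>

lemma H10_product_rule:
  assumes g: "H10 \<Omega> g A" and h: "H10 \<Omega> h B" and s: "smooth s"
  shows "ip M (\<lambda>x. s x * A x $ i) h + ip M (\<lambda>x. s x * g x) (\<lambda>x. B x $ i) = - ip M (\<lambda>x. pd i s x * g x) h"
proof -
  from H10_approx[OF g] obtain a where a: "\<And>n. test_fun \<Omega> (a n)" "\<And>n. smooth (a n)" "L2_lim M a g"
    "\<And>i. L2_lim M (\<lambda>n. pd i (a n)) (\<lambda>x. A x $ i)" by metis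
  from H10_approx[OF h] obtain b where b: "\<And>n. test_fun \<Omega> (b n)" "\<And>n. smooth (b n)" "L2_lim M b h"
    "\<And>i. L2_lim M (\<lambda>n. pd i (b n)) (\<lambda>x. B x $ i)" by metis
  have "ip M (\<lambda>x. s x * pd i (a n) x) (b n) + ip M (\<lambda>x. s x * a n x) (pd i (b n)) = - ip M (\<lambda>x. pd i s x * a n x) (b n)" for n
  proof -
    have "pd i (\<lambda>x. s x * a n x) = (\<lambda>x. s x * pd i (a n) x + pd i s x * a n x)"
      by (rule pd_smooth_mult[OF s a(2)])
    moreover have "ip M (pd i (\<lambda>x. s x * a n x)) (b n) = - ip M (\<lambda>x. s x * a n x) (pd i (b n))"
      by (rule test_fun_by_parts[OF test_fun_mult_left[OF a(1) s] b(2)])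
    moreover have "ip M (\<lambda>x. s x * pd i (a n) x + pd i s x * a n x) (b n) =
        ip M (\<lambda>x. s x * pd i (a n) x) (b n) + ip M (\<lambda>x. pd i s x * a n x) (b n)"
      by (intro ip_add_left smooth_sq_int smooth_mult smooth_pd s a b)
    ultimately show ?thesis by simp
  qed
  moreover have "(\<lambda>n. ip M (\<lambda>x. s x * pd i (a n) x) (b n) + ip M (\<lambda>x. s x * a n x) (pd i (b n))) \<longlonglongrightarrow>
      ip M (\<lambda>x. s x * A x $ i) h + ip M (\<lambda>x. s x * g x) (\<lambda>x. B x $ i)"
    by (intro tendsto_add L2_lim_ip_both L2_lim_smooth_mult sq_int_smooth_mult smooth_sq_int smooth_pd
        s a b sq_int_component H10_sq_int[OF g] H10_sq_int[OF h])
  moreover have "(\<lambda>n. - ip M (\<lambda>x. pd i s x * a n x) (b n)) \<longlonglongrightarrow> - ip M (\<lambda>x. pd i s x * g x) h"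
    by (intro tendsto_minus L2_lim_ip_both L2_lim_smooth_mult sq_int_smooth_mult smooth_sq_int smooth_pd
        s a b H10_sq_int[OF g] H10_sq_int[OF h])
  ultimately show ?thesis using LIMSEQ_unique by simp
qed

text \<open>With the linear weight \<open>x $ 1\<close>, the product rule for \<open>P\<close> with
  itself gives \<open>2 * ip M (x $ 1 * G x $ 1) P = - nsq M P\<close>; Cauchy-Schwarz and a bound
  \<open>R\<close> for the first coordinate on \<Omega> finish.\<close>

lemma Poincare:
  "\<exists>C\<ge>0. \<forall>P G. H10 \<Omega> P G \<longrightarrow> nsq M P \<le> C * nsq M G"
proof -
  obtain R where R: "\<And>x. x \<in> \<Omega> \<Longrightarrow> \<bar>x $ 1\<bar> \<le> R" using smooth_bounded_Omega[OF smooth_component[of 1]] by auto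
  have "nsq M P \<le> (2 * R)^2 * nsq M G" if P: "H10 \<Omega> P G" for P G
  proof -
    note Ps = H10_sq_int[OF P]
    let ?w = "\<lambda>x. x $ 1 * G x $ 1"
    have w: "sq_int M ?w" by (intro sq_int_smooth_mult smooth_component sq_int_component Ps)
    have "pd 1 (\<lambda>x. x $ 1) = (\<lambda>x. 1)" by (simp add: pd_component fun_eq_iff)
    moreover have "ip M (\<lambda>x. x $ 1 * P x) (\<lambda>x. G x $ 1) = ip M ?w P"
      unfolding ip_def by (simp add: ac_simps)
    ultimately have "2 * ip M ?w P = - nsq M P"
      using H10_product_rule[OF P P smooth_component[of 1], of 1] by simp
    then have "(nsq M P)^2 = (2 * ip M ?w P)^2" by simp
    also have "\<dots> = 4 * (ip M ?w P)^2" by (simp add: power_mult_distrib)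
    also have "\<dots> \<le> 4 * (nsq M ?w * nsq M P)" using ip_Cauchy_Schwarz[OF w Ps(1)] by simp
    finally have *: "nsq M P * nsq M P \<le> (4 * nsq M ?w) * nsq M P" by (simp add: power2_eq_square)
    have 1: "nsq M P \<le> 4 * nsq M ?w"
    proof (cases "nsq M P = 0")
      case False
      then have "nsq M P > 0" using ip_nonneg[of M P] by linarith
      with * show ?thesis by (rule mult_right_le_imp_le)
    qed simp
    have "nsq M ?w \<le> R^2 * nsq M G"
    proof (rule ip_self_mono[OF Ps(2) w])
      fix x assume "x \<in> space M"
      then have "\<bar>x $ 1\<bar> * \<bar>G x $ 1\<bar> \<le> R * norm (G x)"
        using R[of x] by (intro mult_mono component_le_norm_cart) auto
      then show "norm (?w x) \<le> R * norm (G x)" by (simp add: abs_mult)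
    qed
    with 1 show ?thesis by (simp add: power_mult_distrib)
  qed
  then show ?thesis by (intro exI[of _ "(2 * R)^2"]) auto
qed

text \<open>Convergence of gradients controls the potentials by the Poincare inequality, so the
  limit is again a gradient. This is what makes the projection behind the Helmholtz decomposition
  available.\<close>

lemma closed_subspace_gradients: "closed_subspace M (\<lambda>G. \<exists>P. H10 \<Omega> P G)"
  unfolding closed_subspace_def
proof (intro conjI allI impI)
  show "\<exists>P. H10 \<Omega> P (\<lambda>x. 0)" using H10_zero by blast
  show "sq_int M G" if "\<exists>P. H10 \<Omega> P G" for G using that H10_sq_int by blast
  show "\<exists>P. H10 \<Omega> P (\<lambda>x. G x + H x)" if "\<exists>P. H10 \<Omega> P G" "\<exists>P. H10 \<Omega> P H" for G H
    using that H10_add by blast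
  show "\<exists>P. H10 \<Omega> P (\<lambda>x. c *\<^sub>R G x)" if "\<exists>P. H10 \<Omega> P G" for c G
    using that H10_cmult by blast
  fix G H assume *: "\<forall>n. \<exists>P. H10 \<Omega> P (G n)" and H: "sq_int M H" "L2_lim M G H"
  then obtain P where P: "\<And>n. H10 \<Omega> (P n) (G n)" by metis
  note Ps = H10_sq_int[OF P]
  obtain C where C: "C \<ge> 0" "\<And>P G. H10 \<Omega> P G \<Longrightarrow> nsq M P \<le> C * nsq M G" using Poincare by blast
  have "\<exists>Q. sq_int M Q \<and> L2_lim M P Q"
  proof (rule Riesz_Fischer[OF Ps(1)])
    fix e :: real assume e: "e > 0"
    \<comment> \<open>If both gradients are within \<open>d\<close> of the limit in squared norm,
      their difference is within \<open>4 * d\<close>, and Poincare multiplies this by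
      \<open>C\<close>; the \<open>+ 1\<close> keeps the denominator positive.\<close>
    define d where "d = e / (4 * (C + 1))"
    have d: "d > 0" "4 * C * d < e" using e C(1) by (auto simp: d_def field_simps)
    have "\<forall>\<^sub>F n in sequentially. nsq M (\<lambda>x. G n x - H x) < d"
      using H(2) d(1) unfolding L2_lim_def by (rule order_tendstoD)
    then obtain N where N: "\<And>n. n \<ge> N \<Longrightarrow> nsq M (\<lambda>x. G n x - H x) < d"
      unfolding eventually_sequentially by blast
    have "nsq M (\<lambda>x. P m x - P n x) < e" if "m \<ge> N" "n \<ge> N" for m n
    proof -
      let ?a = "\<lambda>x. G m x - H x" and ?b = "\<lambda>x. G n x - H x"
      have s: "sq_int M ?a" "sq_int M ?b" by (intro sq_int_diff Ps H)+
      have "nsq M (\<lambda>x. P m x - P n x) \<le> C * nsq M (\<lambda>x. G m x - G n x)"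
        by (rule C(2)[OF H10_diff[OF P P]])
      also have "(\<lambda>x. G m x - G n x) = (\<lambda>x. ?a x - ?b x)" by auto
      also have "C * nsq M (\<lambda>x. ?a x - ?b x) \<le> C * (4 * d)"
      proof (rule mult_left_mono[OF _ C(1)])
        have "0 \<le> nsq M (\<lambda>x. ?a x + ?b x)" by simp
        then have "- 2 * ip M ?a ?b \<le> nsq M ?a + nsq M ?b" unfolding ip_expand_add[OF s] by linarith
        then show "nsq M (\<lambda>x. ?a x - ?b x) \<le> 4 * d"
          unfolding ip_expand_diff[OF s] using N[OF that(1)] N[OF that(2)] by linarith
      qed
      finally show ?thesis using d(2) by (simp add: algebra_simps)
    qed
    then show "\<exists>N. \<forall>m\<ge>N. \<forall>n\<ge>N. nsq M (\<lambda>x. P m x - P n x) < e" by blast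
  qed
  then obtain Q where "sq_int M Q" "L2_lim M P Q" by blast
  then show "\<exists>Q. H10 \<Omega> Q H" using H10_closed[OF P _ H(1) _ H(2)] by blast
qed

lemma Helmholtz_decomposition:
  assumes "sq_int M V"
  obtains P G where "H10 \<Omega> P G" "\<And>Q H. H10 \<Omega> Q H \<Longrightarrow> ip M (\<lambda>x. V x - G x) H = 0"
  using projection_closed_subspace[OF closed_subspace_gradients assms] by blast

end

section \<open>Vector fields\<close>

text \<open>The Jacobian is an argument of its own because fields with components in
  \<open>H10\<close> have only weak derivatives. Row \<open>i\<close> is the gradient of component
  \<open>i\<close>.\<close>

definition curl_of :: "(real^3 \<Rightarrow> real^3^3) \<Rightarrow> real^3 \<Rightarrow> real^3" where
  "curl_of J x = vector [J x $ 3 $ 2 - J x $ 2 $ 3, J x $ 1 $ 3 - J x $ 3 $ 1, J x $ 2 $ 1 - J x $ 1 $ 2]"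

definition div_of :: "(real^3 \<Rightarrow> real^3^3) \<Rightarrow> real^3 \<Rightarrow> real" where
  "div_of J x = J x $ 1 $ 1 + J x $ 2 $ 2 + J x $ 3 $ 3"

definition jacobian :: "(real^3 \<Rightarrow> real^3) \<Rightarrow> real^3 \<Rightarrow> real^3^3" where
  "jacobian V x = (\<chi> i. grad (\<lambda>y. V y $ i) x)"

definition H10_field :: "(real^3) set \<Rightarrow> (real^3 \<Rightarrow> real^3) \<Rightarrow> (real^3 \<Rightarrow> real^3^3) \<Rightarrow> bool" where
  "H10_field \<Omega> v J \<longleftrightarrow> (\<forall>i. H10 \<Omega> (\<lambda>x. v x $ i) (\<lambda>x. J x $ i))"

lemma curl_of_components [simp]:
  "curl_of J x $ 1 = J x $ 3 $ 2 - J x $ 2 $ 3" "curl_of J x $ 2 = J x $ 1 $ 3 - J x $ 3 $ 1"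
  "curl_of J x $ 3 = J x $ 2 $ 1 - J x $ 1 $ 2"
  by (simp_all add: curl_of_def vector_3)

lemma jacobian_component: "jacobian V x $ i $ j = pd j (\<lambda>y. V y $ i) x"
  by (simp add: jacobian_def grad_component)

lemma curl_jacobian: "curl V = curl_of (jacobian V)"
  by (simp add: fun_eq_iff curl_def curl_of_def jacobian_component)

lemma curl_components [simp]:
  "curl V x $ 1 = pd 2 (\<lambda>y. V y $ 3) x - pd 3 (\<lambda>y. V y $ 2) x"
  "curl V x $ 2 = pd 3 (\<lambda>y. V y $ 1) x - pd 1 (\<lambda>y. V y $ 3) x"
  "curl V x $ 3 = pd 1 (\<lambda>y. V y $ 2) x - pd 2 (\<lambda>y. V y $ 1) x"
  by (simp_all add: curl_def vector_3)

lemma smooth_fieldD: "smooth_field V \<Longrightarrow> smooth (\<lambda>x. V x $ i)"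
  by (simp add: smooth_field_def)

context bounded_open
begin

lemma sq_int_curl_of:
  assumes "\<And>i j. sq_int M (\<lambda>x. J x $ i $ j)" shows "sq_int M (curl_of J)"
proof (rule sq_int_vec)
  show "sq_int M (\<lambda>x. curl_of J x $ i)" for i
    using exhaust_3[of i] by (auto intro!: sq_int_diff assms)
qed

lemma sq_int_div_of:
  assumes "\<And>i j. sq_int M (\<lambda>x. J x $ i $ j)" shows "sq_int M (div_of J)"
  unfolding div_of_def by (intro sq_int_add assms)

lemma H10_field_sq_int:
  assumes "H10_field \<Omega> v J"
  shows "sq_int M (\<lambda>x. J x $ i $ j)" "sq_int M (\<lambda>x. v x $ i)" "sq_int M v" "sq_int M (curl_of J)" "sq_int M (div_of J)"
proof -
  show *: "sq_int M (\<lambda>x. J x $ i $ j)" "sq_int M (\<lambda>x. v x $ i)" for i j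
    using assms H10_sq_int sq_int_component unfolding H10_field_def by blast+
  show "sq_int M v" by (intro sq_int_vec *)
  show "sq_int M (curl_of J)" "sq_int M (div_of J)" by (intro sq_int_curl_of sq_int_div_of *)+
qed

lemma smooth_field_sq_int:
  assumes "smooth_field V"
  shows "sq_int M (\<lambda>x. jacobian V x $ i $ j)" "sq_int M (\<lambda>x. V x $ i)" "sq_int M V" "sq_int M (curl V)"
    "sq_int M (div_of (jacobian V))"
proof -
  show *: "sq_int M (\<lambda>x. jacobian V x $ i $ j)" "sq_int M (\<lambda>x. V x $ i)" for i j
    unfolding jacobian_component using smooth_fieldD[OF assms] by (auto intro!: smooth_sq_int smooth_pd)
  show "sq_int M V" by (intro sq_int_vec *)
  show "sq_int M (curl V)" "sq_int M (div_of (jacobian V))"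
    unfolding curl_jacobian by (intro sq_int_curl_of sq_int_div_of *)+
qed

text \<open>Integrating by parts twice exchanges the two derivatives, so the off-diagonal terms of
  \<open>div u div v\<close> cancel those of \<open>curl u \<bullet> curl v\<close>.\<close>

lemma Hodge_identity:
  assumes "\<And>i j. sq_int M (\<lambda>x. J x $ i $ j)" "\<And>i j. sq_int M (\<lambda>x. J' x $ i $ j)"
    and swap: "\<And>i j k l. ip M (\<lambda>x. J x $ i $ j) (\<lambda>x. J' x $ k $ l) = ip M (\<lambda>x. J x $ i $ l) (\<lambda>x. J' x $ k $ j)"
  shows "ip M (curl_of J) (curl_of J') + ip M (div_of J) (div_of J') =
    (\<Sum>i\<in>UNIV. ip M (\<lambda>x. J x $ i) (\<lambda>x. J' x $ i))"
proof -
  note s = sq_int_curl_of[OF assms(1)] sq_int_curl_of[OF assms(2)]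
  have r: "sq_int M (\<lambda>x. J x $ i)" "sq_int M (\<lambda>x. J' x $ i)" for i
    by (intro sq_int_vec assms)+
  show ?thesis
    unfolding ip_vec_sum[OF s] ip_vec_sum[OF r(1,2)] sum_3 curl_of_components div_of_def
    using swap[of 1 1 2 2] swap[of 1 1 3 3] swap[of 2 2 1 1] swap[of 2 2 3 3] swap[of 3 3 1 1] swap[of 3 3 2 2]
    by (simp add: ip_simps sq_int_intros assms)
qed

lemma Hodge_identity_H10:
  assumes "H10_field \<Omega> v J" "H10_field \<Omega> v' J'"
  shows "ip M (curl_of J) (curl_of J') + ip M (div_of J) (div_of J') =
    (\<Sum>i\<in>UNIV. ip M (\<lambda>x. J x $ i) (\<lambda>x. J' x $ i))"
proof (rule Hodge_identity[OF H10_field_sq_int(1)[OF assms(1)] H10_field_sq_int(1)[OF assms(2)]])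
  fix i j k l
  show "ip M (\<lambda>x. J x $ i $ j) (\<lambda>x. J' x $ k $ l) = ip M (\<lambda>x. J x $ i $ l) (\<lambda>x. J' x $ k $ j)"
    using H10_component_swap assms unfolding H10_field_def by blast
qed

text \<open>The boundary term in the exchange of derivatives vanishes through \<open>v\<close>
  alone, so \<open>V\<close> may be nonzero on the boundary. The planar case takes \<open>V\<close>
  normal to a boundary piece.\<close>

lemma Hodge_identity_smooth:
  assumes "H10_field \<Omega> v J" "smooth_field V"
  shows "ip M (curl_of J) (curl V) + ip M (div_of J) (div_of (jacobian V)) =
    (\<Sum>i\<in>UNIV. ip M (\<lambda>x. J x $ i) (grad (\<lambda>y. V y $ i)))"
proof -
  have "ip M (curl_of J) (curl_of (jacobian V)) + ip M (div_of J) (div_of (jacobian V)) =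
    (\<Sum>i\<in>UNIV. ip M (\<lambda>x. J x $ i) (\<lambda>x. jacobian V x $ i))"
  proof (rule Hodge_identity[OF H10_field_sq_int(1)[OF assms(1)] smooth_field_sq_int(1)[OF assms(2)]])
    fix i j k l
    show "ip M (\<lambda>x. J x $ i $ j) (\<lambda>x. jacobian V x $ k $ l) = ip M (\<lambda>x. J x $ i $ l) (\<lambda>x. jacobian V x $ k $ j)"
      using H10_pd_swap[of "\<lambda>x. v x $ i" "\<lambda>x. J x $ i" "\<lambda>y. V y $ k" j l]
        assms smooth_fieldD unfolding H10_field_def jacobian_component by blast
  qed
  then show ?thesis by (simp add: curl_jacobian jacobian_def)
qed

section \<open>Fields with zero tangential trace and divergence free fields\<close>

lemma Hcurl0_iff:
  "Hcurl0 \<Omega> u w \<longleftrightarrow> sq_int M u \<and> sq_int M w \<and> (\<forall>\<phi>. smooth_field \<phi> \<longrightarrow> ip M u (curl \<phi>) = ip M w \<phi>)"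
proof -
  have "test_field \<Omega> \<psi> \<Longrightarrow> smooth_field \<psi>" for \<psi>
    unfolding test_field_def smooth_field_def using test_fun_smooth by blast
  then show ?thesis unfolding Hcurl0_def weak_curl_def L2v_iff_sq_int ip_def by blast
qed

lemma Hcurl0_diff:
  assumes "Hcurl0 \<Omega> u w" "Hcurl0 \<Omega> v z"
  shows "Hcurl0 \<Omega> (\<lambda>x. u x - v x) (\<lambda>x. w x - z x)"
  using assms unfolding Hcurl0_iff by (auto simp: ip_diff_left smooth_field_sq_int intro: sq_int_diff)

lemma Hcurl0_add:
  assumes "Hcurl0 \<Omega> u w" "Hcurl0 \<Omega> v z"
  shows "Hcurl0 \<Omega> (\<lambda>x. u x + v x) (\<lambda>x. w x + z x)"
  using assms unfolding Hcurl0_iff by (auto simp: ip_add_left smooth_field_sq_int intro: sq_int_add)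

lemma Hcurl0_scaleR:
  assumes "Hcurl0 \<Omega> u w"
  shows "Hcurl0 \<Omega> (\<lambda>x. c *\<^sub>R u x) (\<lambda>x. c *\<^sub>R w x)"
  using assms unfolding Hcurl0_iff by (auto simp: ip_scaleR_left intro: sq_int_scaleR)

lemma ip_curl_expand:
  assumes "sq_int M u" "smooth_field \<phi>"
  shows "ip M u (curl \<phi>) =
    ip M (\<lambda>x. u x $ 1) (pd 2 (\<lambda>y. \<phi> y $ 3)) - ip M (\<lambda>x. u x $ 1) (pd 3 (\<lambda>y. \<phi> y $ 2)) +
    (ip M (\<lambda>x. u x $ 2) (pd 3 (\<lambda>y. \<phi> y $ 1)) - ip M (\<lambda>x. u x $ 2) (pd 1 (\<lambda>y. \<phi> y $ 3))) +
    (ip M (\<lambda>x. u x $ 3) (pd 1 (\<lambda>y. \<phi> y $ 2)) - ip M (\<lambda>x. u x $ 3) (pd 2 (\<lambda>y. \<phi> y $ 1)))"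
  unfolding ip_vec_sum[OF assms(1) smooth_field_sq_int(4)[OF assms(2)]] sum_3 curl_components
  by (simp add: ip_diff_right sq_int_component[OF assms(1)] smooth_sq_int smooth_pd smooth_fieldD[OF assms(2)])

lemma H10_field_Hcurl0:
  assumes "H10_field \<Omega> v J" shows "Hcurl0 \<Omega> v (curl_of J)"
  unfolding Hcurl0_iff
proof (intro conjI allI impI H10_field_sq_int[OF assms])
  fix \<phi> assume \<phi>: "smooth_field \<phi>"
  have p: "ip M (\<lambda>x. v x $ i) (pd j (\<lambda>y. \<phi> y $ k)) = - ip M (\<lambda>x. J x $ i $ j) (\<lambda>y. \<phi> y $ k)" for i j k
    using H10_by_parts[of "\<lambda>x. v x $ i" "\<lambda>x. J x $ i" "\<lambda>y. \<phi> y $ k" j] assms smooth_fieldD[OF \<phi>]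
    by (simp add: H10_field_def)
  show "ip M v (curl \<phi>) = ip M (curl_of J) \<phi>"
    unfolding ip_curl_expand[OF H10_field_sq_int(3)[OF assms] \<phi>] p
      ip_vec_sum[OF H10_field_sq_int(4)[OF assms] smooth_field_sq_int(3)[OF \<phi>]] sum_3 curl_of_components
    by (simp add: ip_diff_left H10_field_sq_int[OF assms] smooth_field_sq_int[OF \<phi>])
qed

lemma H10_field_div:
  assumes "H10_field \<Omega> v J" "H10 \<Omega> Q H"
  shows "ip M v H = - ip M (div_of J) Q"
proof -
  have p: "ip M (\<lambda>x. v x $ i) (\<lambda>x. H x $ i) = - ip M (\<lambda>x. J x $ i $ i) Q" for i
  proof -
    have "H10 \<Omega> (\<lambda>x. v x $ i) (\<lambda>x. J x $ i)" using assms(1) by (simp add: H10_field_def)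
    from H10_product_rule[OF this assms(2) smooth_const[of 1], of i]
    show ?thesis by simp
  qed
  show ?thesis
    unfolding ip_vec_sum[OF H10_field_sq_int(3)[OF assms(1)] H10_sq_int(2)[OF assms(2)]] p sum_3 div_of_def
    by (simp add: ip_add_left sq_int_add H10_field_sq_int[OF assms(1)] H10_sq_int[OF assms(2)])
qed

text \<open>A potential with zero trace has no tangential derivative on the boundary; weakly, the
  six terms of Green's formula cancel in pairs by \<open>H10_pd_swap\<close>.\<close>

lemma gradient_Hcurl0:
  assumes "H10 \<Omega> P G" shows "Hcurl0 \<Omega> G (\<lambda>x. 0)"
  unfolding Hcurl0_iff
proof (intro conjI allI impI H10_sq_int[OF assms] sq_int_zero)
  fix \<phi> assume \<phi>: "smooth_field \<phi>"
  have p: "ip M (\<lambda>x. G x $ i) (pd j (\<lambda>y. \<phi> y $ k)) = ip M (\<lambda>x. G x $ j) (pd i (\<lambda>y. \<phi> y $ k))" for i j k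
    by (rule H10_pd_swap[OF assms smooth_fieldD[OF \<phi>]])
  show "ip M G (curl \<phi>) = ip M (\<lambda>x. 0) \<phi>"
    unfolding ip_curl_expand[OF H10_sq_int(2)[OF assms] \<phi>] using p[of 1 2 3] p[of 1 3 2] p[of 2 3 1] by simp
qed

text \<open>By density the test functions in \<open>Hdiv0\<close> may be replaced by all of
  \<open>H10\<close>. Thus \<open>Hdiv0\<close> is the orthogonal complement of the closed space of
  gradients onto which \<open>Helmholtz_decomposition\<close> projects.\<close>

lemma Hdiv0_iff:
  "Hdiv0 \<Omega> u \<longleftrightarrow> sq_int M u \<and> (\<forall>P G. H10 \<Omega> P G \<longrightarrow> ip M u G = 0)"
proof
  assume u: "Hdiv0 \<Omega> u"
  then have s: "sq_int M u" by (simp add: Hdiv0_def L2v_iff_sq_int)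
  moreover have "ip M u G = 0" if P: "H10 \<Omega> P G" for P G
  proof -
    from H10_approx[OF P] obtain a where a: "\<And>n. test_fun \<Omega> (a n)" "\<And>n. smooth (a n)"
      "L2_lim M (\<lambda>n. grad (a n)) G" by metis
    have "(\<lambda>n. ip M (grad (a n)) u) \<longlonglongrightarrow> ip M G u"
      by (intro L2_lim_ip a s H10_sq_int[OF P] smooth_grad_sq_int)
    moreover have "ip M (grad (a n)) u = 0" for n
      using u a(1) by (subst ip_commute) (simp add: Hdiv0_def ip_def)
    ultimately show ?thesis by (simp add: LIMSEQ_const_iff ip_commute)
  qed
  ultimately show "sq_int M u \<and> (\<forall>P G. H10 \<Omega> P G \<longrightarrow> ip M u G = 0)" by blast
next
  assume "sq_int M u \<and> (\<forall>P G. H10 \<Omega> P G \<longrightarrow> ip M u G = 0)"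
  then show "Hdiv0 \<Omega> u"
    using test_fun_H10 by (auto simp: Hdiv0_def L2v_iff_sq_int ip_def)
qed

lemma closed_subspace_Hdiv0: "closed_subspace M (Hdiv0 \<Omega>)"
  unfolding closed_subspace_def
proof (intro conjI allI impI)
  fix f F assume *: "\<forall>n. Hdiv0 \<Omega> (f n)" "sq_int M F" "L2_lim M f F"
  show "Hdiv0 \<Omega> F" unfolding Hdiv0_iff
  proof (intro conjI allI impI *)
    fix P G assume P: "H10 \<Omega> P G"
    have "(\<lambda>n. ip M (f n) G) \<longlonglongrightarrow> ip M F G"
      using * H10_sq_int[OF P] by (intro L2_lim_ip) (auto simp: Hdiv0_iff)
    then show "ip M F G = 0" using * P by (simp add: Hdiv0_iff LIMSEQ_const_iff)
  qed
qed (auto simp: Hdiv0_iff ip_simps H10_sq_int sq_int_intros)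

text \<open>Since \<open>v = \<nabla>f\<close> is curl free, the Rellich type identity
  \<open>\<integral> x\<^sub>1 v\<^sub>1 div v = - \<integral> v\<^sub>1\<^sup>2 + 1/2 \<integral> |v|\<^sup>2\<close> holds. For \<open>div v = - \<mu> f\<close> its left-hand side is
  \<open>\<mu>/2 \<integral> f\<^sup>2 = 1/2 \<integral> |v|\<^sup>2\<close>, whence \<open>v\<^sub>1 = 0\<close>.\<close>

lemma overdetermined_eigenfunction_zero:
  assumes f: "H10 \<Omega> f G" and v: "H10_field \<Omega> v J" and Gv: "AE x in M. G x = v x"
    and div: "AE x in M. div_of J x = - \<mu> * f x"
  shows "AE x in M. f x = 0" "AE x in M. v x = 0"
proof -
  note fs = H10_sq_int[OF f] and vs = H10_field_sq_int[OF v]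
  have Gvi: "AE x in M. G x $ i = v x $ i" for i using Gv by eventually_elim simp
  have vi: "H10 \<Omega> (\<lambda>x. v x $ i) (\<lambda>x. J x $ i)" for i using v by (simp add: H10_field_def)
  let ?x = "\<lambda>x::real^3. x $ 1"
  note xs = sq_int_smooth_mult[OF smooth_component[of 1]]
  have pdx: "pd i ?x x = (if i = 1 then 1 else 0)" for i x by (rule pd_component)
  have vv: "nsq M v = \<mu> * nsq M f"
  proof -
    have "nsq M v = ip M v G" using Gv by (intro ip_cong_AE vs fs) auto
    also have "\<dots> = - ip M (div_of J) f" by (rule H10_field_div[OF v f])
    also have "ip M (div_of J) f = ip M (\<lambda>x. - \<mu> * f x) f" using div by (intro ip_cong_AE vs fs sq_int_mult) auto
    finally show ?thesis by (simp add: ip_simps)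
  qed
  \<comment> \<open>The integral of the first derivative of \<open>x $ 1 * (f x)^2\<close> is
    zero.\<close>
  have xf: "2 * ip M (\<lambda>x. ?x x * v x $ 1) f = - nsq M f"
  proof -
    have "ip M (\<lambda>x. ?x x * G x $ 1) f = ip M (\<lambda>x. ?x x * v x $ 1) f"
      using Gvi[of 1] by (intro ip_cong_AE xs fs vs sq_int_component[OF fs(2)]) auto
    moreover have "ip M (\<lambda>x. ?x x * f x) (\<lambda>x. G x $ 1) = ip M (\<lambda>x. ?x x * G x $ 1) f"
      unfolding ip_def by (simp add: ac_simps)
    ultimately show ?thesis
      using H10_product_rule[OF f f smooth_component[of 1], of 1] by (simp add: pdx)
  qed
  \<comment> \<open>Symmetry of the Jacobian of a gradient, tested against
    \<open>x $ 1 * h x\<close>. It is known for smooth test functions and extends to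
    \<open>h\<close> in \<open>H10\<close> by approximation.\<close>
  have curlfree: "ip M (\<lambda>x. ?x x * h x) (\<lambda>x. J x $ 1 $ i) = ip M (\<lambda>x. ?x x * h x) (\<lambda>x. J x $ i $ 1)"
    if h: "H10 \<Omega> h H" for h H i
  proof -
    note hs = H10_sq_int[OF h]
    from H10_approx[OF h] obtain a where a: "\<And>n. test_fun \<Omega> (a n)" "\<And>n. smooth (a n)"
      "L2_lim M a h" by metis
    have t: "ip M (\<lambda>x. J x $ 1 $ i) \<theta> = ip M (\<lambda>x. J x $ i $ 1) \<theta>" if \<theta>: "smooth \<theta>" for \<theta>
    proof -
      have "ip M (\<lambda>x. J x $ k $ l) \<theta> = - ip M (\<lambda>x. G x $ k) (pd l \<theta>)" for k l
      proof -
        have "ip M (\<lambda>x. v x $ k) (pd l \<theta>) = ip M (\<lambda>x. G x $ k) (pd l \<theta>)"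
          using Gvi[of k] by (intro ip_cong_AE vs sq_int_component[OF fs(2)] smooth_sq_int smooth_pd \<theta>) auto
        then show ?thesis using H10_by_parts[OF vi \<theta>] by simp
      qed
      then show ?thesis using H10_pd_swap[OF f \<theta>, of 1 i] by simp
    qed
    have lim: "(\<lambda>n. ip M (\<lambda>x. ?x x * a n x) (\<lambda>x. J x $ k $ l)) \<longlonglongrightarrow> ip M (\<lambda>x. ?x x * h x) (\<lambda>x. J x $ k $ l)" for k l
      by (intro L2_lim_ip L2_lim_smooth_mult smooth_component xs vs smooth_sq_int a hs)
    have "ip M (\<lambda>x. ?x x * a n x) (\<lambda>x. J x $ 1 $ i) = ip M (\<lambda>x. ?x x * a n x) (\<lambda>x. J x $ i $ 1)" for n
      using t[OF smooth_mult[OF smooth_component[of 1] a(2)]] by (simp add: ip_commute)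
    then show ?thesis using LIMSEQ_unique[OF lim[of 1 i]] lim[of i 1] by simp
  qed
  \<comment> \<open>Move the \<open>i\<close>-th derivative off \<open>v $ i\<close>, replace the
    \<open>i\<close>-th derivative of \<open>v $ 1\<close> by the first derivative of
    \<open>v $ i\<close>, and recognise half the first derivative of
    \<open>(v $ i)^2\<close>.\<close>
  have term1: "ip M (\<lambda>x. ?x x * v x $ 1) (\<lambda>x. J x $ i $ i) =
      - (if i = 1 then nsq M (\<lambda>x. v x $ 1) else 0) + nsq M (\<lambda>x. v x $ i) / 2" for i
  proof -
    have "ip M (\<lambda>x. ?x x * J x $ 1 $ i) (\<lambda>x. v x $ i) + ip M (\<lambda>x. ?x x * v x $ 1) (\<lambda>x. J x $ i $ i) =
       - (if i = 1 then nsq M (\<lambda>x. v x $ 1) else 0)"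
      using H10_product_rule[OF vi[of 1] vi[of i] smooth_component[of 1], of i] by (simp add: pdx)
    moreover have "ip M (\<lambda>x. ?x x * J x $ 1 $ i) (\<lambda>x. v x $ i) = ip M (\<lambda>x. ?x x * v x $ i) (\<lambda>x. J x $ i $ 1)"
      using curlfree[OF vi[of i], of i] unfolding ip_def by (simp add: ac_simps)
    moreover have "2 * ip M (\<lambda>x. ?x x * v x $ i) (\<lambda>x. J x $ i $ 1) = - nsq M (\<lambda>x. v x $ i)"
    proof -
      have "ip M (\<lambda>x. ?x x * J x $ i $ 1) (\<lambda>x. v x $ i) = ip M (\<lambda>x. ?x x * v x $ i) (\<lambda>x. J x $ i $ 1)"
        unfolding ip_def by (simp add: ac_simps)
      then show ?thesis
        using H10_product_rule[OF vi[of i] vi[of i] smooth_component[of 1], of 1] by (simp add: pdx)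
    qed
    ultimately show ?thesis by (simp add: field_simps)
  qed
  have "ip M (\<lambda>x. ?x x * v x $ 1) (div_of J) = (\<Sum>i\<in>UNIV. ip M (\<lambda>x. ?x x * v x $ 1) (\<lambda>x. J x $ i $ i))"
    unfolding div_of_def sum_3 by (simp add: ip_add_right sq_int_add vs xs)
  also have "\<dots> = - nsq M (\<lambda>x. v x $ 1) + nsq M v / 2"
    unfolding term1 ip_vec_sum[OF vs(3) vs(3)] sum_3 by (simp add: field_simps)
  finally have A: "ip M (\<lambda>x. ?x x * v x $ 1) (div_of J) = - nsq M (\<lambda>x. v x $ 1) + nsq M v / 2" .
  have "ip M (\<lambda>x. ?x x * v x $ 1) (div_of J) = ip M (\<lambda>x. ?x x * v x $ 1) (\<lambda>x. - \<mu> * f x)"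
    using div by (intro ip_cong_AE xs vs fs sq_int_mult) auto
  also have "\<dots> = - \<mu> * ip M (\<lambda>x. ?x x * v x $ 1) f" by (rule ip_mult_right)
  also have "ip M (\<lambda>x. ?x x * v x $ 1) f = - nsq M f / 2" using xf by simp
  also have "- \<mu> * (- nsq M f / 2) = \<mu> / 2 * nsq M f" by simp
  finally have "nsq M (\<lambda>x. v x $ 1) = 0" using A vv by simp
  \<comment> \<open>With the first component gone, the left side of \<open>xf\<close> is zero, so
    \<open>f\<close> vanishes, and then \<open>vv\<close> removes \<open>v\<close> as well.\<close>
  then have v1: "AE x in M. v x $ 1 = 0" using ip_self_eq_0 vs by blast
  then have "ip M (\<lambda>x. ?x x * v x $ 1) f = ip M (\<lambda>x. 0) f"
    by (intro ip_cong_AE xs fs vs sq_int_zero) auto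
  with xf have f0: "nsq M f = 0" by simp
  then show "AE x in M. f x = 0" by (rule ip_self_eq_0[OF fs(1)])
  show "AE x in M. v x = 0" using ip_self_eq_0[OF vs(3)] f0 vv by simp
qed

end

section \<open>The Hodge energy and the non-strict inequality\<close>

text \<open>The weak gradients \<open>g j\<close> and weak curls \<open>w j\<close>, existentially
  quantified in the eigenpair definitions, are fixed here together with the eigenfunctions.\<close>

locale eigen_data = bounded_open \<Omega> for \<Omega> :: "(real^3) set" +
  fixes lam alpha :: "nat \<Rightarrow> real" and \<phi> :: "nat \<Rightarrow> real^3 \<Rightarrow> real" and g u w :: "nat \<Rightarrow> real^3 \<Rightarrow> real^3"
  assumes lam_mono: "1 \<le> j \<Longrightarrow> j \<le> k \<Longrightarrow> lam j \<le> lam k"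
    and alpha_mono: "1 \<le> j \<Longrightarrow> j \<le> k \<Longrightarrow> alpha j \<le> alpha k"
    and phi_H10: "j \<ge> 1 \<Longrightarrow> H10 \<Omega> (\<phi> j) (g j)"
    and phi_weak: "j \<ge> 1 \<Longrightarrow> H10 \<Omega> \<psi> H \<Longrightarrow> ip M (g j) H = lam j * ip M (\<phi> j) \<psi>"
    and phi_on: "i \<ge> 1 \<Longrightarrow> j \<ge> 1 \<Longrightarrow> ip M (\<phi> i) (\<phi> j) = (if i = j then 1 else 0)"
    and phi_complete: "sq_int M f \<Longrightarrow> (\<And>j. j \<ge> 1 \<Longrightarrow> ip M f (\<phi> j) = 0) \<Longrightarrow> AE x in M. f x = 0"
    and u_Hdiv0: "j \<ge> 1 \<Longrightarrow> Hdiv0 \<Omega> (u j)"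
    and u_Hcurl0: "j \<ge> 1 \<Longrightarrow> Hcurl0 \<Omega> (u j) (w j)"
    and u_weak: "j \<ge> 1 \<Longrightarrow> Hdiv0 \<Omega> v \<Longrightarrow> Hcurl0 \<Omega> v z \<Longrightarrow> ip M (w j) z = alpha j * ip M (u j) v"
    and u_on: "i \<ge> 1 \<Longrightarrow> j \<ge> 1 \<Longrightarrow> ip M (u i) (u j) = (if i = j then 1 else 0)"
    and u_complete: "Hdiv0 \<Omega> v \<Longrightarrow> (\<And>j. j \<ge> 1 \<Longrightarrow> ip M v (u j) = 0) \<Longrightarrow> AE x in M. v x = 0"
begin

lemma phi_sq_int: "j \<ge> 1 \<Longrightarrow> sq_int M (\<phi> j)" and g_sq_int: "j \<ge> 1 \<Longrightarrow> sq_int M (g j)"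
  using phi_H10 H10_sq_int by blast+

lemma u_sq_int: "j \<ge> 1 \<Longrightarrow> sq_int M (u j)" and w_sq_int: "j \<ge> 1 \<Longrightarrow> sq_int M (w j)"
  using u_Hcurl0 by (auto simp: Hcurl0_iff)

text \<open>Poincare for the normalised \<open>\<phi> j\<close> reads
  \<open>1 \<le> C * lam j\<close>. Positivity later allows cancelling \<open>lam j\<close>, which
  turns orthogonality to \<open>g j\<close> into orthogonality of potentials to
  \<open>\<phi> j\<close>.\<close>

lemma lam_pos: assumes "j \<ge> 1" shows "lam j > 0"
proof -
  obtain C where C: "C \<ge> 0" "nsq M (\<phi> j) \<le> C * nsq M (g j)" using Poincare phi_H10[OF assms] by blast
  have "nsq M (g j) = lam j" using phi_weak[OF assms phi_H10[OF assms]] phi_on[OF assms assms] by simp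
  then have "1 \<le> C * lam j" using C phi_on[OF assms assms] by simp
  moreover have "lam j \<ge> 0" using \<open>nsq M (g j) = lam j\<close> ip_nonneg[of M "g j"] by simp
  ultimately show ?thesis by (cases "lam j = 0") auto
qed

lemma Dirichlet_Rayleigh:
  assumes P: "H10 \<Omega> P G" and orth: "\<And>j. 1 \<le> j \<Longrightarrow> j < m \<Longrightarrow> ip M P (\<phi> j) = 0" and m: "m \<ge> 1"
  shows "lam m * nsq M P \<le> nsq M G"
proof (rule Rayleigh_lower_bound[OF closed_subspace_sq_int phi_sq_int phi_on phi_complete g_sq_int _ lam_mono
      H10_sq_int(1)[OF P] H10_sq_int(2)[OF P] _ orth m])
  show "ip M (g i) (g j) = lam j * ip M (\<phi> i) (\<phi> j)" if "i \<ge> 1" "j \<ge> 1" for i j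
    using phi_weak[OF that(2) phi_H10[OF that(1)]] by (simp add: ip_commute)
  show "ip M G (g j) = lam j * ip M P (\<phi> j)" if "j \<ge> 1" for j
    using phi_weak[OF that P] by (simp add: ip_commute)
qed auto

lemma curl_Rayleigh:
  assumes z: "Hdiv0 \<Omega> z" "Hcurl0 \<Omega> z \<zeta>" and orth: "\<And>j. 1 \<le> j \<Longrightarrow> j < m \<Longrightarrow> ip M z (u j) = 0" and m: "m \<ge> 1"
  shows "alpha m * nsq M z \<le> nsq M \<zeta>"
proof (rule Rayleigh_lower_bound[OF closed_subspace_Hdiv0 u_Hdiv0 u_on u_complete w_sq_int _ alpha_mono
      z(1) _ _ orth m])
  show "ip M (w i) (w j) = alpha j * ip M (u i) (u j)" if "i \<ge> 1" "j \<ge> 1" for i j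
    using u_weak[OF that(2) u_Hdiv0[OF that(1)] u_Hcurl0[OF that(1)]] by (simp add: ip_commute)
  show "ip M \<zeta> (w j) = alpha j * ip M z (u j)" if "j \<ge> 1" for j
    using u_weak[OF that z] by (simp add: ip_commute)
  show "sq_int M \<zeta>" using z by (simp add: Hcurl0_iff)
qed auto

text \<open>The Hodge energy of \<open>v\<close> (curl \<open>W\<close>, divergence \<open>D\<close>) is bounded below by splitting
  \<open>v = z + \<nabla>P\<close>; the gradient part uses \<open>\<parallel>D\<parallel>\<^sup>2 - \<mu> \<parallel>\<nabla>P\<parallel>\<^sup>2 \<ge> \<parallel>D + \<mu> P\<parallel>\<^sup>2\<close>.\<close>

lemma Hodge_energy_lower_bound:
  assumes v: "Hcurl0 \<Omega> v W" and D: "sq_int M D" "\<forall>Q H. H10 \<Omega> Q H \<longrightarrow> ip M v H = - ip M D Q"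
    and m: "m \<ge> 1" "\<forall>j\<ge>1. j < m \<longrightarrow> ip M v (u j) = 0"
    and l: "l \<ge> 1" "\<forall>j\<ge>1. j < l \<longrightarrow> ip M v (g j) = 0"
    and \<mu>: "0 \<le> \<mu>" "\<mu> \<le> lam l"
  shows "\<exists>P G. H10 \<Omega> P G \<and> Hdiv0 \<Omega> (\<lambda>x. v x - G x) \<and> Hcurl0 \<Omega> (\<lambda>x. v x - G x) W \<and>
    (\<forall>j\<ge>1. j < m \<longrightarrow> ip M (\<lambda>x. v x - G x) (u j) = 0) \<and>
    (\<forall>j\<ge>1. j < l \<longrightarrow> ip M P (\<phi> j) = 0) \<and>
    nsq M v = nsq M (\<lambda>x. v x - G x) + nsq M G \<and>
    alpha m * nsq M (\<lambda>x. v x - G x) \<le> nsq M W \<and>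
    \<mu> * nsq M G + nsq M (\<lambda>x. D x + \<mu> * P x) \<le> nsq M D"
proof -
  have vs: "sq_int M v" using v by (simp add: Hcurl0_iff)
  obtain P G where P: "H10 \<Omega> P G" and orth: "\<And>Q H. H10 \<Omega> Q H \<Longrightarrow> ip M (\<lambda>x. v x - G x) H = 0"
    using Helmholtz_decomposition[OF vs] by blast
  note Ps = H10_sq_int[OF P]
  let ?z = "\<lambda>x. v x - G x"
  have zs: "sq_int M ?z" by (intro sq_int_diff vs Ps)
  have z1: "Hdiv0 \<Omega> ?z" unfolding Hdiv0_iff using zs orth by blast
  have z2: "Hcurl0 \<Omega> ?z W" using Hcurl0_diff[OF v gradient_Hcurl0[OF P]] by simp
  \<comment> \<open>The eigenfields are divergence free, hence orthogonal to \<open>G\<close>;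
    subtracting \<open>G\<close> preserves orthogonality to them.\<close>
  have z3: "ip M ?z (u j) = 0" if j: "1 \<le> j" "j < m" for j
  proof -
    have "ip M (u j) G = 0" using u_Hdiv0[OF j(1)] P by (auto simp: Hdiv0_iff)
    then show ?thesis using m(2)[rule_format, OF j] by (simp add: ip_diff_left vs Ps u_sq_int[OF j(1)] ip_commute[of M G])
  qed
  \<comment> \<open>The divergence free part is orthogonal to \<open>g j\<close>, so
    \<open>G\<close> inherits the condition from \<open>v\<close>, and the weak eigenvalue equation
    passes it to \<open>P\<close>.\<close>
  have P1: "ip M P (\<phi> j) = 0" if j: "1 \<le> j" "j < l" for j
  proof -
    have "ip M v (g j) - ip M G (g j) = 0"
      using orth[OF phi_H10[OF j(1)]] by (simp add: ip_diff_left vs Ps g_sq_int[OF j(1)])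
    then have "lam j * ip M P (\<phi> j) = 0" using l(2)[rule_format, OF j] phi_weak[OF j(1) P] by (simp add: ip_commute)
    then show ?thesis using lam_pos[OF j(1)] by simp
  qed
  have vG: "ip M v G = nsq M G" using orth[OF P] by (simp add: ip_diff_left vs Ps)
  have n: "nsq M v = nsq M ?z + nsq M G"
    by (simp add: ip_expand_diff[OF vs Ps(2)] vG)
  have e: "alpha m * nsq M ?z \<le> nsq M W" by (rule curl_Rayleigh[OF z1 z2 z3 m(1)])
  \<comment> \<open>Pairing \<open>D\<close> with \<open>P\<close> gives \<open>- nsq M G\<close>.
    After expansion the claim is \<open>\<mu> * (\<mu> * nsq M P) \<le> \<mu> * nsq M G\<close>,
    which is the Dirichlet Rayleigh bound.\<close>
  have "nsq M (\<lambda>x. D x + \<mu> * P x) = nsq M D - 2 * \<mu> * nsq M G + \<mu> * (\<mu> * nsq M P)"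
    using D(2)[rule_format, OF P] by (simp add: ip_expand_add D(1) Ps sq_int_mult ip_mult_left ip_mult_right vG)
  moreover have "\<mu> * nsq M P \<le> nsq M G"
    using Dirichlet_Rayleigh[OF P P1 l(1)] mult_right_mono[OF \<mu>(2) ip_nonneg[of M P]] by linarith
  then have "\<mu> * (\<mu> * nsq M P) \<le> \<mu> * nsq M G" using \<mu>(1) by (rule mult_left_mono)
  ultimately have "\<mu> * nsq M G + nsq M (\<lambda>x. D x + \<mu> * P x) \<le> nsq M D" by linarith
  with P z1 z2 z3 P1 n e show ?thesis by blast
qed

section \<open>The trial space of constant vectors times Dirichlet eigenfunctions\<close>

definition comb :: "nat \<Rightarrow> (nat \<Rightarrow> real^3) \<Rightarrow> real^3 \<Rightarrow> real^3" where
  "comb k b x = (\<Sum>j\<in>{1..k}. \<phi> j x *\<^sub>R b j)"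

definition comb_grad :: "nat \<Rightarrow> (nat \<Rightarrow> real^3) \<Rightarrow> real^3 \<Rightarrow> real^3^3" where
  "comb_grad k b x = (\<chi> i. \<Sum>j\<in>{1..k}. b j $ i *\<^sub>R g j x)"

lemma comb_component: "comb k b x $ i = (\<Sum>j\<in>{1..k}. b j $ i * \<phi> j x)"
  by (simp add: comb_def mult.commute)

lemma comb_H10: "H10_field \<Omega> (comb k b) (comb_grad k b)"
  unfolding H10_field_def
proof
  fix i
  have "H10 \<Omega> (\<lambda>x. \<Sum>j\<in>{1..k}. b j $ i * \<phi> j x) (\<lambda>x. \<Sum>j\<in>{1..k}. b j $ i *\<^sub>R g j x)"
    by (intro H10_sum H10_cmult phi_H10) auto
  then show "H10 \<Omega> (\<lambda>x. comb k b x $ i) (\<lambda>x. comb_grad k b x $ i)"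
    by (simp add: comb_component comb_grad_def)
qed

lemmas comb_sq_int = H10_field_sq_int[OF comb_H10]

lemma ip_comb:
  assumes "sq_int M U"
  shows "ip M (comb k b) U = (\<Sum>j\<in>{1..k}. \<Sum>i\<in>UNIV. b j $ i * ip M (\<phi> j) (\<lambda>x. U x $ i))"
proof -
  have "ip M (comb k b) U = (\<Sum>i\<in>UNIV. ip M (\<lambda>x. \<Sum>j\<in>{1..k}. b j $ i * \<phi> j x) (\<lambda>x. U x $ i))"
    by (simp add: ip_vec_sum[OF comb_sq_int(3) assms] comb_component)
  also have "\<dots> = (\<Sum>i\<in>UNIV. \<Sum>j\<in>{1..k}. b j $ i * ip M (\<phi> j) (\<lambda>x. U x $ i))"
    by (intro sum.cong refl, subst ip_sum_left)
       (auto intro!: sum.cong sq_int_mult phi_sq_int sq_int_component assms simp: ip_mult_left)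
  finally show ?thesis by (simp add: sum.swap[of _ UNIV])
qed

lemma ip_comb_phi:
  assumes "j \<ge> 1"
  shows "ip M (\<phi> j) (\<lambda>x. comb k b x $ i) = (if j \<le> k then b j $ i else 0)"
proof -
  have "ip M (\<phi> j) (\<lambda>x. comb k b x $ i) = (\<Sum>l\<in>{1..k}. b l $ i * ip M (\<phi> j) (\<phi> l))"
    unfolding comb_component
    using assms by (subst ip_sum_right) (auto intro!: sum.cong sq_int_mult phi_sq_int simp: ip_mult_right)
  also have "\<dots> = (\<Sum>l\<in>{1..k}. if l = j then b j $ i else 0)"
    using phi_on[OF assms] by (intro sum.cong) auto
  finally show ?thesis using assms by simp
qed

lemma comb_norm: "nsq M (comb k b) = (\<Sum>j\<in>{1..k}. (norm (b j))^2)"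
  unfolding ip_comb[OF comb_sq_int(3)]
  by (intro sum.cong) (auto simp: ip_comb_phi power2_norm_eq_inner inner_vec_def)

text \<open>By the Hodge identity the energy is the sum of the Dirichlet energies of the components,
  in which the eigenfunctions decouple.\<close>

lemma comb_energy:
  "nsq M (curl_of (comb_grad k b)) + nsq M (div_of (comb_grad k b)) =
    (\<Sum>j\<in>{1..k}. lam j * (norm (b j))^2)"
proof -
  have gi: "ip M (g j) (\<lambda>x. comb_grad k b x $ i) = lam j * (b j $ i)" if "1 \<le> j" "j \<le> k" for i j
    using phi_weak[OF that(1), of "\<lambda>x. comb k b x $ i" "\<lambda>x. comb_grad k b x $ i"] comb_H10[of k b] that
    by (simp add: H10_field_def ip_comb_phi)
  have s: "sq_int M (\<lambda>x. comb_grad k b x $ i)" for i by (intro sq_int_vec comb_sq_int)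
  have "nsq M (\<lambda>x. comb_grad k b x $ i) = (\<Sum>j\<in>{1..k}. lam j * (b j $ i * b j $ i))" for i
  proof -
    have "nsq M (\<lambda>x. comb_grad k b x $ i) =
        ip M (\<lambda>x. \<Sum>j\<in>{1..k}. b j $ i *\<^sub>R g j x) (\<lambda>x. comb_grad k b x $ i)"
      by (simp add: comb_grad_def)
    also have "\<dots> = (\<Sum>j\<in>{1..k}. b j $ i * ip M (g j) (\<lambda>x. comb_grad k b x $ i))"
      by (subst ip_sum_left) (auto intro!: sq_int_scaleR g_sq_int s simp: ip_scaleR_left)
    also have "\<dots> = (\<Sum>j\<in>{1..k}. lam j * (b j $ i * b j $ i))"
      by (intro sum.cong) (auto simp: gi)
    finally show ?thesis .
  qed
  then have "(\<Sum>i\<in>UNIV. nsq M (\<lambda>x. comb_grad k b x $ i)) =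
      (\<Sum>j\<in>{1..k}. lam j * (\<Sum>i\<in>UNIV. b j $ i * b j $ i))"
    by (simp add: sum.swap[of _ UNIV] sum_distrib_left)
  then show ?thesis
    unfolding Hodge_identity_H10[OF comb_H10 comb_H10] by (simp add: power2_norm_eq_inner inner_vec_def)
qed

lemma comb_energy_le:
  "nsq M (curl_of (comb_grad k b)) + nsq M (div_of (comb_grad k b))
    \<le> lam k * nsq M (comb k b)"
  unfolding comb_energy comb_norm sum_distrib_left
  by (intro sum_mono mult_right_mono lam_mono) auto

theorem alpha_le_lam:
  assumes k: "k \<ge> 1"
  shows "alpha (2 * k + 1) \<le> lam k"
proof (rule ccontr)
  assume "\<not> alpha (2 * k + 1) \<le> lam k"
  then have less: "lam k < alpha (2 * k + 1)" by simp
  \<comment> \<open>\<open>None\<close> indexes the coefficient of the extra field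
    \<open>g k\<close>, and \<open>Some (j, i)\<close> that of \<open>\<phi> j\<close> in direction
    \<open>i\<close>.\<close>
  define I where "I = insert None (Some ` ({1..k} \<times> (UNIV :: 3 set)))"
  define J where "J = u ` {1..2*k} \<union> g ` {1..k}"
  define A where "A U p = (case p of None \<Rightarrow> ip M (g k) U | Some (j, i) \<Rightarrow> ip M (\<phi> j) (\<lambda>x. U x $ i))"
    for U :: "real^3 \<Rightarrow> real^3" and p
  have "card J \<le> 2 * k + k"
    unfolding J_def by (intro order_trans[OF card_Un_le] add_mono order_trans[OF card_image_le]) auto
  moreover have "card I = 3 * k + 1"
    unfolding I_def by (subst card_insert_disjoint) (auto simp: card_image inj_on_def card_cartesian_product)
  ultimately obtain x where x: "\<exists>p\<in>I. x p \<noteq> 0" "\<forall>U\<in>J. (\<Sum>p\<in>I. A U p * x p) = 0"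
    using exists_common_zero[of J I A] by (auto simp: I_def J_def)
  define c where "c = x None"
  define b where "b j = (\<chi> i. x (Some (j, i)))" for j
  define F where "F y = comb k b y + c *\<^sub>R g k y" for y
  have gs: "sq_int M (g k)" and ps: "sq_int M (\<phi> k)" by (rule g_sq_int[OF k], rule phi_sq_int[OF k])
  note cs = comb_sq_int[of k b]
  have FU: "ip M F U = 0" if "U \<in> J" for U
  proof -
    have U: "sq_int M U" using that g_sq_int u_sq_int by (auto simp: J_def)
    have "ip M F U = (\<Sum>p\<in>I. A U p * x p)"
      unfolding F_def I_def A_def
      by (subst sum.insert, simp, force, subst sum.reindex)
         (auto simp: ip_add_left cs sq_int_scaleR gs U ip_scaleR_left ip_comb c_def b_def sum.cartesian_product
           case_prod_unfold algebra_simps)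
    then show ?thesis using x(2) that by simp
  qed
  let ?W = "curl_of (comb_grad k b)"
  \<comment> \<open>The divergence of \<open>F\<close>: that of \<open>g k\<close> is
    \<open>- lam k * \<phi> k\<close>. Since \<open>g k\<close> need not have components in
    \<open>H10\<close>, the divergence is justified by duality in \<open>FD\<close>.\<close>
  define D where "D y = div_of (comb_grad k b) y - c * lam k * \<phi> k y" for y
  have gk: "ip M (g k) H = lam k * ip M (\<phi> k) Q" if "H10 \<Omega> Q H" for Q H by (rule phi_weak[OF k that])
  have Fs: "sq_int M F" unfolding F_def by (intro sq_int_add sq_int_scaleR cs gs)
  have Ds: "sq_int M D" unfolding D_def by (intro sq_int_diff sq_int_mult cs ps)
  have FW: "Hcurl0 \<Omega> F ?W"
    using Hcurl0_add[OF H10_field_Hcurl0[OF comb_H10] Hcurl0_scaleR[OF gradient_Hcurl0[OF phi_H10[OF k]]], of k b c]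
    by (simp add: F_def[abs_def])
  have FD: "\<forall>Q H. H10 \<Omega> Q H \<longrightarrow> ip M F H = - ip M D Q"
  proof (intro allI impI)
    fix Q H assume Q: "H10 \<Omega> Q H"
    show "ip M F H = - ip M D Q"
    unfolding F_def D_def using H10_field_div[OF comb_H10 Q, of k b] gk[OF Q] H10_sq_int[OF Q]
    by (simp add: ip_simps cs sq_int_intros gs ps)
  qed
  \<comment> \<open>Adding \<open>c *\<^sub>R g k\<close> changes the energy by exactly
    \<open>lam k\<close> times the change in the squared norm, so the bound for \<open>comb\<close>
    carries over.\<close>
  have upper: "nsq M ?W + nsq M D \<le> lam k * nsq M F"
  proof -
    have cg: "ip M (comb k b) (g k) = - ip M (div_of (comb_grad k b)) (\<phi> k)"
      by (rule H10_field_div[OF comb_H10 phi_H10[OF k]])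
    have gg: "nsq M (g k) = lam k * nsq M (\<phi> k)" by (rule gk[OF phi_H10[OF k]])
    have "nsq M D = nsq M (div_of (comb_grad k b)) +
        2 * c * lam k * ip M (comb k b) (g k) + lam k * (c^2 * nsq M (g k))"
      unfolding D_def by (simp add: ip_expand_diff cs sq_int_mult ps ip_mult_left ip_mult_right cg gg power2_eq_square)
    moreover have "nsq M F = nsq M (comb k b) + 2 * c * ip M (comb k b) (g k) + c^2 * nsq M (g k)"
      unfolding F_def by (simp add: ip_expand_add cs sq_int_scaleR gs ip_scaleR_left ip_scaleR_right power2_eq_square)
    ultimately show ?thesis using comb_energy_le[of k b] by (simp add: algebra_simps)
  qed
  have Fu: "\<forall>j\<ge>1. j < 2 * k + 1 \<longrightarrow> ip M F (u j) = 0"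
    by (intro allI impI FU) (auto simp: J_def)
  have Fg: "\<forall>j\<ge>1. j < k + 1 \<longrightarrow> ip M F (g j) = 0"
    by (intro allI impI FU) (auto simp: J_def)
  have lk: "0 \<le> lam k" "lam k \<le> lam (k + 1)" using lam_pos[OF k] lam_mono[OF k, of "k + 1"] by auto
  note low = Hodge_energy_lower_bound[OF FW Ds FD le_add2 Fu le_add2 Fg lk]
  from low obtain P G where P: "H10 \<Omega> P G" "Hdiv0 \<Omega> (\<lambda>x. F x - G x)" "Hcurl0 \<Omega> (\<lambda>x. F x - G x) ?W"
    "\<And>j. 1 \<le> j \<Longrightarrow> j < 2 * k + 1 \<Longrightarrow> ip M (\<lambda>x. F x - G x) (u j) = 0"
    "\<And>j. 1 \<le> j \<Longrightarrow> j < k + 1 \<Longrightarrow> ip M P (\<phi> j) = 0"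
    "nsq M F = nsq M (\<lambda>x. F x - G x) + nsq M G"
    "alpha (2 * k + 1) * nsq M (\<lambda>x. F x - G x) \<le> nsq M ?W"
    "lam k * nsq M G + nsq M (\<lambda>x. D x + lam k * P x) \<le> nsq M D"
    by blast
  note Ps = H10_sq_int[OF P(1)]
  let ?z = "\<lambda>x. F x - G x"
  \<comment> \<open>The upper and lower energy bounds leave no slack: both nonnegative terms vanish,
    so the divergence free part is zero and \<open>F\<close> is a gradient almost
    everywhere.\<close>
  have "(alpha (2 * k + 1) - lam k) * nsq M ?z + nsq M (\<lambda>x. D x + lam k * P x) \<le> 0"
    using upper P(6,7,8) by (simp add: algebra_simps)
  moreover have "0 \<le> (alpha (2 * k + 1) - lam k) * nsq M ?z" using less by simp
  moreover have "0 \<le> nsq M (\<lambda>x. D x + lam k * P x)" by simp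
  ultimately have "(alpha (2 * k + 1) - lam k) * nsq M ?z = 0" and
    D0: "nsq M (\<lambda>x. D x + lam k * P x) = 0" by linarith+
  then have z0: "nsq M ?z = 0" using less by simp
  have FG: "AE y in M. F y - G y = 0" by (intro ip_self_eq_0 z0 sq_int_diff Fs Ps)
  have DP: "AE y in M. D y + lam k * P y = 0" by (intro ip_self_eq_0 D0 sq_int_add sq_int_mult Ds Ps)
  \<comment> \<open>Shifting the potential by \<open>c * \<phi> k\<close> removes the extra field.
    The new potential has gradient \<open>comb k b\<close>, with components in \<open>H10\<close>,
    and satisfies the eigenvalue equation: this is the overdetermined situation.\<close>
  have f: "H10 \<Omega> (\<lambda>y. P y - c * \<phi> k y) (\<lambda>y. G y - c *\<^sub>R g k y)"
    by (intro H10_diff H10_cmult P(1) phi_H10 k)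
  have "AE y in M. G y - c *\<^sub>R g k y = comb k b y" using FG
  proof eventually_elim
    case (elim y)
    then have "G y = comb k b y + c *\<^sub>R g k y" by (simp add: F_def)
    then show ?case by simp
  qed
  moreover have "AE y in M. div_of (comb_grad k b) y = - lam k * (P y - c * \<phi> k y)" using DP
    by eventually_elim (simp add: D_def algebra_simps)
  ultimately have f0: "AE y in M. P y - c * \<phi> k y = 0" and v0: "AE y in M. comb k b y = 0"
    using overdetermined_eigenfunction_zero[OF f comb_H10] by blast+
  \<comment> \<open>Orthogonality of \<open>P\<close> to \<open>\<phi> k\<close> isolates the
    coefficient \<open>c\<close>.\<close>
  have "ip M (\<lambda>y. P y - c * \<phi> k y) (\<phi> k) = ip M (\<lambda>y. 0) (\<phi> k)"
    using f0 by (intro ip_cong_AE sq_int_diff sq_int_mult sq_int_zero Ps ps) auto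
  then have "c = 0" using P(5)[of k] k phi_on[OF k k]
    by (simp add: ip_diff_left Ps ps sq_int_mult ip_mult_left)
  moreover have "b j = 0" if "j \<in> {1..k}" for j
  proof -
    have "nsq M (comb k b) = ip M (\<lambda>y. 0) (comb k b)"
      using v0 by (intro ip_cong_AE cs sq_int_zero) auto
    then have "(\<Sum>j\<in>{1..k}. (norm (b j))^2) = 0" by (simp add: comb_norm)
    then show ?thesis using that by (subst (asm) sum_nonneg_eq_0_iff) auto
  qed
  ultimately show False using x(1) by (auto simp: I_def c_def b_def vec_eq_iff)
qed

end

section \<open>The case of equality\<close>

lemma linear_coeff_zero_of_nonneg:
  fixes a c :: real
  assumes "\<And>t. 0 \<le> t * a + t^2 * c" shows "a = 0"
proof (rule ccontr)
  assume a: "a \<noteq> 0"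
  define t where "t = - a / (\<bar>c\<bar> + 1)"
  have c: "\<bar>c\<bar> + 1 > 0" by linarith
  have "t^2 * c \<le> t^2 * \<bar>c\<bar>" by (intro mult_left_mono) auto
  also have "\<dots> < t^2 * (\<bar>c\<bar> + 1)" using a c by (simp add: t_def)
  also have "t^2 * (\<bar>c\<bar> + 1) = t * (t * (\<bar>c\<bar> + 1))" by (simp add: power2_eq_square)
  also have "t * (\<bar>c\<bar> + 1) = - a" using c by (simp add: t_def)
  finally have "t * a + t^2 * c < 0" by simp
  with assms[of t] show False by simp
qed

context eigen_data
begin

lemma Hdiv0_diff: "Hdiv0 \<Omega> f \<Longrightarrow> Hdiv0 \<Omega> h \<Longrightarrow> Hdiv0 \<Omega> (\<lambda>x. f x - h x)"
  by (auto simp: Hdiv0_iff ip_diff_left H10_sq_int sq_int_diff)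

text \<open>Among fields orthogonal to the first \<open>m - 1\<close> eigenfields, \<open>z\<close>
  minimises the curl energy minus \<open>\<mu>\<close> times the squared norm, so the first
  variation vanishes there. Along the removed eigenfields both sides of the equation are zero, hence
  it holds for every admissible \<open>y\<close>.\<close>

lemma curl_minimizer_weak:
  assumes z: "Hdiv0 \<Omega> z" "Hcurl0 \<Omega> z W" and zu: "\<forall>j\<ge>1. j < m \<longrightarrow> ip M z (u j) = 0" and m: "m \<ge> 1"
    and \<mu>: "\<mu> \<le> alpha m" "nsq M W = \<mu> * nsq M z"
    and y: "Hdiv0 \<Omega> y" "Hcurl0 \<Omega> y \<zeta>"
  shows "ip M W \<zeta> = \<mu> * ip M z y"
proof -
  have s: "sq_int M z" "sq_int M W" "sq_int M y" "sq_int M \<zeta>" using z y by (auto simp: Hcurl0_iff)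
  \<comment> \<open>The admissible part of the variation, obtained by projecting out the first
    \<open>m - 1\<close> eigenfields; \<open>\<zeta>'\<close> is its curl.\<close>
  define y' where "y' x = y x - (\<Sum>i\<in>{1..<m}. ip M y (u i) *\<^sub>R u i x)" for x
  define \<zeta>' where "\<zeta>' x = \<zeta> x - (\<Sum>i\<in>{1..<m}. ip M y (u i) *\<^sub>R w i x)" for x
  have Su: "sq_int M (\<lambda>x. \<Sum>i\<in>{1..<m}. ip M y (u i) *\<^sub>R u i x)" by (intro sq_int_sum sq_int_scaleR u_sq_int) auto
  have Sw: "sq_int M (\<lambda>x. \<Sum>i\<in>{1..<m}. ip M y (u i) *\<^sub>R w i x)" by (intro sq_int_sum sq_int_scaleR w_sq_int) auto
  have s': "sq_int M y'" "sq_int M \<zeta>'" unfolding y'_def \<zeta>'_def by (intro sq_int_diff s Su Sw)+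
  have S: "Hdiv0 \<Omega> (\<lambda>x. \<Sum>i\<in>I. ip M y (u i) *\<^sub>R u i x) \<and>
      Hcurl0 \<Omega> (\<lambda>x. \<Sum>i\<in>I. ip M y (u i) *\<^sub>R u i x) (\<lambda>x. \<Sum>i\<in>I. ip M y (u i) *\<^sub>R w i x)"
    if "finite I" "I \<subseteq> {1..}" for I
    using that
  proof (induction I rule: finite_induct)
    case empty
    then show ?case using closed_subspaceD(2)[OF closed_subspace_Hdiv0] by (auto simp: Hcurl0_iff)
  next
    case (insert i I)
    then have i: "i \<ge> 1" by auto
    have IH: "Hdiv0 \<Omega> (\<lambda>x. \<Sum>i\<in>I. ip M y (u i) *\<^sub>R u i x)"
      "Hcurl0 \<Omega> (\<lambda>x. \<Sum>i\<in>I. ip M y (u i) *\<^sub>R u i x) (\<lambda>x. \<Sum>i\<in>I. ip M y (u i) *\<^sub>R w i x)"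
      using insert by auto
    show ?case unfolding sum.insert[OF insert.hyps]
      by (intro conjI closed_subspaceD(3,4)[OF closed_subspace_Hdiv0] u_Hdiv0 i IH Hcurl0_add Hcurl0_scaleR u_Hcurl0)
  qed
  have "finite {1..<m}" "{1..<m} \<subseteq> {1..}" by auto
  from S[OF this] have S': "Hdiv0 \<Omega> (\<lambda>x. \<Sum>i\<in>{1..<m}. ip M y (u i) *\<^sub>R u i x)"
    "Hcurl0 \<Omega> (\<lambda>x. \<Sum>i\<in>{1..<m}. ip M y (u i) *\<^sub>R u i x) (\<lambda>x. \<Sum>i\<in>{1..<m}. ip M y (u i) *\<^sub>R w i x)"
    by blast+
  have y'1: "Hdiv0 \<Omega> y'"
  proof -
    have "y' = (\<lambda>x. y x - (\<Sum>i\<in>{1..<m}. ip M y (u i) *\<^sub>R u i x))" by (rule ext) (rule y'_def)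
    with Hdiv0_diff[OF y(1) S'(1)] show ?thesis by argo
  qed
  have y'2: "Hcurl0 \<Omega> y' \<zeta>'"
    using Hcurl0_diff[OF y(2) S'(2)] by (simp only: y'_def[abs_def] \<zeta>'_def[abs_def])
  have y'u: "ip M y' (u j) = 0" if j: "1 \<le> j" "j < m" for j
  proof -
    have "ip M (\<lambda>x. \<Sum>i\<in>{1..<m}. ip M y (u i) *\<^sub>R u i x) (u j) = (\<Sum>i\<in>{1..<m}. ip M y (u i) * ip M (u i) (u j))"
      by (subst ip_sum_left) (auto intro!: sq_int_scaleR u_sq_int j simp: ip_scaleR_left)
    also have "\<dots> = (\<Sum>i\<in>{1..<m}. if i = j then ip M y (u j) else 0)"
      using u_on[OF _ j(1)] by (intro sum.cong) auto
    also have "\<dots> = ip M y (u j)" using j by simp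
    finally show ?thesis unfolding y'_def ip_diff_left[OF s(3) Su u_sq_int[OF j(1)]] by simp
  qed
  \<comment> \<open>The Rayleigh bound for \<open>z + t y'\<close>; the constant term cancels
    because the quotient of \<open>z\<close> is \<open>\<mu>\<close>.\<close>
  have "0 \<le> t * (2 * (ip M W \<zeta>' - \<mu> * ip M z y')) + t^2 * (nsq M \<zeta>' - \<mu> * nsq M y')" for t
  proof -
    let ?p = "\<lambda>x. z x + t *\<^sub>R y' x" and ?q = "\<lambda>x. W x + t *\<^sub>R \<zeta>' x"
    have "Hdiv0 \<Omega> ?p" by (intro closed_subspaceD(3,4)[OF closed_subspace_Hdiv0] z y'1)
    moreover have "Hcurl0 \<Omega> ?p ?q" by (intro Hcurl0_add Hcurl0_scaleR z y'2)
    moreover have "ip M ?p (u j) = 0" if j: "1 \<le> j" "j < m" for j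
      using zu j y'u[OF j] by (simp add: ip_add_left s s' sq_int_scaleR u_sq_int ip_scaleR_left)
    ultimately have "alpha m * nsq M ?p \<le> nsq M ?q" using m by (intro curl_Rayleigh) auto
    moreover have "\<mu> * nsq M ?p \<le> alpha m * nsq M ?p" by (intro mult_right_mono \<mu>) auto
    ultimately have "\<mu> * nsq M ?p \<le> nsq M ?q" by linarith
    then show ?thesis
      using \<mu>(2) by (simp add: ip_expand_add s s' sq_int_scaleR ip_scaleR_left ip_scaleR_right algebra_simps power2_eq_square)
  qed
  from linear_coeff_zero_of_nonneg[OF this] have "ip M W \<zeta>' = \<mu> * ip M z y'" by simp
  moreover have "ip M W \<zeta>' = ip M W \<zeta>"
  proof -
    have "ip M W (\<lambda>x. \<Sum>i\<in>{1..<m}. ip M y (u i) *\<^sub>R w i x) = (\<Sum>i\<in>{1..<m}. ip M y (u i) * ip M W (w i))"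
      by (subst ip_sum_right) (auto intro!: sq_int_scaleR w_sq_int s simp: ip_scaleR_right)
    also have "\<dots> = 0"
    proof (intro sum.neutral ballI)
      fix i assume i: "i \<in> {1..<m}"
      then have "ip M (w i) W = alpha i * ip M (u i) z" by (intro u_weak z) auto
      then show "ip M y (u i) * ip M W (w i) = 0" using zu i by (simp add: ip_commute)
    qed
    finally show ?thesis unfolding \<zeta>'_def ip_diff_right[OF s(4) Sw s(2)] by simp
  qed
  moreover have "ip M z y' = ip M z y"
  proof -
    have "ip M z (\<lambda>x. \<Sum>i\<in>{1..<m}. ip M y (u i) *\<^sub>R u i x) = (\<Sum>i\<in>{1..<m}. ip M y (u i) * ip M z (u i))"
      by (subst ip_sum_right) (auto intro!: sq_int_scaleR u_sq_int s simp: ip_scaleR_right)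
    also have "\<dots> = 0" using zu by (intro sum.neutral) auto
    finally show ?thesis unfolding y'_def ip_diff_right[OF s(3) Su s(1)] by simp
  qed
  ultimately show ?thesis by simp
qed

text \<open>If the strict inequality fails, some field with components in the \<open>lam k\<close>-eigenspace of the
  Dirichlet Laplacian is a critical point of the Hodge energy on all of \<open>H\<^sub>0(curl) \<inter> H(div)\<close>.\<close>

lemma equality_case:
  assumes k: "k \<ge> 1" and ge: "lam k \<le> alpha (2 * k + 1)"
  shows "\<exists>b P G. (\<exists>j\<in>{1..k}. b j \<noteq> 0) \<and> (\<forall>j\<in>{1..k}. lam j \<noteq> lam k \<longrightarrow> b j = 0) \<and>
    H10 \<Omega> P G \<and> (AE x in M. div_of (comb_grad k b) x = - lam k * P x) \<and>
    (\<forall>Q H. H10 \<Omega> Q H \<longrightarrow> ip M G H = lam k * ip M P Q) \<and>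
    Hdiv0 \<Omega> (\<lambda>x. comb k b x - G x) \<and> Hcurl0 \<Omega> (\<lambda>x. comb k b x - G x) (curl_of (comb_grad k b)) \<and>
    (\<forall>y \<zeta>. Hdiv0 \<Omega> y \<longrightarrow> Hcurl0 \<Omega> y \<zeta> \<longrightarrow>
      ip M (curl_of (comb_grad k b)) \<zeta> = lam k * ip M (\<lambda>x. comb k b x - G x) y)"
proof -
  \<comment> \<open>The first index of the eigenvalue: orthogonality below \<open>l\<close> already
    gives the bound \<open>lam l = lam k\<close> for the gradient part and costs only
    \<open>l - 1 < k\<close> conditions.\<close>
  define l where "l = (LEAST j. 1 \<le> j \<and> lam j = lam k)"
  have l: "1 \<le> l" "lam l = lam k" using LeastI[of "\<lambda>j. 1 \<le> j \<and> lam j = lam k" k] k by (auto simp: l_def)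
  have lk: "l \<le> k" unfolding l_def using k by (intro Least_le) simp
  define I where "I = {1..k} \<times> (UNIV :: 3 set)"
  define J where "J = u ` {1..2*k} \<union> g ` {1..<l}"
  define A where "A U p = (case p of (j, i) \<Rightarrow> ip M (\<phi> j) (\<lambda>x. U x $ i))"
    for U :: "real^3 \<Rightarrow> real^3" and p
  have "card J \<le> 2 * k + (l - 1)"
    unfolding J_def by (intro order_trans[OF card_Un_le] add_mono order_trans[OF card_image_le]) auto
  moreover have "card I = 3 * k" unfolding I_def by (simp add: card_cartesian_product)
  ultimately have "card J < card I" using lk k by simp
  then obtain x where x: "\<exists>p\<in>I. x p \<noteq> 0" "\<forall>U\<in>J. (\<Sum>p\<in>I. A U p * x p) = 0"
    using exists_common_zero[of J I A] by (auto simp: I_def J_def)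
  define b where "b j = (\<chi> i. x (j, i))" for j
  note cs = comb_sq_int[of k b]
  have FU: "ip M (comb k b) U = 0" if "U \<in> J" for U
  proof -
    have U: "sq_int M U" using that g_sq_int u_sq_int by (auto simp: J_def)
    have "ip M (comb k b) U = (\<Sum>p\<in>I. A U p * x p)"
      unfolding I_def A_def by (simp add: ip_comb U b_def sum.cartesian_product case_prod_unfold algebra_simps)
    then show ?thesis using x(2) that by simp
  qed
  let ?F = "comb k b" and ?W = "curl_of (comb_grad k b)" and ?D = "div_of (comb_grad k b)"
  have FD: "\<forall>Q H. H10 \<Omega> Q H \<longrightarrow> ip M ?F H = - ip M ?D Q" using H10_field_div[OF comb_H10] by blast
  have Fu: "\<forall>j\<ge>1. j < 2 * k + 1 \<longrightarrow> ip M ?F (u j) = 0"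
    by (intro allI impI FU) (auto simp: J_def)
  have Fg: "\<forall>j\<ge>1. j < l \<longrightarrow> ip M ?F (g j) = 0"
    by (intro allI impI FU) (auto simp: J_def)
  have lk0: "0 \<le> lam k" "lam k \<le> lam l" using lam_pos[OF k] l by auto
  note low = Hodge_energy_lower_bound[OF H10_field_Hcurl0[OF comb_H10] cs(5) FD le_add2 Fu l(1) Fg lk0]
  from low obtain P G where P: "H10 \<Omega> P G" and z1: "Hdiv0 \<Omega> (\<lambda>x. ?F x - G x)" and z2: "Hcurl0 \<Omega> (\<lambda>x. ?F x - G x) ?W"
    and zu: "\<forall>j\<ge>1. j < 2 * k + 1 \<longrightarrow> ip M (\<lambda>x. ?F x - G x) (u j) = 0"
    and n: "nsq M ?F = nsq M (\<lambda>x. ?F x - G x) + nsq M G"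
    and c: "alpha (2 * k + 1) * nsq M (\<lambda>x. ?F x - G x) \<le> nsq M ?W"
    and d: "lam k * nsq M G + nsq M (\<lambda>x. ?D x + lam k * P x) \<le> nsq M ?D"
    by blast
  note Ps = H10_sq_int[OF P]
  let ?z = "\<lambda>x. ?F x - G x"
  \<comment> \<open>The slack in \<open>comb_energy_le\<close>. It, the slack in the curl bound and
    the squared norm of \<open>D + lam k * P\<close> are nonnegative with sum at most zero, so all
    three vanish.\<close>
  define E where "E = (\<Sum>j\<in>{1..k}. (lam k - lam j) * (norm (b j))^2)"
  have Et: "0 \<le> (lam k - lam j) * (norm (b j))^2" if "j \<in> {1..k}" for j
    using lam_mono[of j k] that by simp
  have E0: "0 \<le> E" unfolding E_def by (intro sum_nonneg Et)
  have "nsq M ?W + nsq M ?D = lam k * nsq M ?F - E"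
    unfolding comb_energy comb_norm E_def by (simp add: sum_distrib_left sum_subtractf left_diff_distrib)
  then have en: "nsq M ?W + nsq M ?D = lam k * nsq M ?z + lam k * nsq M G - E"
    unfolding n by (simp add: distrib_left)
  have az: "lam k * nsq M ?z \<le> alpha (2 * k + 1) * nsq M ?z" by (intro mult_right_mono ge) auto
  have d0: "0 \<le> nsq M (\<lambda>x. ?D x + lam k * P x)" by simp
  have D0: "nsq M (\<lambda>x. ?D x + lam k * P x) = 0" and E00: "E = 0"
    and W: "nsq M ?W = lam k * nsq M ?z"
    using en az d0 d c E0 by linarith+
  have bz: "b j = 0" if "j \<in> {1..k}" "lam j \<noteq> lam k" for j
  proof -
    have "(lam k - lam j) * (norm (b j))^2 = 0"
      using E00 that(1) sum_nonneg_eq_0_iff[of "{1..k}" "\<lambda>j. (lam k - lam j) * (norm (b j))^2"] Et by (simp add: E_def)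
    then show ?thesis using that by simp
  qed
  have "AE x in M. ?D x + lam k * P x = 0" by (intro ip_self_eq_0 D0 sq_int_add sq_int_mult cs Ps)
  \<comment> \<open>As \<open>P\<close> lies in \<open>H10\<close>, this is the natural boundary
    condition on the divergence in weak form.\<close>
  then have DP: "AE x in M. ?D x = - lam k * P x" by eventually_elim linarith
  have weakP: "ip M G H = lam k * ip M P Q" if Q: "H10 \<Omega> Q H" for Q H
  proof -
    note Qs = H10_sq_int[OF Q]
    have "0 = ip M ?z H" using z1 Q by (auto simp: Hdiv0_iff)
    also have "\<dots> = - ip M ?D Q - ip M G H" using FD Q by (simp add: ip_diff_left cs Ps Qs)
    also have "ip M ?D Q = ip M (\<lambda>x. - lam k * P x) Q" using DP by (intro ip_cong_AE cs Ps Qs sq_int_mult) auto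
    finally show ?thesis unfolding ip_mult_left by linarith
  qed
  have weakz: "ip M ?W \<zeta> = lam k * ip M ?z y" if "Hdiv0 \<Omega> y" "Hcurl0 \<Omega> y \<zeta>" for y \<zeta>
    by (rule curl_minimizer_weak[OF z1 z2 zu le_add2 ge W that])
  have "\<exists>j\<in>{1..k}. b j \<noteq> 0" using x(1) by (auto simp: I_def b_def vec_eq_iff)
  with bz P DP weakP z1 z2 weakz show ?thesis by blast
qed

text \<open>Pairing with \<open>\<psi>\<close> gives \<open>c = 0\<close>, since each derivative of
  \<open>\<psi>\<close> is orthogonal to \<open>\<psi>\<close>. Pairing with
  \<open>(x \<bullet> \<beta>) * \<psi> x\<close> then gives
  \<open>- (\<beta> \<bullet> \<beta>) / 2 = 0\<close>.\<close>

lemma H10_scaled_direction_zero: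
  assumes P: "H10 \<Omega> \<psi> H" and 1: "nsq M \<psi> = 1" and \<beta>: "AE x in M. \<beta> \<bullet> H x = c * \<psi> x"
  shows "\<beta> = 0"
proof -
  note s = H10_sq_int[OF P]
  have Hi: "sq_int M (\<lambda>x. H x $ i)" for i by (rule sq_int_component[OF s(2)])
  have bHs: "sq_int M (\<lambda>x. \<beta> \<bullet> H x)"
    unfolding inner_vec_def by (auto intro!: sq_int_sum sq_int_mult Hi)
  have bH: "ip M (\<lambda>x. \<beta> \<bullet> H x) f = (\<Sum>i\<in>UNIV. \<beta> $ i * ip M (\<lambda>x. H x $ i) f)" if "sq_int M f" for f
    unfolding inner_vec_def by (subst ip_sum_left) (auto intro!: sq_int_mult Hi that simp: ip_mult_left)
  have "ip M (\<lambda>x. H x $ i) \<psi> = 0" for i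
    using H10_product_rule[OF P P smooth_const[of 1], of i] by (simp add: ip_commute)
  then have "0 = ip M (\<lambda>x. \<beta> \<bullet> H x) \<psi>" by (simp add: bH s)
  also have "\<dots> = ip M (\<lambda>x. c * \<psi> x) \<psi>" using \<beta> by (intro ip_cong_AE bHs sq_int_mult s) auto
  finally have "c = 0" using 1 by (simp add: ip_mult_left)
  let ?s = "\<lambda>x. x \<bullet> \<beta>"
  have sm: "sq_int M (\<lambda>x. ?s x * f x)" if "sq_int M f" for f by (rule sq_int_smooth_mult[OF smooth_inner that])
  have pr: "2 * ip M (\<lambda>x. H x $ i) (\<lambda>x. ?s x * \<psi> x) = - (\<beta> $ i)" for i
  proof -
    have "ip M (\<lambda>x. ?s x * H x $ i) \<psi> = ip M (\<lambda>x. H x $ i) (\<lambda>x. ?s x * \<psi> x)"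
      "ip M (\<lambda>x. ?s x * \<psi> x) (\<lambda>x. H x $ i) = ip M (\<lambda>x. H x $ i) (\<lambda>x. ?s x * \<psi> x)"
      unfolding ip_def by (simp_all add: ac_simps)
    then show ?thesis
      using H10_product_rule[OF P P smooth_inner[of \<beta>], of i] 1 by (simp add: pd_inner ip_mult_left)
  qed
  have "0 = ip M (\<lambda>x. 0 :: real) (\<lambda>x. ?s x * \<psi> x)" by simp
  also have "\<dots> = ip M (\<lambda>x. \<beta> \<bullet> H x) (\<lambda>x. ?s x * \<psi> x)"
    using \<beta> \<open>c = 0\<close> by (intro ip_cong_AE sq_int_zero bHs sm s) auto
  also have "\<dots> = (\<Sum>i\<in>UNIV. \<beta> $ i * (- (\<beta> $ i) / 2))"
    unfolding bH[OF sm[OF s(1)]] using pr by (intro sum.cong refl arg_cong2[where f = "(*)"]) (simp add: field_simps)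
  also have "\<dots> = - (\<beta> \<bullet> \<beta>) / 2" by (simp add: inner_vec_def sum_negf sum_divide_distrib)
  finally show ?thesis by simp
qed

theorem alpha_less_lam_simple:
  assumes k: "k \<ge> 1" and simple: "card {j. 1 \<le> j \<and> lam j = lam k} = 1"
  shows "alpha (2 * k + 1) < lam k"
proof (rule ccontr)
  assume "\<not> ?thesis"
  then have ge: "lam k \<le> alpha (2 * k + 1)" by simp
  obtain i where i: "{j. 1 \<le> j \<and> lam j = lam k} = {i}" using card_1_singletonE[OF simple] .
  have "k \<in> {i}" unfolding i[symmetric] using k by blast
  moreover have "j \<in> {i}" if "1 \<le> j" "lam j = lam k" for j unfolding i[symmetric] using that by blast
  ultimately have uniq: "j = k" if "1 \<le> j" "lam j = lam k" for j using that by blast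
  from equality_case[OF k ge] obtain b P G where b: "\<exists>j\<in>{1..k}. b j \<noteq> 0" "\<forall>j\<in>{1..k}. lam j \<noteq> lam k \<longrightarrow> b j = 0"
    and P: "H10 \<Omega> P G" and DP: "AE x in M. div_of (comb_grad k b) x = - lam k * P x"
    and wP: "\<forall>Q H. H10 \<Omega> Q H \<longrightarrow> ip M G H = lam k * ip M P Q" by blast
  note Ps = H10_sq_int[OF P]
  have b0: "b j = 0" if "j \<in> {1..k}" "j \<noteq> k" for j using b(2) uniq that by (meson atLeastAtMost_iff)
  then have bk: "b k \<noteq> 0" using b(1) by metis
  have "comb_grad k b x $ i = b k $ i *\<^sub>R g k x" for x i
  proof -
    have "(\<Sum>j\<in>{1..k}. b j $ i *\<^sub>R g j x) = (\<Sum>j\<in>{1..k}. if j = k then b k $ i *\<^sub>R g k x else 0)"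
      by (intro sum.cong) (auto simp: b0)
    then show ?thesis using k by (simp add: comb_grad_def)
  qed
  then have D: "div_of (comb_grad k b) x = b k \<bullet> g k x" for x
    by (simp add: div_of_def inner_vec_def sum_3)
  \<comment> \<open>\<open>P\<close> solves the eigenvalue equation for \<open>lam k\<close>, so
    simplicity and completeness reduce it to \<open>c * \<phi> k\<close>.\<close>
  define c where "c = ip M P (\<phi> k)"
  have "ip M P (\<phi> j) = 0" if j: "1 \<le> j" "j \<noteq> k" for j
  proof -
    have "lam k * ip M P (\<phi> j) = lam j * ip M P (\<phi> j)"
      using wP phi_H10[OF j(1)] phi_weak[OF j(1) P] by (metis ip_commute)
    then show ?thesis using uniq[OF j(1)] j(2) by auto
  qed
  then have "AE x in M. P x - c * \<phi> k x = 0"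
    using k phi_on[OF k] by (intro phi_complete sq_int_diff sq_int_mult Ps phi_sq_int)
      (auto simp: ip_diff_left Ps sq_int_mult phi_sq_int ip_mult_left c_def)
  then have "AE x in M. b k \<bullet> g k x = (- lam k * c) * \<phi> k x"
    using DP by eventually_elim (simp add: D)
  then have "b k = 0"
    using H10_scaled_direction_zero[OF phi_H10[OF k] _, of "b k" "- lam k * c"] phi_on[OF k k] by simp
  with bk show False by simp
qed

end

section \<open>Helmholtz equation: gradient estimate and continuation\<close>

definition laplacian :: "(real^3 \<Rightarrow> real) \<Rightarrow> real^3 \<Rightarrow> real" where
  "laplacian f x = (\<Sum>i\<in>UNIV. pd i (pd i f) x)"

lemma smooth_laplacian: "smooth f \<Longrightarrow> smooth (laplacian f)"
  unfolding laplacian_def[abs_def] by (intro smooth_sum smooth_pd)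

lemma laplacian_add:
  assumes "smooth f" "smooth g"
  shows "laplacian (\<lambda>x. f x + g x) x = laplacian f x + laplacian g x"
  unfolding laplacian_def pd_smooth_add[OF assms]
  by (simp add: pd_smooth_add smooth_pd assms sum.distrib)

lemma laplacian_cmult:
  assumes "smooth f"
  shows "laplacian (\<lambda>x. c * f x) x = c * laplacian f x"
  unfolding laplacian_def pd_cmult[OF assms]
  by (simp add: pd_cmult smooth_pd assms sum_distrib_left)

lemma laplacian_mult:
  assumes "smooth f" "smooth g"
  shows "laplacian (\<lambda>x. f x * g x) x = f x * laplacian g x + 2 * (grad f x \<bullet> grad g x) + laplacian f x * g x"
proof -
  have "pd i (pd i (\<lambda>x. f x * g x)) x = f x * pd i (pd i g) x + 2 * (pd i f x * pd i g x) + pd i (pd i f) x * g x" for i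
    unfolding pd_smooth_mult[OF assms]
    by (simp add: pd_smooth_add pd_smooth_mult smooth_mult smooth_pd assms algebra_simps)
  then show ?thesis
    by (simp add: laplacian_def grad_def inner_vec_def sum.distrib sum_distrib_left sum_distrib_right)
qed

lemma grad_mult:
  assumes "smooth f" "smooth g"
  shows "grad (\<lambda>x. f x * g x) x = f x *\<^sub>R grad g x + g x *\<^sub>R grad f x"
  by (simp add: vec_eq_iff grad_def pd_smooth_mult assms)

lemma pd_square_distance: "pd i (\<lambda>x. (x - a) \<bullet> (x - a)) x = 2 * (x - a) $ i"
proof -
  have "((\<lambda>x. (x - a) \<bullet> (x - a)) has_derivative (\<lambda>h. 2 * (h \<bullet> (x - a)))) (at x)"
    by (auto intro!: derivative_eq_intros simp: inner_commute)
  from pd_eqI[OF this, of i] show ?thesis by (simp add: inner_axis')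
qed

lemma grad_square_distance: "grad (\<lambda>x. (x - a) \<bullet> (x - a)) x = 2 *\<^sub>R (x - a)"
  by (simp add: vec_eq_iff grad_def pd_square_distance)

lemma laplacian_square_distance: "laplacian (\<lambda>x. (x - a) \<bullet> (x - a)) x = 6"
proof -
  have "pd i (pd i (\<lambda>x. (x - a) \<bullet> (x - a))) x = 2" for i
  proof -
    have "pd i (\<lambda>x. (x - a) \<bullet> (x - a)) = (\<lambda>x. 2 * (x $ i - a $ i))"
      by (simp add: fun_eq_iff pd_square_distance)
    moreover have "pd i (\<lambda>x. 2 * (x $ i - a $ i)) x = 2"
      by (simp add: pd_cmult pd_diff smooth_intros pd_component)
    ultimately show ?thesis by simp
  qed
  then show ?thesis by (simp add: laplacian_def)
qed

section \<open>Maximum principle and interior gradient bound\<close>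

lemma interior_max_second_derivative:
  assumes f: "smooth f" and y: "y \<in> ball a d" and max: "\<And>x. x \<in> ball a d \<Longrightarrow> f x \<le> f y"
  shows "pd i (pd i f) y \<le> 0"
proof (rule ccontr)
  assume "\<not> ?thesis"
  then have pos: "pd i (pd i f) y > 0" by simp
  let ?l = "\<lambda>t. y + t *\<^sub>R axis i 1"
  define e where "e = d - dist a y"
  have e: "e > 0" using y by (simp add: e_def)
  have inb: "?l t \<in> ball a d" if "\<bar>t\<bar> < e" for t
  proof -
    have "dist a (?l t) \<le> dist a y + dist y (?l t)" by (rule dist_triangle)
    also have "dist y (?l t) = \<bar>t\<bar>" by (simp add: dist_norm)
    finally show ?thesis using that by (simp add: e_def)
  qed
  have "pd i f (?l 0) = 0"
  proof (rule DERIV_local_max[OF line_has_derivative[OF f] e], intro allI impI)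
    fix t assume "\<bar>0 - t\<bar> < e"
    then show "f (?l t) \<le> f (?l 0)" using max[OF inb[of t]] by simp
  qed
  moreover obtain r where r: "r > 0" "\<And>h. 0 < h \<Longrightarrow> h < r \<Longrightarrow> pd i f (?l 0) < pd i f (?l (0 + h))"
    using DERIV_pos_inc_right[OF line_has_derivative[OF smooth_pd[OF f, of i], of y i 0]] pos by auto
  ultimately have pp: "pd i f (?l h) > 0" if "0 < h" "h < r" for h using that by fastforce
  define h where "h = min e r / 2"
  have h: "0 < h" "h < e" "h < r" using e r by (auto simp: h_def)
  from MVT2[OF h(1) line_has_derivative[OF f, of y i]]
  obtain t where t: "0 < t" "t < h" "f (?l h) - f (?l 0) = (h - 0) * pd i f (?l t)" by blast
  have "(h - 0) * pd i f (?l t) > 0" using pp[of t] t h by simp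
  then have "f (?l h) > f y" using t(3) by simp
  with max[OF inb[of h]] h show False by simp
qed

lemma strict_maximum_principle:
  assumes f: "smooth f" and pos: "\<And>x. x \<in> ball a d \<Longrightarrow> laplacian f x > 0" and x: "x \<in> cball a d"
  shows "\<exists>y\<in>sphere a d. f x \<le> f y"
proof -
  have ne: "cball a d \<noteq> {}" using x by blast
  obtain y where y: "y \<in> cball a d" "\<forall>z\<in>cball a d. f z \<le> f y"
    using continuous_attains_sup[OF compact_cball ne smooth_continuous[OF f]] by blast
  have "y \<notin> ball a d"
  proof
    assume yb: "y \<in> ball a d"
    have "pd i (pd i f) y \<le> 0" for i
      by (rule interior_max_second_derivative[OF f yb]) (use y(2) ball_subset_cball in blast)
    then have "laplacian f y \<le> 0" unfolding laplacian_def by (intro sum_nonpos) auto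
    with pos[OF yb] show False by simp
  qed
  then have "y \<in> sphere a d" using y(1) by auto
  with y(2) x show ?thesis by blast
qed

lemma laplacian_pd:
  assumes f: "smooth f" and eq: "\<And>x. x \<in> ball a d \<Longrightarrow> laplacian f x = - \<mu> * f x" and x: "x \<in> ball a d"
  shows "laplacian (pd i f) x = - \<mu> * pd i f x"
proof -
  have "laplacian (pd i f) x = (\<Sum>j\<in>UNIV. pd i (pd j (pd j f)) x)"
    unfolding laplacian_def using pd_commute[OF smooth_pd[OF f]] pd_commute[OF f] by metis
  also have "\<dots> = pd i (laplacian f) x"
  proof -
    have "pd i (\<lambda>x. \<Sum>j\<in>I. h j x) x = (\<Sum>j\<in>I. pd i (h j) x)" if "\<And>j. smooth (h j)" "finite I" for h :: "3 \<Rightarrow> real^3 \<Rightarrow> real" and I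
      using that(2) by (induction I rule: finite_induct) (auto simp: pd_smooth_add smooth_sum that)
    then show ?thesis unfolding laplacian_def[abs_def] by (simp add: smooth_pd f)
  qed
  also have "\<dots> = pd i (\<lambda>x. - \<mu> * f x) x"
    by (rule pd_cong_open[OF open_ball x eq smooth_differentiable[OF smooth_cmult[OF f]]])
  also have "\<dots> = - \<mu> * pd i f x" by (simp only: pd_cmult[OF f])
  finally show ?thesis .
qed

text \<open>Bernstein's method: the maximum principle is applied to
  \<open>\<eta>\<^sup>2 |\<partial>\<^sub>i f|\<^sup>2 + A f\<^sup>2 + B |x - a|\<^sup>2\<close> with the cutoff \<open>\<eta> = d\<^sup>2 - |x - a|\<^sup>2\<close>.\<close>

lemma gradient_estimate:
  assumes f: "smooth f" and eq: "\<And>x. x \<in> ball a d \<Longrightarrow> laplacian f x = - \<mu> * f x" and \<mu>: "\<mu> \<ge> 0"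
    and d: "0 < d" "d \<le> 1" and m: "\<And>x. x \<in> cball a d \<Longrightarrow> \<bar>f x\<bar> \<le> m"
  shows "\<bar>pd i f a\<bar> \<le> (23 + \<mu>) / d * m"
proof -
  have m0: "0 \<le> m" using m[of a] d by auto
  \<comment> \<open>A strict majorant is positive even if \<open>m = 0\<close>, which makes the
    Laplacian of \<open>F\<close> strictly positive; the limit \<open>m' = m\<close> is taken at the
    end.\<close>
  have *: "\<bar>pd i f a\<bar> \<le> (23 + \<mu>) / d * m'" if m': "m' > m" for m'
  proof -
    have mp: "m' > 0" and mf: "\<And>x. x \<in> cball a d \<Longrightarrow> (f x)^2 \<le> m'^2"
      using m m0 m' power_mono[OF _ abs_ge_zero, of _ m' 2] by fastforce+
    define q where "q x = (x - a) \<bullet> (x - a)" for x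
    define h where "h x = d^2 + (-1) * q x" for x
    define p where "p = pd i f"
    \<comment> \<open>\<open>2 * A = (46 + 2 * \<mu>) * d^2\<close> absorbs the losses
      \<open>12\<close>, \<open>32\<close> and \<open>2 * \<mu>\<close>, each times
      \<open>d^2 * (p x)^2\<close>, with 2 to spare. In turn \<open>6 * B\<close> absorbs the loss
      \<open>2 * A * \<mu> * m'^2\<close> from \<open>f^2\<close> and leaves
      \<open>2 * A * m'^2 > 0\<close>.\<close>
    define A where "A = (23 + \<mu>) * d^2"
    define B where "B = A * (\<mu> + 1) * m'^2 / 3"
    define F where "F x = h x * h x * (p x * p x) + (A * (f x * f x) + B * q x)" for x
    have sq: "smooth q" unfolding q_def by (rule smooth_inner_self)
    have sh: "smooth h" unfolding h_def[abs_def] by (intro smooth_add smooth_const smooth_cmult sq)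
    have sp: "smooth p" unfolding p_def by (rule smooth_pd[OF f])
    have sF: "smooth F" unfolding F_def[abs_def] by (intro smooth_add smooth_mult smooth_const sh sp f sq)
    have A0: "A > 0" using d \<mu> by (simp add: A_def)
    have gq: "grad q x = 2 *\<^sub>R (x - a)" and lq: "laplacian q x = 6" for x
      unfolding q_def by (rule grad_square_distance, rule laplacian_square_distance)
    have gh: "grad h x = - 2 *\<^sub>R (x - a)" and lh: "laplacian h x = - 6" for x
    proof -
      show "laplacian h x = - 6"
        unfolding h_def[abs_def] laplacian_add[OF smooth_const smooth_cmult[OF sq]] laplacian_cmult[OF sq] lq
        by (simp add: laplacian_def)
      have "pd j h x = - 2 * (x - a) $ j" for j
        unfolding h_def[abs_def] pd_smooth_add[OF smooth_const smooth_cmult[OF sq]] pd_cmult[OF sq]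
        using gq[of x] by (simp add: grad_def vec_eq_iff)
      then show "grad h x = - 2 *\<^sub>R (x - a)" by (simp add: grad_def vec_eq_iff)
    qed
    have pos: "laplacian F x > 0" if x: "x \<in> ball a d" for x
    proof -
      define r where "r = q x"
      have r0: "0 \<le> r" by (simp add: r_def q_def)
      have rd: "r \<le> d^2"
      proof -
        have "norm (x - a) \<le> d" using x by (simp add: dist_norm norm_minus_commute)
        then have "(norm (x - a))^2 \<le> d^2" by (intro power_mono) auto
        then show ?thesis by (simp add: r_def q_def power2_norm_eq_inner)
      qed
      have ghh: "grad h x \<bullet> grad h x = 4 * r" by (simp add: gh r_def q_def)
      have hx: "h x = d^2 - r" by (simp add: h_def r_def)
      have h0: "0 \<le> h x" "h x \<le> d^2" using rd r0 by (auto simp: hx)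
      have lp: "laplacian p x = - \<mu> * p x" unfolding p_def by (rule laplacian_pd[OF f eq x])
      have lf: "laplacian f x = - \<mu> * f x" by (rule eq[OF x])
      have l1: "laplacian (\<lambda>x. h x * h x) x = 2 * h x * (- 6) + 8 * r"
        using laplacian_mult[OF sh sh, of x] by (simp add: lh ghh)
      have l2: "laplacian (\<lambda>x. p x * p x) x = - 2 * \<mu> * (p x)^2 + 2 * (grad p x \<bullet> grad p x)"
        using laplacian_mult[OF sp sp, of x] by (simp add: lp power2_eq_square)
      have l3: "laplacian (\<lambda>x. f x * f x) x = - 2 * \<mu> * (f x)^2 + 2 * (grad f x \<bullet> grad f x)"
        using laplacian_mult[OF f f, of x] by (simp add: lf power2_eq_square)
      have LF: "laplacian F x = (h x)^2 * (- 2 * \<mu> * (p x)^2 + 2 * (grad p x \<bullet> grad p x)) +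
          8 * (h x * p x * (grad h x \<bullet> grad p x)) + (2 * h x * (- 6) + 8 * r) * (p x)^2 +
          A * (- 2 * \<mu> * (f x)^2 + 2 * (grad f x \<bullet> grad f x)) + 6 * B"
      proof -
        have "grad (\<lambda>x. h x * h x) x \<bullet> grad (\<lambda>x. p x * p x) x = 4 * (h x * p x * (grad h x \<bullet> grad p x))"
          unfolding grad_mult[OF sh sh] grad_mult[OF sp sp]
          by (simp only: inner_add_left inner_add_right inner_scaleR_left inner_scaleR_right) (simp add: algebra_simps)
        then have "laplacian (\<lambda>x. h x * h x * (p x * p x)) x =
          (h x)^2 * (- 2 * \<mu> * (p x)^2 + 2 * (grad p x \<bullet> grad p x)) +
          8 * (h x * p x * (grad h x \<bullet> grad p x)) + (2 * h x * (- 6) + 8 * r) * (p x)^2"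
          using laplacian_mult[OF smooth_mult[OF sh sh] smooth_mult[OF sp sp], of x]
          by (simp add: l1 l2 power2_eq_square)
        then show ?thesis
          unfolding F_def[abs_def]
          by (simp add: laplacian_add laplacian_cmult smooth_mult smooth_add smooth_cmult sh sp f sq l3 lq)
      qed
      \<comment> \<open>Completing the square removes the mixed term and the second derivatives at
        the cost of \<open>32 * r * (p x)^2\<close>.\<close>
      have sqn: "0 \<le> 2 * ((h x)^2 * (grad p x \<bullet> grad p x)) + 8 * (h x * p x * (grad h x \<bullet> grad p x)) + 8 * (p x)^2 * (4 * r)"
      proof -
        have "0 \<le> 2 * ((h x *\<^sub>R grad p x + (2 * p x) *\<^sub>R grad h x) \<bullet> (h x *\<^sub>R grad p x + (2 * p x) *\<^sub>R grad h x))"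
          by simp
        also have "\<dots> = 2 * ((h x)^2 * (grad p x \<bullet> grad p x)) + 8 * (h x * p x * (grad h x \<bullet> grad p x)) + 8 * (p x)^2 * (grad h x \<bullet> grad h x)"
          by (simp add: inner_add_left inner_add_right inner_commute power2_eq_square algebra_simps)
        finally show ?thesis by (simp only: ghh)
      qed
      have pg: "(p x)^2 \<le> grad f x \<bullet> grad f x"
      proof -
        have "(p x)^2 = (\<bar>grad f x $ i\<bar>)^2" by (simp add: p_def grad_def)
        also have "\<dots> \<le> (norm (grad f x))^2" by (intro power_mono component_le_norm_cart) auto
        finally show ?thesis by (simp add: power2_norm_eq_inner)
      qed
      have h2: "(h x)^2 \<le> d^2"
      proof -
        have "(h x)^2 \<le> (d^2)^2" using h0 by (intro power_mono) auto
        also have "\<dots> = d^2 * d^2" by (simp add: power2_eq_square)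
        also have "\<dots> \<le> d^2 * 1" using d by (intro mult_left_mono power_le_one) auto
        finally show ?thesis by simp
      qed
      have "2 * \<mu> * (h x)^2 * (p x)^2 \<le> 2 * \<mu> * d^2 * (p x)^2"
        using h2 \<mu> by (intro mult_right_mono mult_left_mono) auto
      moreover have "12 * h x * (p x)^2 \<le> 12 * d^2 * (p x)^2"
        using h0 by (intro mult_right_mono) auto
      moreover have "32 * r * (p x)^2 \<le> 32 * d^2 * (p x)^2" using rd by (intro mult_right_mono) auto
      moreover have "0 \<le> 8 * r * (p x)^2" using r0 by simp
      moreover have "2 * A * (p x)^2 \<le> 2 * A * (grad f x \<bullet> grad f x)" using pg A0 by (intro mult_left_mono) auto
      moreover have "2 * A * \<mu> * (f x)^2 \<le> 2 * A * \<mu> * m'^2"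
        using mf[of x] x A0 \<mu> by (intro mult_left_mono) auto
      moreover have "6 * B = 2 * A * \<mu> * m'^2 + 2 * A * m'^2" by (simp add: B_def algebra_simps)
      moreover have "2 * A * m'^2 > 0" using A0 mp by simp
      moreover have "0 \<le> 2 * d^2 * (p x)^2" by simp
      moreover have "2 * A * (p x)^2 = 46 * d^2 * (p x)^2 + 2 * \<mu> * d^2 * (p x)^2" by (simp add: A_def algebra_simps)
      moreover have "laplacian F x = (2 * ((h x)^2 * (grad p x \<bullet> grad p x)) + 8 * (h x * p x * (grad h x \<bullet> grad p x)) + 8 * (p x)^2 * (4 * r))
          - 32 * r * (p x)^2 - 2 * \<mu> * (h x)^2 * (p x)^2 - 12 * h x * (p x)^2 + 8 * r * (p x)^2
          - 2 * A * \<mu> * (f x)^2 + 2 * A * (grad f x \<bullet> grad f x) + 6 * B"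
        unfolding LF by (simp add: algebra_simps)
      ultimately show ?thesis using sqn by linarith
    qed
    have "\<exists>y\<in>sphere a d. F a \<le> F y"
    proof (rule strict_maximum_principle[OF sF])
      show "a \<in> cball a d" using d by simp
    qed (rule pos)
    then obtain y where y: "y \<in> sphere a d" "F a \<le> F y" by blast
    have qy: "q y = d^2" using y(1) by (simp add: q_def dist_norm norm_minus_commute flip: power2_norm_eq_inner)
    \<comment> \<open>At the centre the cutoff is \<open>d^2\<close>; on the sphere it is zero, so
      the derivative drops out of \<open>F y\<close>.\<close>
    have "d^2 * d^2 * (p a)^2 \<le> F a"
      using A0 by (simp add: F_def h_def q_def power2_eq_square)
    also have "\<dots> \<le> F y" by (rule y)
    also have "\<dots> = A * (f y)^2 + B * d^2" by (simp add: F_def h_def qy power2_eq_square)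
    also have "\<dots> \<le> A * m'^2 + B * 1"
    proof (intro add_mono mult_left_mono mf)
      show "y \<in> cball a d" using y by simp
      show "d^2 \<le> 1" using d by (intro power_le_one) auto
      show "0 \<le> B" "0 \<le> A" using A0 \<mu> by (auto simp: B_def)
    qed
    also have "\<dots> \<le> A * ((23 + \<mu>) * m'^2)"
    proof -
      have "A * m'^2 + B * 1 = A * ((1 + (\<mu> + 1) / 3) * m'^2)" by (simp add: B_def algebra_simps)
      also have "\<dots> \<le> A * ((23 + \<mu>) * m'^2)"
        using \<mu> A0 by (intro mult_left_mono mult_right_mono) (auto simp: field_simps)
      finally show ?thesis .
    qed
    also have "\<dots> = d^2 * ((23 + \<mu>) * m')^2" by (simp add: A_def power2_eq_square)
    finally have "d^2 * (d^2 * (p a)^2) \<le> d^2 * ((23 + \<mu>) * m')^2" by (simp only: mult.assoc)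
    moreover have "d^2 > 0" using d by simp
    ultimately have "d^2 * (p a)^2 \<le> ((23 + \<mu>) * m')^2" by (rule mult_left_le_imp_le)
    moreover have "(d * \<bar>p a\<bar>)^2 = d^2 * (p a)^2" by (simp add: power_mult_distrib)
    ultimately have "(d * \<bar>p a\<bar>)^2 \<le> ((23 + \<mu>) * m')^2" by argo
    moreover have "0 \<le> (23 + \<mu>) * m'" using \<mu> mp by simp
    ultimately have "d * \<bar>p a\<bar> \<le> (23 + \<mu>) * m'" by (rule power2_le_imp_le)
    then have "\<bar>p a\<bar> \<le> (23 + \<mu>) * m' / d" using d(1) by (simp only: pos_le_divide_eq mult.commute)
    then show ?thesis by (simp add: p_def)
  qed
  show ?thesis
  proof (rule field_le_epsilon)
    fix e :: real assume e: "e > 0"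
    define e' where "e' = e * d / (23 + \<mu>)"
    have "e' > 0" using e d \<mu> by (simp add: e'_def)
    then have "\<bar>pd i f a\<bar> \<le> (23 + \<mu>) / d * (m + e')" by (intro *) simp
    also have "\<dots> = (23 + \<mu>) / d * m + e" using d \<mu> unfolding distrib_left by (simp add: e'_def)
    finally show "\<bar>pd i f a\<bar> \<le> (23 + \<mu>) / d * m + e" .
  qed
qed

text \<open>The quotient \<open>n^n / n!\<close> is one term of the exponential series. It turns the
  growth \<open>n^n\<close> of the iterated derivative bound into a geometric factor.\<close>

lemma power_self_le_fact_exp: "real n ^ n \<le> fact n * exp (real n)"
proof -
  have "real n ^ n /\<^sub>R fact n \<le> exp (real n)"
    unfolding exp_def using sum_le_suminf[OF summable_exp_generic[of "real n"], of "{n}"] by simp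
  then show ?thesis by (simp add: field_simps)
qed

text \<open>The iterated gradient estimate with step \<open>\<delta>/n\<close> bounds the \<open>n\<close>-th derivative by
  \<open>(C n / \<delta>)\<^sup>n\<close>, so the Taylor expansion at a point near which \<open>f\<close> vanishes shows \<open>f = 0\<close> further out.\<close>

lemma Helmholtz_continuation_line:
  assumes f: "smooth f" and \<mu>: "\<mu> \<ge> 0" and R: "0 < R" "R \<le> 1"
    and eq: "\<And>x. x \<in> ball 0 R \<Longrightarrow> laplacian f x = - \<mu> * f x"
    and \<rho>: "\<rho> > 0" "\<And>x. x \<in> ball 0 \<rho> \<Longrightarrow> f x = 0"
    and t: "\<bar>t\<bar> < R / (4 * exp 1 * (23 + \<mu>))"
  shows "f (t *\<^sub>R axis i 1) = 0"
proof -
  define C where "C = 23 + \<mu>"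
  have C: "C \<ge> 23" using \<mu> by (simp add: C_def)
  \<comment> \<open>Starting from radius \<open>R/2\<close>, \<open>n\<close> steps of length
    \<open>\<delta> / n\<close> end at radius \<open>R/4 = \<delta>\<close>.\<close>
  define \<delta> where "\<delta> = R / 4"
  define V where "V k = (pd i ^^ k) f" for k
  have VS: "V (Suc k) = pd i (V k)" for k by (simp add: V_def)
  have sV: "smooth (V k)" for k by (induction k) (auto simp: VS smooth_pd V_def f)
  have eV: "laplacian (V k) x = - \<mu> * V k x" if "x \<in> ball 0 R" for k x
    using that
  proof (induction k arbitrary: x)
    case 0
    then show ?case using eq by (simp add: V_def)
  next
    case (Suc k)
    show ?case unfolding VS by (rule laplacian_pd[OF sV Suc.IH Suc.prems])
  qed
  have V0: "V k x = 0" if "x \<in> ball 0 \<rho>" for k x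
    using that
  proof (induction k arbitrary: x)
    case 0
    then show ?case using \<rho> by (simp add: V_def)
  next
    case (Suc k)
    show ?case unfolding VS using pd_cong_open[OF open_ball Suc.prems, of "V k" "\<lambda>_. 0" i] Suc.IH by simp
  qed
  have "compact (f ` cball 0 (R/2))" by (intro compact_continuous_image smooth_continuous f) auto
  then obtain m where m: "\<And>x. x \<in> cball 0 (R/2) \<Longrightarrow> \<bar>f x\<bar> \<le> m"
    using compact_imp_bounded bounded_iff by (metis image_eqI real_norm_def)
  have m0: "0 \<le> m" using m[of 0] R by auto
  have Vn: "\<bar>V n x\<bar> \<le> (C * real n / \<delta>) ^ n * m" if n: "n \<ge> 1" and x: "x \<in> cball 0 \<delta>" for n x
  proof -
    \<comment> \<open>With \<open>n\<close> fixed, each derivative costs a radius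
      \<open>\<delta> / n\<close> and a factor \<open>C * n / \<delta>\<close>.\<close>
    have "\<bar>V k x\<bar> \<le> (C * real n / \<delta>) ^ k * m" if "k \<le> n" "x \<in> cball 0 (R/2 - real k * (\<delta> / real n))" for k x
      using that
    proof (induction k arbitrary: x)
      case 0
      then show ?case using m by (simp add: V_def)
    next
      case (Suc k)
      define s where "s = \<delta> / real n"
      have s: "0 < s" "s \<le> 1" "s \<le> \<delta>" using n R by (auto simp: s_def \<delta>_def field_simps)
      have nx: "norm x \<le> R/2 - real (Suc k) * s" using Suc.prems by (simp add: s_def)
      have sub: "y \<in> cball 0 (R/2 - real k * s)" if "y \<in> cball x s" for y
      proof -
        have "norm y \<le> norm x + dist x y" using norm_triangle_ineq[of x "y - x"] by (simp add: dist_norm norm_minus_commute)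
        then show ?thesis using that nx by (simp add: algebra_simps)
      qed
      have ks: "0 \<le> real k * s" using s by simp
      have "\<bar>V (Suc k) x\<bar> \<le> (23 + \<mu>) / s * ((C * real n / \<delta>) ^ k * m)"
        unfolding VS
      proof (rule gradient_estimate[OF sV _ \<mu> s(1,2)])
        show "laplacian (V k) y = - \<mu> * V k y" if "y \<in> ball x s" for y
        proof (rule eV)
          have "y \<in> cball 0 (R/2 - real k * s)" using that by (intro sub) auto
          then show "y \<in> ball 0 R" using ks R by simp
        qed
        show "\<bar>V k y\<bar> \<le> (C * real n / \<delta>) ^ k * m" if "y \<in> cball x s" for y
          using Suc.IH[of y] Suc.prems sub[OF that] by (simp add: s_def)
      qed
      also have "(23 + \<mu>) / s = C * real n / \<delta>" by (simp add: s_def C_def)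
      finally show ?case by (simp add: mult.assoc)
    qed
    moreover have "R/2 - real n * (\<delta> / real n) = \<delta>" using n by (simp add: \<delta>_def)
    ultimately show ?thesis using x by (metis order_refl)
  qed
  \<comment> \<open>The ratio of the resulting geometric bound; the hypothesis on \<open>t\<close>
    says precisely that it is below 1. That threshold does not involve
    \<open>\<rho>\<close>.\<close>
  define \<theta> where "\<theta> = \<bar>t\<bar> * C * exp 1 / \<delta>"
  have \<theta>: "0 \<le> \<theta>" "\<theta> < 1"
  proof -
    have "0 < 4 * exp 1 * C" using C by simp
    then have "\<bar>t\<bar> * (4 * exp 1 * C) < R" using t unfolding C_def[symmetric] by (simp only: pos_less_divide_eq)
    then show "\<theta> < 1" using R by (simp add: \<theta>_def \<delta>_def field_simps)
    show "0 \<le> \<theta>" using C R by (simp add: \<theta>_def \<delta>_def)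
  qed
  have t\<delta>: "\<bar>t\<bar> \<le> \<delta>"
  proof -
    have "1 * 1 \<le> exp 1 * C" using C by (intro mult_mono) auto
    then have "R / (4 * exp 1 * C) \<le> R / 4" using R C by (simp add: field_simps)
    then show ?thesis using t unfolding \<delta>_def C_def[symmetric] by linarith
  qed
  let ?u = "\<lambda>k s. V k (s *\<^sub>R axis i 1)"
  have bound: "\<bar>f (t *\<^sub>R axis i 1)\<bar> \<le> \<theta> ^ n * m" if n: "n \<ge> 1" for n
  proof -
    have "(?u k has_real_derivative ?u (Suc k) s) (at s)" for k s
      using line_has_derivative[OF sV[of k], of 0 i s] by (simp add: VS)
    then have "\<forall>k s. (?u k has_real_derivative ?u (Suc k) s) (at s)" by blast
    moreover have "?u 0 = (\<lambda>s. f (s *\<^sub>R axis i 1))" by (simp add: V_def)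
    ultimately obtain s where s: "\<bar>s\<bar> \<le> \<bar>t\<bar>"
      "f (t *\<^sub>R axis i 1) = (\<Sum>k<n. ?u k 0 / fact k * t ^ k) + ?u n s / fact n * t ^ n"
      using Maclaurin_all_le[of ?u "\<lambda>s. f (s *\<^sub>R axis i 1)" t n] by blast
    \<comment> \<open>All derivatives vanish at the origin, so only the Taylor remainder is
      left.\<close>
    have "(\<Sum>k<n. ?u k 0 / fact k * t ^ k) = 0" using V0 \<rho>(1) by simp
    then have "\<bar>f (t *\<^sub>R axis i 1)\<bar> = \<bar>?u n s\<bar> / fact n * \<bar>t\<bar> ^ n"
      using s(2) by (simp add: abs_mult power_abs)
    also have "\<dots> \<le> ((C * real n / \<delta>) ^ n * m) / fact n * \<bar>t\<bar> ^ n"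
      using Vn[OF n, of "s *\<^sub>R axis i 1"] s(1) t\<delta> by (intro mult_right_mono divide_right_mono) auto
    also have "\<dots> = (real n ^ n / fact n) * ((\<bar>t\<bar> * C / \<delta>) ^ n * m)"
      by (simp add: power_mult_distrib power_divide ac_simps)
    also have "\<dots> \<le> exp (real n) * ((\<bar>t\<bar> * C / \<delta>) ^ n * m)"
      using power_self_le_fact_exp[of n] m0 C R
      by (intro mult_right_mono) (auto simp: \<delta>_def field_simps)
    also have "exp (real n) = exp 1 ^ n" using exp_of_nat_mult[of n "1::real"] by simp
    also have "exp 1 ^ n * ((\<bar>t\<bar> * C / \<delta>) ^ n * m) = \<theta> ^ n * m"
      by (simp add: \<theta>_def power_mult_distrib power_divide)
    finally show ?thesis .
  qed
  have "(\<lambda>n. \<theta> ^ n * m) \<longlonglongrightarrow> 0 * m"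
    using \<theta> by (intro tendsto_intros LIMSEQ_realpow_zero)
  then have "\<bar>f (t *\<^sub>R axis i 1)\<bar> \<le> 0 * m"
    by (rule LIMSEQ_le_const) (use bound in blast)
  then show ?thesis by simp
qed

section \<open>Weak unique continuation\<close>

lemma test_fun_bounded: "test_fun S f \<Longrightarrow> \<exists>C. \<forall>x. \<bar>f x\<bar> \<le> C"
  unfolding test_fun_iff using continuous_bounded_support[OF smooth_continuous] by (metis real_norm_def)

text \<open>Uniformity in \<open>z\<close> is the point: it permits differentiating an integral in
  the translation parameter. The constant \<open>9 * B\<close> comes from two sums over three
  coordinates.\<close>

lemma test_fun_second_order_remainder:
  assumes \<psi>: "test_fun S \<psi>"
  shows "\<exists>L\<ge>0. \<forall>z k. \<bar>\<psi> (z + k) - \<psi> z - k \<bullet> grad \<psi> z\<bar> \<le> L * (norm k)^2"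
proof -
  note s = test_fun_smooth[OF \<psi>]
  have "\<exists>C. \<forall>i j x. \<bar>pd j (pd i \<psi>) x\<bar> \<le> C"
  proof -
    have "\<forall>p. \<exists>C. \<forall>x. \<bar>pd (fst p) (pd (snd p) \<psi>) x\<bar> \<le> C"
      using test_fun_bounded[OF test_fun_pd[OF test_fun_pd[OF \<psi>]]] by blast
    then obtain C where C: "\<And>p x. \<bar>pd (fst p) (pd (snd p) \<psi>) x\<bar> \<le> C p" by metis
    have "\<bar>pd j (pd i \<psi>) x\<bar> \<le> Max (range C)" for i j x
      using C[of "(j, i)" x] Max_ge[of "range C" "C (j, i)"] by (auto intro: order_trans)
    then show ?thesis by blast
  qed
  then obtain B where B: "\<And>i j x. \<bar>pd j (pd i \<psi>) x\<bar> \<le> B" by blast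
  have B0: "0 \<le> B" using B[of 1 1 0] by linarith
  have "\<bar>\<psi> (z + k) - \<psi> z - k \<bullet> grad \<psi> z\<bar> \<le> 9 * B * (norm k)^2" for z k
  proof -
    let ?l = "\<lambda>t. z + t *\<^sub>R k"
    have kn: "\<bar>k $ i\<bar> \<le> norm k" for i by (rule component_le_norm_cart)
    have l1: "((\<lambda>t. f (?l t)) has_real_derivative k \<bullet> grad f (?l t)) (at t)" if "smooth f" for f t
      by (rule line_has_derivative_direction[OF that])
    from MVT2[OF zero_less_one l1[OF s]]
    obtain \<theta> where \<theta>: "0 < \<theta>" "\<theta> < 1" "\<psi> (?l 1) - \<psi> (?l 0) = (1 - 0) * (k \<bullet> grad \<psi> (?l \<theta>))" by blast
    have "\<bar>pd i \<psi> (?l \<theta>) - pd i \<psi> (?l 0)\<bar> \<le> 3 * B * norm k" for i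
    proof -
      from MVT2[OF \<theta>(1) l1[OF smooth_pd[OF s, of i]]]
      obtain \<tau> where "0 < \<tau>" "\<tau> < \<theta>" and \<tau>: "pd i \<psi> (?l \<theta>) - pd i \<psi> (?l 0) = (\<theta> - 0) * (k \<bullet> grad (pd i \<psi>) (?l \<tau>))" by blast
      have "\<bar>k \<bullet> grad (pd i \<psi>) (?l \<tau>)\<bar> \<le> (\<Sum>j\<in>UNIV. \<bar>k $ j * pd j (pd i \<psi>) (?l \<tau>)\<bar>)"
        unfolding inner_vec_def grad_def by (simp add: sum_abs)
      also have "\<dots> \<le> (\<Sum>j\<in>(UNIV :: 3 set). norm k * B)"
        by (intro sum_mono) (auto simp: abs_mult intro!: mult_mono kn B)
      also have "\<dots> = 3 * B * norm k" by simp
      finally have b: "\<bar>k \<bullet> grad (pd i \<psi>) (?l \<tau>)\<bar> \<le> 3 * B * norm k" .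
      have "\<bar>pd i \<psi> (?l \<theta>) - pd i \<psi> (?l 0)\<bar> = \<theta> * \<bar>k \<bullet> grad (pd i \<psi>) (?l \<tau>)\<bar>"
        unfolding \<tau> using \<theta> by (simp add: abs_mult)
      also have "\<dots> \<le> 1 * (3 * B * norm k)" using \<theta> b by (intro mult_mono) auto
      finally show ?thesis by simp
    qed
    note d = this
    have "\<psi> (z + k) - \<psi> z - k \<bullet> grad \<psi> z = (\<Sum>i\<in>UNIV. k $ i * (pd i \<psi> (?l \<theta>) - pd i \<psi> (?l 0)))"
      using \<theta>(3) by (simp add: inner_vec_def grad_def sum_subtractf right_diff_distrib)
    also have "\<bar>\<dots>\<bar> \<le> (\<Sum>i\<in>UNIV. \<bar>k $ i * (pd i \<psi> (?l \<theta>) - pd i \<psi> (?l 0))\<bar>)" by (rule sum_abs)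
    also have "\<dots> \<le> (\<Sum>i\<in>(UNIV :: 3 set). norm k * (3 * B * norm k))"
      unfolding abs_mult by (intro sum_mono mult_mono kn d) auto
    also have "\<dots> = 9 * B * (norm k)^2" by (simp add: power2_eq_square)
    finally show ?thesis .
  qed
  then show ?thesis using B0 by (intro exI[of _ "9 * B"]) auto
qed

lemma has_derivative_of_quadratic_remainder:
  fixes f :: "'a::real_normed_vector \<Rightarrow> real"
  assumes D: "bounded_linear D" and b: "\<And>k. \<bar>f (s + k) - f s - D k\<bar> \<le> L * (norm k)^2"
  shows "(f has_derivative D) (at s)"
  unfolding has_derivative_at
proof (intro conjI D)
  show "(\<lambda>h. norm (f (s + h) - f s - D h) / norm h) \<midarrow>0\<rightarrow> 0"
  proof (rule Lim_null_comparison)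
    have "norm (norm (f (s + h) - f s - D h) / norm h) \<le> L * norm h" for h
    proof (cases "h = 0")
      case False
      then show ?thesis using b[of h] by (simp add: field_simps power2_eq_square)
    qed simp
    then show "\<forall>\<^sub>F h in at 0. norm (norm (f (s + h) - f s - D h) / norm h) \<le> L * norm h" by simp
    show "(\<lambda>h::'a. L * norm h) \<midarrow>0\<rightarrow> 0" by (intro tendsto_mult_right_zero tendsto_norm_zero tendsto_ident_at)
  qed
qed

lemma pd_shift: "smooth f \<Longrightarrow> pd i (\<lambda>y. f (y - a)) = (\<lambda>y. pd i f (y - a))"
  using pd_affine[of f "- a" 1] smooth_differentiable by (simp add: fun_eq_iff)

lemma smooth_shift: "smooth f \<Longrightarrow> smooth (\<lambda>y. f (y - a))"
  using smooth_affine[of f "- a" 1] by simp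

lemma laplacian_shift: "smooth f \<Longrightarrow> laplacian (\<lambda>y. f (y - a)) = (\<lambda>y. laplacian f (y - a))"
  unfolding laplacian_def[abs_def] by (simp add: pd_shift smooth_pd)

lemma test_fun_shift:
  assumes "test_fun (ball p r) f"
  shows "test_fun (ball (p + a) r) (\<lambda>y. f (y - a))"
proof -
  obtain K where K: "smooth f" "compact K" "K \<subseteq> ball p r" "\<And>x. x \<notin> K \<Longrightarrow> f x = 0"
    using assms unfolding test_fun_iff by blast
  have "compact ((\<lambda>y. y + a) ` K)" by (intro compact_continuous_image K continuous_intros)
  moreover have "(\<lambda>y. y + a) ` K \<subseteq> ball (p + a) r" using K(3) by (auto simp: dist_norm)
  moreover have "f (y - a) = 0" if "y \<notin> (\<lambda>y. y + a) ` K" for y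
  proof (rule K(4), rule notI)
    assume "y - a \<in> K"
    then have "(y - a) + a \<in> (\<lambda>y. y + a) ` K" by (rule imageI)
    with that show False by simp
  qed
  ultimately show ?thesis using smooth_shift[OF K(1)] unfolding test_fun_iff by blast
qed

section \<open>Smoothing weak solutions by translated test functions\<close>

context bounded_open
begin

text \<open>The derivative falls on the translated test function. Its Taylor remainder is uniformly
  quadratic in \<open>k\<close>, and Cauchy-Schwarz against the constant 1 on the bounded \<Omega>
  keeps the remainder of the integral quadratic.\<close>

lemma convolution_has_derivative:
  assumes w: "sq_int M w" and \<psi>: "test_fun S \<psi>"
  shows "((\<lambda>s. ip M w (\<lambda>y. \<psi> (y - s))) has_derivative
    (\<lambda>k. \<Sum>i\<in>UNIV. k $ i * (- ip M w (\<lambda>y. pd i \<psi> (y - s))))) (at s)"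
proof -
  note sm = test_fun_smooth[OF \<psi>]
  obtain L where L: "L \<ge> 0" "\<And>z k. \<bar>\<psi> (z + k) - \<psi> z - k \<bullet> grad \<psi> z\<bar> \<le> L * (norm k)^2"
    using test_fun_second_order_remainder[OF \<psi>] by blast
  have s1: "sq_int M (\<lambda>y. \<psi> (y - a))" "sq_int M (\<lambda>y. pd i \<psi> (y - a))" for a i
    by (intro smooth_sq_int smooth_shift smooth_pd sm)+
  have one: "sq_int M (\<lambda>y. 1 :: real)" by (intro smooth_sq_int smooth_const)
  show ?thesis
  proof (rule has_derivative_of_quadratic_remainder)
    show "bounded_linear (\<lambda>k. \<Sum>i\<in>UNIV. k $ i * (- ip M w (\<lambda>y. pd i \<psi> (y - s))))"
      by (intro bounded_linear_sum bounded_linear_mult_const bounded_linear_vec_nth)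
    fix k :: "real^3"
    define r where "r y = \<psi> (y - (s + k)) - \<psi> (y - s) + (\<Sum>i\<in>UNIV. k $ i * pd i \<psi> (y - s))" for y
    have rs: "sq_int M r" unfolding r_def[abs_def] by (intro sq_int_intros s1)
    have "\<bar>r y\<bar> \<le> L * (norm k)^2" for y
    proof -
      have "y - (s + k) = (y - s) + - k" by simp
      then have "r y = \<psi> ((y - s) + - k) - \<psi> (y - s) - (- k) \<bullet> grad \<psi> (y - s)"
        by (simp only: r_def) (simp add: inner_vec_def grad_def sum_negf)
      then show ?thesis using L(2)[of "y - s" "- k"] by simp
    qed
    then have "nsq M r \<le> (L * (norm k)^2)^2 * ip M (\<lambda>y. 1 :: real) (\<lambda>y. 1)"
      by (intro ip_self_mono[OF one rs]) auto
    then have "sqrt (nsq M r) \<le> L * (norm k)^2 * sqrt (ip M (\<lambda>y. 1 :: real) (\<lambda>y. 1))"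
      using L(1) real_sqrt_le_mono[of "nsq M r"] by (fastforce simp: real_sqrt_mult)
    then have "sqrt (nsq M w) * sqrt (nsq M r) \<le> sqrt (nsq M w) * (L * (norm k)^2 * sqrt (ip M (\<lambda>y. 1 :: real) (\<lambda>y. 1)))"
      by (intro mult_left_mono) auto
    then have "\<bar>ip M w r\<bar> \<le> (sqrt (nsq M w) * L * sqrt (ip M (\<lambda>y. 1 :: real) (\<lambda>y. 1))) * (norm k)^2"
      using ip_abs_le[OF w rs] by (simp add: ac_simps)
    moreover have "ip M w r = ip M w (\<lambda>y. \<psi> (y - (s + k))) - ip M w (\<lambda>y. \<psi> (y - s))
        - (\<Sum>i\<in>UNIV. k $ i * (- ip M w (\<lambda>y. pd i \<psi> (y - s))))"
      unfolding r_def by (simp add: ip_add_right ip_diff_right ip_sum_right ip_mult_right s1 w sq_int_intros sum_negf)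
    ultimately show "\<bar>ip M w (\<lambda>y. \<psi> (y - (s + k))) - ip M w (\<lambda>y. \<psi> (y - s))
        - (\<Sum>i\<in>UNIV. k $ i * (- ip M w (\<lambda>y. pd i \<psi> (y - s))))\<bar>
      \<le> (sqrt (nsq M w) * L * sqrt (ip M (\<lambda>y. 1 :: real) (\<lambda>y. 1))) * (norm k)^2" by simp
  qed
qed

lemma pd_convolution:
  assumes "sq_int M w" "test_fun S \<psi>"
  shows "pd i (\<lambda>s. ip M w (\<lambda>y. \<psi> (y - s))) = (\<lambda>s. - ip M w (\<lambda>y. pd i \<psi> (y - s)))"
proof
  fix s
  show "pd i (\<lambda>s. ip M w (\<lambda>y. \<psi> (y - s))) s = - ip M w (\<lambda>y. pd i \<psi> (y - s))"
    using pd_eqI[OF convolution_has_derivative[OF assms], of i s]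
    by (simp add: axis_def if_distrib if_distribR cong: if_cong)
qed

lemma smooth_convolution:
  assumes w: "sq_int M w" and \<psi>: "test_fun S \<psi>"
  shows "smooth (\<lambda>s. ip M w (\<lambda>y. \<psi> (y - s)))"
proof -
  have "Ck n (\<lambda>s. c * ip M w (\<lambda>y. \<psi> (y - s)))" if "test_fun S \<psi>" for n c \<psi>
    using that
  proof (induction n arbitrary: c \<psi>)
    case 0
    have "continuous_on UNIV (\<lambda>s. ip M w (\<lambda>y. \<psi> (y - s)))"
      using convolution_has_derivative[OF w 0]
      by (meson continuous_at_imp_continuous_on has_derivative_continuous)
    then show ?case by (auto intro: continuous_intros)
  next
    case (Suc n)
    have df: "(\<lambda>s. ip M w (\<lambda>y. \<psi> (y - s))) differentiable (at s)" for s
      using convolution_has_derivative[OF w Suc.prems] differentiable_def by blast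
    have "pd i (\<lambda>s. c * ip M w (\<lambda>y. \<psi> (y - s))) s = - c * ip M w (\<lambda>y. pd i \<psi> (y - s))" for i s
      using pd_mult[OF differentiable_const df, of i c s] by (simp add: pd_convolution[OF w Suc.prems])
    then have "pd i (\<lambda>s. c * ip M w (\<lambda>y. \<psi> (y - s))) = (\<lambda>s. - c * ip M w (\<lambda>y. pd i \<psi> (y - s)))" for i by blast
    moreover have "Ck n (\<lambda>s. - c * ip M w (\<lambda>y. pd i \<psi> (y - s)))" for i
      by (rule Suc.IH[OF test_fun_pd[OF Suc.prems]])
    ultimately show ?case by (intro Ck_Suc_I differentiable_mult differentiable_const df) auto
  qed
  from this[OF \<psi>, of _ 1] show ?thesis by (simp add: smooth_def)
qed

lemma laplacian_convolution:
  assumes w: "sq_int M w" and \<psi>: "test_fun S \<psi>"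
  shows "laplacian (\<lambda>s. ip M w (\<lambda>y. \<psi> (y - s))) s = ip M w (\<lambda>y. laplacian \<psi> (y - s))"
proof -
  have "pd i (pd i (\<lambda>s. ip M w (\<lambda>y. \<psi> (y - s)))) s = ip M w (\<lambda>y. pd i (pd i \<psi>) (y - s))" for i
    unfolding pd_convolution[OF w \<psi>] pd_uminus[OF smooth_convolution[OF w test_fun_pd[OF \<psi>]]]
      pd_convolution[OF w test_fun_pd[OF \<psi>]] by simp
  moreover have "sq_int M (\<lambda>y. pd i (pd i \<psi>) (y - s))" for i
    by (intro smooth_sq_int smooth_shift smooth_pd test_fun_smooth[OF \<psi>])
  ultimately show ?thesis by (simp add: laplacian_def ip_sum_right w)
qed

text \<open>The test functions may reach outside \<Omega> while the integral runs over \<Omega>: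
  this is local vanishing of the extension of \<open>w\<close> by zero, and it makes sense at and
  beyond the boundary.\<close>

definition vanishes_near :: "(real^3 \<Rightarrow> real) \<Rightarrow> real^3 \<Rightarrow> bool" where
  "vanishes_near w x \<longleftrightarrow> (\<exists>r>0. \<forall>\<psi>. test_fun (ball x r) \<psi> \<longrightarrow> ip M w \<psi> = 0)"

text \<open>Again \<open>S\<close> may leave \<Omega>; then the equation concerns the extension of
  \<open>w\<close> by zero.\<close>

definition weak_Helmholtz :: "real \<Rightarrow> (real^3) set \<Rightarrow> (real^3 \<Rightarrow> real) \<Rightarrow> bool" where
  "weak_Helmholtz \<mu> S w \<longleftrightarrow> (\<forall>\<psi>. test_fun S \<psi> \<longrightarrow> ip M w (\<lambda>x. laplacian \<psi> x + \<mu> * \<psi> x) = 0)"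

lemma weak_Helmholtz_mono: "weak_Helmholtz \<mu> S w \<Longrightarrow> T \<subseteq> S \<Longrightarrow> weak_Helmholtz \<mu> T w"
  using test_fun_mono unfolding weak_Helmholtz_def by blast

text \<open>Pairing \<open>w\<close> with a test function translated by \<open>h\<close> is a smooth
  function of \<open>h\<close> that solves the Helmholtz equation and vanishes for small
  \<open>h\<close>. Its value at \<open>t *\<^sub>R axis i 1\<close> is the pairing to be shown
  zero.\<close>

lemma continuation_axis:
  assumes w: "sq_int M w" and \<mu>: "\<mu> \<ge> 0" and R: "0 < R" "R \<le> 1"
    and H: "weak_Helmholtz \<mu> (ball x R) w" and x: "vanishes_near w x"
    and t: "\<bar>t\<bar> < R / (8 * exp 1 * (23 + \<mu>))"
  shows "vanishes_near w (x + t *\<^sub>R axis i 1)"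
proof -
  obtain \<rho> where \<rho>: "\<rho> > 0" "\<And>\<psi>. test_fun (ball x \<rho>) \<psi> \<Longrightarrow> ip M w \<psi> = 0"
    using x unfolding vanishes_near_def by blast
  let ?e = "axis i (1::real)"
  \<comment> \<open>Supports of radius up to \<open>R/2\<close> must stay inside
    \<open>ball x R\<close>, so the pairing is controlled for \<open>h\<close> in radius
    \<open>R/2\<close> only; hence the constant 8 in place of 4.\<close>
  define \<epsilon> where "\<epsilon> = min (\<rho>/2) (R/2)"
  have \<epsilon>: "\<epsilon> > 0" "\<epsilon> \<le> \<rho>/2" "\<epsilon> \<le> R/2" using \<rho>(1) R by (auto simp: \<epsilon>_def)
  have "ip M w \<psi> = 0" if \<psi>: "test_fun (ball (x + t *\<^sub>R ?e) \<epsilon>) \<psi>" for \<psi>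
  proof -
    note sm = test_fun_smooth[OF \<psi>]
    define F where "F s = ip M w (\<lambda>y. \<psi> (y - s))" for s
    define f where "f h = F (h - t *\<^sub>R ?e)" for h
    have sF: "smooth F" unfolding F_def[abs_def] by (rule smooth_convolution[OF w \<psi>])
    have sf: "smooth f" unfolding f_def[abs_def] by (rule smooth_shift[OF sF])
    have T: "test_fun (ball (x + h) \<epsilon>) (\<lambda>y. \<psi> (y - (h - t *\<^sub>R ?e)))" for h
      using test_fun_shift[OF \<psi>, of "h - t *\<^sub>R ?e"] by simp
    have sub: "ball (x + h) \<epsilon> \<subseteq> ball x r" if "norm h + \<epsilon> \<le> r" for h r
      using that by (intro ball_subset_ball_iff[THEN iffD2] disjI1) (simp add: dist_norm norm_minus_commute)
    have "f (t *\<^sub>R ?e) = 0"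
    proof (rule Helmholtz_continuation_line[OF sf \<mu>])
      show "0 < R/2" "R/2 \<le> 1" "\<rho>/2 > 0" using R \<rho> by auto
      show "f h = 0" if "h \<in> ball 0 (\<rho>/2)" for h
        unfolding f_def F_def using that \<epsilon> by (intro \<rho>(2) test_fun_mono[OF T sub]) auto
      show "\<bar>t\<bar> < R/2 / (4 * exp 1 * (23 + \<mu>))" using t by (simp add: mult.assoc)
      show "laplacian f h = - \<mu> * f h" if "h \<in> ball 0 (R/2)" for h
      proof -
        let ?g = "\<lambda>y. \<psi> (y - (h - t *\<^sub>R ?e))"
        have "test_fun (ball x R) ?g" using that \<epsilon> by (intro test_fun_mono[OF T sub]) auto
        then have "0 = ip M w (\<lambda>y. laplacian ?g y + \<mu> * ?g y)" using H by (simp add: weak_Helmholtz_def)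
        also have "\<dots> = ip M w (laplacian ?g) + \<mu> * ip M w ?g"
          by (subst ip_add_right)
             (auto intro!: w smooth_sq_int smooth_laplacian smooth_shift smooth_cmult sm simp: ip_mult_right)
        also have "ip M w (laplacian ?g) = laplacian F (h - t *\<^sub>R ?e)"
          unfolding laplacian_shift[OF sm] F_def[abs_def] laplacian_convolution[OF w \<psi>] ..
        also have "laplacian F (h - t *\<^sub>R ?e) = laplacian f h"
          unfolding f_def[abs_def] laplacian_shift[OF sF] ..
        finally show ?thesis by (simp add: f_def F_def)
      qed
    qed
    then show ?thesis by (simp add: f_def F_def)
  qed
  with \<epsilon>(1) show ?thesis unfolding vanishes_near_def by blast
qed

text \<open>Three moves parallel to the axes lead from \<open>x\<close> to \<open>y\<close>. Each
  starts within \<open>R/2\<close> of \<open>x\<close>, where a ball of radius \<open>R/2\<close> is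
  still available; halving the radius turns the constant 8 into 16.\<close>

lemma continuation_ball:
  assumes w: "sq_int M w" and \<mu>: "\<mu> \<ge> 0" and R: "0 < R" "R \<le> 1"
    and H: "weak_Helmholtz \<mu> (ball x R) w" and x: "vanishes_near w x"
    and y: "dist x y < R / (16 * exp 1 * (23 + \<mu>))"
  shows "vanishes_near w y"
proof -
  define k where "k = y - x"
  define c where "c = R / (16 * exp 1 * (23 + \<mu>))"
  have c: "c = R/2 / (8 * exp 1 * (23 + \<mu>))" by (simp add: c_def)
  have "16 * 1 * 23 \<le> 16 * exp 1 * (23 + \<mu>)" using \<mu> by (intro mult_mono) auto
  then have cR: "c \<le> R/4" unfolding c_def using R by (intro divide_left_mono) auto
  have kn: "norm k < c" using y by (simp add: k_def c_def dist_norm norm_minus_commute)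
  have ki: "\<bar>k $ i\<bar> < c" for i using component_le_norm_cart[of k i] kn by linarith
  have step: "vanishes_near w (z + k $ i *\<^sub>R axis i 1)" if "vanishes_near w z" "dist x z \<le> R/2" for z i
  proof (rule continuation_axis[OF w \<mu> _ _ _ that(1)])
    show "0 < R/2" "R/2 \<le> 1" using R by auto
    show "weak_Helmholtz \<mu> (ball z (R/2)) w"
      using that(2) by (intro weak_Helmholtz_mono[OF H] ball_subset_ball_iff[THEN iffD2] disjI1) (simp add: dist_commute)
    show "\<bar>k $ i\<bar> < R/2 / (8 * exp 1 * (23 + \<mu>))" using ki[of i] unfolding c .
  qed
  let ?a = "k $ 1 *\<^sub>R axis 1 (1::real) :: real^3" and ?b = "k $ 2 *\<^sub>R axis 2 (1::real) :: real^3"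
    and ?c = "k $ 3 *\<^sub>R axis 3 (1::real) :: real^3"
  have n: "norm ?a < c" "norm ?b < c" using ki by auto
  have "vanishes_near w (x + ?a)" using step[OF x] R by simp
  moreover have "dist x (x + ?a) \<le> R/2" using n cR R by (simp add: dist_norm)
  ultimately have "vanishes_near w (x + ?a + ?b)" by (rule step)
  moreover have "dist x (x + ?a + ?b) \<le> R/2"
  proof -
    have "dist x (x + ?a + ?b) = norm (?a + ?b)" by (simp only: dist_norm norm_minus_commute[of x]) (simp add: algebra_simps)
    then show ?thesis using norm_triangle_ineq[of ?a ?b] n cR by linarith
  qed
  ultimately have "vanishes_near w (x + ?a + ?b + ?c)" by (rule step)
  moreover have "x + ?a + ?b + ?c = y"
    unfolding k_def vec_eq_iff forall_3 by (simp add: axis_def)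
  ultimately show ?thesis by simp
qed

lemma vanishes_near_open:
  assumes "vanishes_near w x"
  shows "\<exists>r>0. \<forall>y\<in>ball x r. vanishes_near w y"
proof -
  obtain r where r: "r > 0" "\<And>\<psi>. test_fun (ball x r) \<psi> \<Longrightarrow> ip M w \<psi> = 0"
    using assms unfolding vanishes_near_def by blast
  have "vanishes_near w y" if "y \<in> ball x (r/2)" for y
    unfolding vanishes_near_def
  proof (intro exI conjI allI impI)
    show "r/2 > 0" using r by simp
    have sub: "ball y (r/2) \<subseteq> ball x r" using that by (intro ball_subset_ball_iff[THEN iffD2] disjI1) (simp add: dist_commute)
    show "ip M w \<psi> = 0" if "test_fun (ball y (r/2)) \<psi>" for \<psi> by (rule r(2)[OF test_fun_mono[OF that sub]])
  qed
  then show ?thesis using r(1) by (intro exI[of _ "r/2"]) auto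
qed

text \<open>The points near which \<open>w\<close> vanishes form an open set. It is also relatively
  closed: the reach of \<open>continuation_ball\<close> depends on \<open>R\<close> and
  \<open>\<mu>\<close> but not on the size of the neighbourhood where \<open>w\<close> is known to
  vanish, so a limit point is reached from a nearby point of the set.\<close>

theorem unique_continuation:
  assumes conn: "connected \<Omega>" and w: "sq_int M w" and \<mu>: "\<mu> \<ge> 0"
    and H: "weak_Helmholtz \<mu> \<Omega> w" and x0: "x0 \<in> \<Omega>" "vanishes_near w x0" and x: "x \<in> \<Omega>"
  shows "vanishes_near w x"
proof -
  define S where "S = {x \<in> \<Omega>. vanishes_near w x}"
  have "openin (top_of_set \<Omega>) S"
    unfolding openin_contains_ball S_def using vanishes_near_open by blast
  moreover have "closedin (top_of_set \<Omega>) S"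
    unfolding closedin_limpt
  proof (intro conjI allI impI)
    show "S \<subseteq> \<Omega>" by (auto simp: S_def)
    fix y assume y: "y islimpt S \<and> y \<in> \<Omega>"
    obtain r where r: "r > 0" "ball y r \<subseteq> \<Omega>" using y open_Omega open_contains_ball by blast
    define R where "R = min 1 (r/2)"
    have R: "0 < R" "R \<le> 1" "R \<le> r/2" using r by (auto simp: R_def)
    define c where "c = R / (16 * exp 1 * (23 + \<mu>))"
    have "1 * 1 * 1 \<le> 16 * exp 1 * (23 + \<mu>)" using \<mu> by (intro mult_mono) auto
    then have c: "0 < c" "c \<le> R" using R \<mu> by (auto simp: c_def divide_le_eq)
    obtain z where z: "z \<in> S" "dist z y < c" using y c(1) unfolding islimpt_approachable by blast
    have "ball z R \<subseteq> ball y r"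
      using z(2) c R by (intro ball_subset_ball_iff[THEN iffD2] disjI1) simp
    then have "weak_Helmholtz \<mu> (ball z R) w" using r by (intro weak_Helmholtz_mono[OF H]) auto
    then have "vanishes_near w y"
      using continuation_ball[OF w \<mu> R(1,2), of z y] z by (simp add: S_def c_def)
    then show "y \<in> S" using y by (simp add: S_def)
  qed
  moreover have "S \<noteq> {}" using x0 by (auto simp: S_def)
  ultimately have "S = \<Omega>" using conn unfolding connected_clopen by blast
  then show ?thesis using x by (auto simp: S_def)
qed

text \<open>In place of a partition of unity: multiplying \<open>\<theta>\<close> by \<open>\<Prod>(1 - \<eta>\<^sub>x)\<close>, where the plateaus of the
  cutoffs \<open>\<eta>\<^sub>x\<close> cover the support of \<open>\<theta>\<close>, does not change the integral but gives zero.\<close>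

lemma vanishes_everywhere:
  assumes w: "sq_int M w" and loc: "\<And>x. x \<in> \<Omega> \<Longrightarrow> vanishes_near w x" and \<theta>: "test_fun \<Omega> \<theta>"
  shows "ip M w \<theta> = 0"
proof -
  obtain K where K: "compact K" "K \<subseteq> \<Omega>" "\<And>x. x \<notin> K \<Longrightarrow> \<theta> x = 0" using \<theta> unfolding test_fun_iff by blast
  have "\<forall>x\<in>K. \<exists>r>0. \<forall>\<psi>. test_fun (ball x r) \<psi> \<longrightarrow> ip M w \<psi> = 0"
    using loc K(2) unfolding vanishes_near_def by blast
  from bchoice[OF this] obtain r where r: "\<And>x. x \<in> K \<Longrightarrow> r x > 0"
    "\<And>x \<psi>. x \<in> K \<Longrightarrow> test_fun (ball x (r x)) \<psi> \<Longrightarrow> ip M w \<psi> = 0" by blast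
  have "\<forall>x\<in>K. \<exists>\<eta>. test_fun (ball x (r x)) \<eta> \<and> (\<forall>y\<in>ball x (r x / 2). \<eta> y = 1)"
    using exists_plateau r(1) by blast
  from bchoice[OF this] obtain \<eta> where \<eta>: "\<And>x. x \<in> K \<Longrightarrow> test_fun (ball x (r x)) (\<eta> x)"
    "\<And>x y. x \<in> K \<Longrightarrow> y \<in> ball x (r x / 2) \<Longrightarrow> \<eta> x y = 1" by blast
  have "K \<subseteq> (\<Union>x\<in>K. ball x (r x / 2))" using r(1) by force
  from this obtain X where X: "X \<subseteq> K" "finite X" "K \<subseteq> (\<Union>x\<in>X. ball x (r x / 2))"
    by (rule compactE_image[OF K(1) open_ball])
  have sm: "smooth (\<eta> x)" if "x \<in> K" for x using test_fun_smooth[OF \<eta>(1)[OF that]] .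
  have "ip M w (\<lambda>y. \<theta> y * (\<Prod>x\<in>Y. 1 - \<eta> x y)) = ip M w \<theta>" if "Y \<subseteq> K" "finite Y" for Y
    using that(2,1)
  proof (induction Y rule: finite_induct)
    case (insert a Y)
    let ?p = "\<lambda>y. \<theta> y * (\<Prod>x\<in>Y. 1 - \<eta> x y)"
    have sp: "smooth ?p"
      using insert.prems by (intro smooth_mult smooth_prod smooth_diff smooth_const sm test_fun_smooth[OF \<theta>]) auto
    have a: "a \<in> K" using insert.prems by simp
    have t: "test_fun (ball a (r a)) (\<lambda>y. ?p y * \<eta> a y)" by (intro test_fun_mult_left \<eta> a sp)
    have "(\<lambda>y. \<theta> y * (\<Prod>x\<in>insert a Y. 1 - \<eta> x y)) = (\<lambda>y. ?p y - ?p y * \<eta> a y)"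
      using insert.hyps by (simp add: fun_eq_iff algebra_simps)
    then have "ip M w (\<lambda>y. \<theta> y * (\<Prod>x\<in>insert a Y. 1 - \<eta> x y)) = ip M w ?p - ip M w (\<lambda>y. ?p y * \<eta> a y)"
      by (simp only: ip_diff_right[OF smooth_sq_int[OF sp] smooth_sq_int[OF test_fun_smooth[OF t]] w])
    also have "\<dots> = ip M w \<theta>" using r(2)[OF a t] insert by simp
    finally show ?case .
  qed simp
  from this[OF X(1,2)] have "ip M w \<theta> = ip M w (\<lambda>y. \<theta> y * (\<Prod>x\<in>X. 1 - \<eta> x y))" by simp
  also have "(\<lambda>y. \<theta> y * (\<Prod>x\<in>X. 1 - \<eta> x y)) = (\<lambda>y. 0)"
  proof
    fix y
    show "\<theta> y * (\<Prod>x\<in>X. 1 - \<eta> x y) = 0"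
    proof (cases "y \<in> K")
      case True
      then obtain x where "x \<in> X" "y \<in> ball x (r x / 2)" using X(3) by blast
      then have "1 - \<eta> x y = 0" using \<eta>(2) X(1) by auto
      then show ?thesis using \<open>x \<in> X\<close> X(2) by (auto intro: prod_zero)
    qed (simp add: K)
  qed
  finally show ?thesis by simp
qed

lemma H10_zero_of_vanishing:
  assumes P: "H10 \<Omega> P G" and "\<And>\<theta>. test_fun \<Omega> \<theta> \<Longrightarrow> ip M P \<theta> = 0"
  shows "AE x in M. P x = 0"
proof -
  note Ps = H10_sq_int[OF P]
  from H10_approx[OF P] obtain a where a: "\<And>n. test_fun \<Omega> (a n)" "\<And>n. smooth (a n)" "L2_lim M a P" by metis
  have "(\<lambda>n. ip M (a n) P) \<longlonglongrightarrow> nsq M P" by (intro L2_lim_ip a smooth_sq_int Ps)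
  moreover have "ip M (a n) P = 0" for n using assms(2)[OF a(1)] by (simp add: ip_commute)
  ultimately have "nsq M P = 0" by (simp add: LIMSEQ_const_iff)
  then show ?thesis by (rule ip_self_eq_0[OF Ps(1)])
qed

end

section \<open>Planar boundary pieces\<close>

text \<open>A flat piece of the frontier alone could have \<Omega> on both sides; the Lipschitz
  graph excludes this. The graph function \<open>h\<close> vanishes on the frontier and grows with
  unit slope along the graph axis \<open>m\<close>. Projecting along \<open>m\<close> onto the plane
  therefore shows that \<open>h\<close> is a multiple of \<open>n \<bullet> (x - p)\<close> near
  \<open>p\<close>.\<close>

lemma planar_piece_half_ball:
  assumes lip: "lipschitz_domain \<Omega>" and P: "planar_piece \<Omega> n P"
  obtains p r \<sigma> where "p \<in> frontier \<Omega>" "r > 0" "\<bar>\<sigma>\<bar> = 1"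
    "\<And>x. x \<in> ball p r \<Longrightarrow> x \<in> \<Omega> \<longleftrightarrow> \<sigma> * (n \<bullet> (x - p)) < 0"
proof -
  have op: "open \<Omega>" using lip by (simp add: lipschitz_domain_def)
  obtain c where P: "n \<noteq> 0" "P \<noteq> {}" "P \<subseteq> frontier \<Omega>" "openin (top_of_set {x. n \<bullet> x = c}) P"
    using P unfolding planar_piece_def by blast
  obtain p where p: "p \<in> P" using P(2) by blast
  have pf: "p \<in> frontier \<Omega>" and np: "n \<bullet> p = c"
    using p P(3,4) openin_subset[OF P(4)] by auto
  obtain s where s: "s > 0" "ball p s \<inter> {x. n \<bullet> x = c} \<subseteq> P"
    using P(4) p unfolding openin_contains_ball by blast
  obtain Q :: "real^3 \<Rightarrow> real^3" and r0 L and g :: "real^2 \<Rightarrow> real" where Q: "orthogonal_transformation Q" and r0: "r0 > 0" and g: "L-lipschitz_on UNIV g"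
    and loc: "\<And>x. x \<in> ball p r0 \<Longrightarrow> x \<in> \<Omega> \<longleftrightarrow>
      (Q (x - p)) $ 3 < g (vector [(Q (x - p)) $ 1, (Q (x - p)) $ 2] :: real^2)"
    using lip pf unfolding lipschitz_domain_def by blast
  have lin: "linear Q" using Q by (simp add: orthogonal_transformation_def)
  define h where "h x = (Q (x - p)) $ 3 - g (vector [(Q (x - p)) $ 1, (Q (x - p)) $ 2])" for x
  have Qc: "continuous_on UNIV (\<lambda>x. Q (x - p))"
    by (intro continuous_on_compose2[OF linear_continuous_on[OF linear_conv_bounded_linear[THEN iffD1, OF lin]]] continuous_intros) auto
  have "(vector [a, b] :: real^2) = (\<chi> i. if i = 1 then a else b)" for a b
    by (simp add: vec_eq_iff forall_2 vector_2)
  then have v: "(\<lambda>x. vector [(Q (x - p)) $ 1, (Q (x - p)) $ 2] :: real^2) =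
      (\<lambda>x. \<chi> i. if i = 1 then (Q (x - p)) $ 1 else (Q (x - p)) $ 2)" by simp
  have "continuous_on UNIV (\<lambda>x. if i = 1 then (Q (x - p)) $ 1 else (Q (x - p)) $ 2)" for i :: 2
    by (cases "i = 1") (simp_all add: continuous_on_component[OF Qc])
  then have "continuous_on UNIV (\<lambda>x. vector [(Q (x - p)) $ 1, (Q (x - p)) $ 2] :: real^2)"
    unfolding v by (rule continuous_on_vec_lambda)
  then have hc: "continuous_on UNIV h"
    unfolding h_def[abs_def]
    by (intro continuous_on_diff continuous_on_component[OF Qc]
        continuous_on_compose2[OF lipschitz_on_continuous_on[OF g]]) auto
  have h\<Omega>: "x \<in> \<Omega> \<longleftrightarrow> h x < 0" if "x \<in> ball p r0" for x using loc[OF that] by (simp add: h_def)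
  have hfr: "h x = 0" if x: "x \<in> frontier \<Omega>" "x \<in> ball p r0" for x
  proof (rule ccontr)
    assume "h x \<noteq> 0"
    moreover have "x \<notin> \<Omega>" using x(1) op by (auto simp: frontier_def interior_open)
    ultimately have pos: "h x > 0" using h\<Omega>[OF x(2)] by auto
    let ?U = "ball p r0 \<inter> {y. h y > 0}"
    have "open ?U" by (intro open_Int open_ball open_Collect_less hc continuous_intros)
    moreover have "?U \<inter> \<Omega> = {}" using h\<Omega> by fastforce
    ultimately have "?U \<inter> closure \<Omega> = {}" using open_Int_closure_eq_empty by blast
    then show False using x pos by (auto simp: frontier_def)
  qed
  obtain m where m: "Q m = axis 3 1" using orthogonal_transformation_surj[OF Q] by (metis surjD)
  have h_line: "h (x + \<tau> *\<^sub>R m) = h x + \<tau>" for x \<tau>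
  proof -
    have "Q (x + \<tau> *\<^sub>R m - p) = Q (x - p) + \<tau> *\<^sub>R axis 3 1"
      using linear_add[OF lin, of "x - p" "\<tau> *\<^sub>R m"] linear_scale[OF lin, of \<tau> m] m by (simp add: algebra_simps)
    then show ?thesis unfolding h_def by (simp add: axis_def)
  qed
  \<comment> \<open>Otherwise the plane would contain a segment in direction \<open>m\<close>
    through \<open>p\<close>, on which \<open>h\<close> both vanishes and increases.\<close>
  have nm: "n \<bullet> m \<noteq> 0"
  proof
    assume nm: "n \<bullet> m = 0"
    define \<tau> where "\<tau> = min s r0 / (2 * (norm m + 1))"
    have m1: "norm m + 1 > 0" by (simp add: add_nonneg_pos)
    have \<tau>: "\<tau> > 0" using s r0 m1 by (simp add: \<tau>_def)
    have "\<tau> * norm m \<le> \<tau> * (norm m + 1)" using \<tau> by simp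
    also have "\<dots> = min s r0 / 2" unfolding \<tau>_def using m1 nonzero_mult_divide_mult_cancel_right[of "norm m + 1" "min s r0" 2] by argo
    also have "\<dots> < min s r0" using s(1) r0 by auto
    finally have d: "dist p (p + \<tau> *\<^sub>R m) < min s r0" using \<tau> by (simp add: dist_norm)
    have "n \<bullet> (p + \<tau> *\<^sub>R m) = c" using nm np by (simp add: inner_add_right)
    then have "p + \<tau> *\<^sub>R m \<in> P" using s(2) d by auto
    then have "h (p + \<tau> *\<^sub>R m) = 0" using P(3) d by (intro hfr) auto
    moreover have "h p = 0" using pf r0 by (intro hfr) auto
    ultimately show False using h_line \<tau> by simp
  qed
  \<comment> \<open>Projection along \<open>m\<close> onto the plane enlarges the distance from
    \<open>p\<close> at most by this factor, so points within \<open>r\<close> project into the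
    known part of the piece.\<close>
  define a where "a = 1 + norm n * norm m / \<bar>n \<bullet> m\<bar>"
  have a: "a > 0" unfolding a_def by (intro add_pos_nonneg) auto
  define r where "r = min (min s r0 / a) r0"
  have r: "r > 0" using s r0 a by (simp add: r_def)
  have key: "x \<in> \<Omega> \<longleftrightarrow> sgn (n \<bullet> m) * (n \<bullet> (x - p)) < 0" if x: "x \<in> ball p r" for x
  proof -
    define \<tau> where "\<tau> = n \<bullet> (x - p) / (n \<bullet> m)"
    let ?y = "x - \<tau> *\<^sub>R m"
    have ny: "n \<bullet> ?y = c" using nm np by (simp add: \<tau>_def inner_diff_right)
    have xr: "norm (x - p) < min s r0 / a" using x by (simp add: r_def dist_norm norm_minus_commute)
    have "\<bar>\<tau>\<bar> \<le> norm n * norm (x - p) / \<bar>n \<bullet> m\<bar>"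
      unfolding \<tau>_def abs_divide by (intro divide_right_mono Cauchy_Schwarz_ineq2) auto
    then have "\<bar>\<tau>\<bar> * norm m \<le> norm n * norm (x - p) / \<bar>n \<bullet> m\<bar> * norm m" by (intro mult_right_mono) auto
    then have "norm (\<tau> *\<^sub>R m) \<le> norm (x - p) * (norm n * norm m / \<bar>n \<bullet> m\<bar>)" by (simp add: ac_simps)
    then have "norm (x - p) + norm (\<tau> *\<^sub>R m) \<le> norm (x - p) * a" by (simp add: a_def distrib_left)
    moreover have "norm (x - p) * a < min s r0" using xr a by (simp add: pos_less_divide_eq)
    moreover have "dist p ?y \<le> norm (x - p) + norm (\<tau> *\<^sub>R m)"
      using norm_triangle_ineq4[of "x - p" "\<tau> *\<^sub>R m"] by (simp add: dist_norm norm_minus_commute algebra_simps)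
    ultimately have d: "dist p ?y < min s r0" by linarith
    then have "?y \<in> P" using s(2) ny by auto
    then have "h ?y = 0" using P(3) d by (intro hfr) auto
    then have "h x = \<tau>" using h_line[of ?y \<tau>] by simp
    moreover have "x \<in> ball p r0" using x by (simp add: r_def)
    ultimately have "x \<in> \<Omega> \<longleftrightarrow> \<tau> < 0" using h\<Omega> by simp
    then show ?thesis unfolding \<tau>_def by (auto simp: divide_less_0_iff sgn_if)
  qed
  have "\<bar>sgn (n \<bullet> m)\<bar> = 1" using nm by (simp add: abs_sgn_eq)
  from that[OF pf r this key] show ?thesis .
qed

context bounded_open
begin

text \<open>A field \<open>\<psi> n\<close> supported near a planar piece of the boundary with normal \<open>n\<close> is normal to the
  boundary there; the integral in Green's formula is a sum of integrals of tangential derivatives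
  over a half-space.\<close>

lemma normal_field_Hcurl0:
  assumes \<psi>: "test_fun (ball p r) \<psi>"
    and loc: "\<And>x. x \<in> ball p r \<Longrightarrow> x \<in> \<Omega> \<longleftrightarrow> \<sigma> * (n \<bullet> (x - p)) < 0"
  shows "smooth_field (\<lambda>x. \<psi> x *\<^sub>R n)" "Hcurl0 \<Omega> (\<lambda>x. \<psi> x *\<^sub>R n) (curl (\<lambda>x. \<psi> x *\<^sub>R n))"
proof -
  let ?V = "\<lambda>x. \<psi> x *\<^sub>R n"
  note s\<psi> = test_fun_smooth[OF \<psi>]
  have Vi: "(\<lambda>x. ?V x $ i) = (\<lambda>x. n $ i * \<psi> x)" for i by (simp add: mult.commute)
  show sV: "smooth_field ?V" unfolding smooth_field_def Vi by (intro allI smooth_cmult s\<psi>)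
  define H where "H = {x. \<sigma> * (n \<bullet> (x - p)) < 0}"
  have oH: "open H" unfolding H_def by (intro open_Collect_less continuous_intros)
  have zero: "(LINT x|M. d \<bullet> grad (\<lambda>x. \<psi> x * f x) x) = 0" "integrable M (\<lambda>x. d \<bullet> grad (\<lambda>x. \<psi> x * f x) x)"
    if f: "smooth f" and d: "n \<bullet> d = 0" for f d
  proof -
    let ?q = "\<lambda>x. \<psi> x * f x"
    have tq: "test_fun (ball p r) ?q" by (rule test_fun_mult_right[OF \<psi> f])
    obtain K where K: "compact K" "K \<subseteq> ball p r" "\<And>x. x \<notin> K \<Longrightarrow> ?q x = 0" using tq unfolding test_fun_iff by blast
    have g0: "d \<bullet> grad ?q x = 0" if "x \<notin> ball p r" for x
    proof -
      have "pd i ?q x = 0" for i using test_fun_pd[OF tq, of i] that unfolding test_fun_iff by blast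
      then show ?thesis by (simp add: grad_def inner_vec_def)
    qed
    \<comment> \<open>The integrand vanishes off the ball, where \<Omega> and the half-space agree,
      so \<Omega> may be replaced by the half-space, which is invariant under tangential
      translations.\<close>
    have \<Omega>H: "\<Omega> \<inter> ball p r = H \<inter> ball p r" using loc by (auto simp: H_def)
    have sets: "\<Omega> \<inter> ball p r \<in> sets lebesgue" "H \<in> sets lebesgue"
      using oH open_Omega by (auto intro!: borel_open)
    have "(LINT x|M. d \<bullet> grad ?q x) = (LINT x|lebesgue_on (\<Omega> \<inter> ball p r). d \<bullet> grad ?q x)"
      by (rule integral_lebesgue_on_superset[OF sets(1) Omega_sets]) (auto intro: g0)
    also have "\<dots> = (LINT x|lebesgue_on H. d \<bullet> grad ?q x)"
      by (rule integral_lebesgue_on_superset[OF sets, symmetric]) (use \<Omega>H in \<open>auto intro: g0\<close>)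
    also have "\<dots> = 0"
    proof (rule integral_directional_derivative_zero[OF _ _ smooth_mult[OF s\<psi> f] K(1,3)])
      show "H \<in> sets borel" using oH by (rule borel_open)
      show "x + t *\<^sub>R d \<in> H \<longleftrightarrow> x \<in> H" for x t
        using d by (simp add: H_def inner_add_right inner_diff_right)
    qed
    finally show "(LINT x|M. d \<bullet> grad ?q x) = 0" .
    have "sq_int M (\<lambda>x. d)" by (intro continuous_sq_int continuous_intros bounded_Omega open_Omega)
    then show "integrable M (\<lambda>x. d \<bullet> grad ?q x)"
      by (intro sq_int_inner_integrable smooth_grad_sq_int smooth_mult s\<psi> f)
  qed
  show "Hcurl0 \<Omega> ?V (curl ?V)"
    unfolding Hcurl0_iff
  proof (intro conjI allI impI smooth_field_sq_int[OF sV])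
    fix \<phi> assume \<phi>: "smooth_field \<phi>"
    note s\<phi> = smooth_fieldD[OF \<phi>]
    \<comment> \<open>The cross products of the coordinate vectors with \<open>n\<close>; they are
      tangential and make the integrand of Green's formula a sum of tangential derivatives.\<close>
    define d1 d2 d3 :: "real^3" where "d1 = vector [0, - n $ 3, n $ 2]" and "d2 = vector [n $ 3, 0, - n $ 1]"
      and "d3 = vector [- n $ 2, n $ 1, 0]"
    have dn: "n \<bullet> d1 = 0" "n \<bullet> d2 = 0" "n \<bullet> d3 = 0"
      by (simp_all add: d1_def d2_def d3_def inner_vec_def sum_3 vector_3)
    have pV: "pd j (\<lambda>y. ?V y $ i) x = n $ i * pd j \<psi> x" for i j x
      unfolding Vi by (simp add: pd_cmult[OF s\<psi>])
    have pt: "?V x \<bullet> curl \<phi> x - curl ?V x \<bullet> \<phi> x = d1 \<bullet> grad (\<lambda>x. \<psi> x * \<phi> x $ 1) x +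
        d2 \<bullet> grad (\<lambda>x. \<psi> x * \<phi> x $ 2) x + d3 \<bullet> grad (\<lambda>x. \<psi> x * \<phi> x $ 3) x" for x
      unfolding inner_vec_def sum_3 curl_components pV grad_component pd_smooth_mult[OF s\<psi> s\<phi>]
        d1_def d2_def d3_def vector_3 by (simp add: algebra_simps)
    have "ip M ?V (curl \<phi>) - ip M (curl ?V) \<phi> = (LINT x|M. ?V x \<bullet> curl \<phi> x - curl ?V x \<bullet> \<phi> x)"
      unfolding ip_def using smooth_field_sq_int[OF sV] smooth_field_sq_int[OF \<phi>]
      by (intro Bochner_Integration.integral_diff[symmetric] sq_int_inner_integrable)
    also have "\<dots> = 0"
      unfolding pt using zero[OF s\<phi> dn(1)] zero[OF s\<phi> dn(2)] zero[OF s\<phi> dn(3)] by simp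
    finally show "ip M ?V (curl \<phi>) = ip M (curl ?V) \<phi>" by simp
  qed
qed

text \<open>Only the zero trace of \<open>w\<close> is available, so one derivative is moved.
  Passing from the Laplacian to the gradient is the Dirichlet half of the zero Cauchy data.\<close>

lemma H10_laplacian:
  assumes w: "H10 \<Omega> w K" and \<psi>: "smooth \<psi>"
  shows "ip M w (laplacian \<psi>) = - ip M K (grad \<psi>)"
proof -
  have "ip M w (laplacian \<psi>) = (\<Sum>i\<in>UNIV. ip M w (pd i (pd i \<psi>)))"
    unfolding laplacian_def[abs_def]
    by (rule ip_sum_right) (intro smooth_sq_int smooth_pd \<psi> H10_sq_int[OF w])+
  also have "\<dots> = (\<Sum>i\<in>UNIV. - ip M (\<lambda>x. K x $ i) (pd i \<psi>))"
    using H10_by_parts[OF w smooth_pd[OF \<psi>]] by simp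
  also have "\<dots> = - ip M K (grad \<psi>)"
    by (simp add: ip_vec_sum H10_sq_int[OF w] smooth_grad_sq_int[OF \<psi>] grad_component sum_negf)
  finally show ?thesis .
qed

lemma smooth_field_div:
  assumes V: "smooth_field V" and P: "H10 \<Omega> Q H"
  shows "ip M V H = - ip M (div_of (jacobian V)) Q"
proof -
  note Qs = H10_sq_int[OF P]
  have "ip M V H = (\<Sum>i\<in>UNIV. ip M (\<lambda>x. H x $ i) (\<lambda>x. V x $ i))"
    unfolding ip_vec_sum[OF smooth_field_sq_int(3)[OF V] Qs(2)] by (intro sum.cong refl ip_commute)
  also have "\<dots> = (\<Sum>i\<in>UNIV. - ip M Q (pd i (\<lambda>y. V y $ i)))"
    by (intro sum.cong refl H10_by_parts[OF P] smooth_fieldD V)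
  also have "\<dots> = - ip M Q (div_of (jacobian V))"
    unfolding div_of_def jacobian_component sum_3
    by (simp add: ip_add_right Qs smooth_sq_int smooth_pd smooth_add smooth_fieldD[OF V])
  finally show ?thesis by (simp add: ip_commute)
qed

text \<open>The extension by zero vanishes on the outer side of the planar piece and solves the
  equation across it, so continuation carries vanishing from outside into \<Omega>.\<close>

lemma vanishes_from_half_ball:
  assumes conn: "connected \<Omega>" and w: "sq_int M w" and \<mu>: "\<mu> \<ge> 0"
    and p: "p \<in> frontier \<Omega>" and r: "r > 0" and \<sigma>: "\<bar>\<sigma>\<bar> = 1" and n: "n \<noteq> 0"
    and loc: "\<And>x. x \<in> ball p r \<Longrightarrow> x \<in> \<Omega> \<longleftrightarrow> \<sigma> * (n \<bullet> (x - p)) < 0"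
    and H: "weak_Helmholtz \<mu> \<Omega> w" "weak_Helmholtz \<mu> (ball p r) w" and x: "x \<in> \<Omega>"
  shows "vanishes_near w x"
proof -
  define R where "R = min 1 (r/2)"
  have R: "0 < R" "R \<le> 1" "R \<le> r/2" using r by (auto simp: R_def)
  define c where "c = R / (16 * exp 1 * (23 + \<mu>))"
  have "1 * 1 * 1 \<le> 16 * exp 1 * (23 + \<mu>)" using \<mu> by (intro mult_mono) auto
  then have c: "0 < c" "c \<le> R" using R \<mu> by (auto simp: c_def divide_le_eq)
  define \<tau> where "\<tau> = c / (2 * norm n)"
  have \<tau>: "\<tau> > 0" using c n by (simp add: \<tau>_def)
  \<comment> \<open>A point outside \<Omega> on the normal through \<open>p\<close>, at distance
    \<open>c/2\<close>: close enough for one continuation step to reach \<open>p\<close>.\<close>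
  define q where "q = p + (\<sigma> * \<tau>) *\<^sub>R n"
  have dq: "dist q p = c/2" using n \<sigma> \<tau> by (simp add: q_def dist_norm abs_mult) (simp add: \<tau>_def)
  let ?U = "ball p r \<inter> {x. 0 < \<sigma> * (n \<bullet> (x - p))}"
  have "open ?U" by (intro open_Int open_ball open_Collect_less continuous_intros)
  moreover have "q \<in> ?U"
  proof -
    have "\<sigma> * \<sigma> = 1" using \<sigma> by (metis abs_mult_self_eq mult_1)
    then have "\<sigma> * (n \<bullet> (q - p)) = \<tau> * (n \<bullet> n)" by (simp add: q_def mult.assoc[symmetric])
    then show ?thesis using dq c R r \<tau> n by (simp add: dist_commute)
  qed
  ultimately obtain e where e: "e > 0" "ball q e \<subseteq> ?U" using open_contains_ball by blast
  have "vanishes_near w q"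
    unfolding vanishes_near_def
  proof (intro exI[of _ e] conjI allI impI)
    show "e > 0" by fact
    fix \<psi> assume \<psi>: "test_fun (ball q e) \<psi>"
    have "\<psi> x = 0" if "x \<in> \<Omega>" for x
    proof -
      have "x \<notin> ball q e" using e(2) loc[of x] that by force
      then show ?thesis using \<psi> unfolding test_fun_iff by blast
    qed
    then have "ip M w \<psi> = ip M w (\<lambda>x. 0)"
      unfolding ip_def by (intro Bochner_Integration.integral_cong) auto
    then show "ip M w \<psi> = 0" by simp
  qed
  moreover have "weak_Helmholtz \<mu> (ball q R) w"
    using dq c R by (intro weak_Helmholtz_mono[OF H(2)] ball_subset_ball_iff[THEN iffD2] disjI1) simp
  moreover have "dist q p < c" using dq c by simp
  ultimately have "vanishes_near w p"
    using continuation_ball[OF w \<mu> R(1,2)] unfolding c_def by blast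
  \<comment> \<open>Vanishing near \<open>p\<close> includes a neighbourhood, which meets \<Omega>
    because \<open>p\<close> is a frontier point; from there the interior theorem takes
    over.\<close>
  then obtain d where d: "d > 0" "\<forall>y\<in>ball p d. vanishes_near w y" using vanishes_near_open by blast
  have "p \<in> closure \<Omega>" using p by (simp add: frontier_def)
  then obtain x0 where "x0 \<in> \<Omega>" "dist x0 p < d" using d(1) unfolding closure_approachable by blast
  then show ?thesis using unique_continuation[OF conn w \<mu> H(1) _ _ x, of x0] d(2) by (simp add: dist_commute)
qed

end

context eigen_data
begin

text \<open>Equality yields a critical field of the Hodge energy. Variations normal to a planar
  piece are admissible although they are nonzero on the boundary, which adds a Neumann condition to
  the Dirichlet condition for the normal component. That component vanishes in \<Omega>, and three
  independent normals leave no field.\<close>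

theorem alpha_less_lam_planar:
  assumes lip: "lipschitz_domain \<Omega>" and conn: "connected \<Omega>" and k: "k \<ge> 1"
    and pieces: "three_planar_pieces \<Omega>"
  shows "alpha (2 * k + 1) < lam k"
proof (rule ccontr)
  assume "\<not> ?thesis"
  then have ge: "lam k \<le> alpha (2 * k + 1)" by simp
  from equality_case[OF k ge] obtain b P G where b: "\<exists>j\<in>{1..k}. b j \<noteq> 0" "\<forall>j\<in>{1..k}. lam j \<noteq> lam k \<longrightarrow> b j = 0"
    and P: "H10 \<Omega> P G" and DP: "AE x in M. div_of (comb_grad k b) x = - lam k * P x"
    and wP: "\<forall>Q H. H10 \<Omega> Q H \<longrightarrow> ip M G H = lam k * ip M P Q"
    and z: "Hdiv0 \<Omega> (\<lambda>x. comb k b x - G x)" "Hcurl0 \<Omega> (\<lambda>x. comb k b x - G x) (curl_of (comb_grad k b))"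
    and wz: "\<forall>y \<zeta>. Hdiv0 \<Omega> y \<longrightarrow> Hcurl0 \<Omega> y \<zeta> \<longrightarrow>
      ip M (curl_of (comb_grad k b)) \<zeta> = lam k * ip M (\<lambda>x. comb k b x - G x) y" by blast
  note Ps = H10_sq_int[OF P]
  let ?F = "comb k b" and ?J = "comb_grad k b"
  note cs = comb_sq_int[of k b]
  \<comment> \<open>Split \<open>V\<close> into a divergence free part and a gradient:
    \<open>wz\<close> treats the curl term and \<open>DP\<close> the divergence term. The Hodge
    identity then rewrites the sum as the component-wise Dirichlet form.\<close>
  have crit: "(\<Sum>i\<in>UNIV. ip M (\<lambda>x. ?J x $ i) (grad (\<lambda>y. V y $ i))) = lam k * ip M ?F V"
    if V: "smooth_field V" "Hcurl0 \<Omega> V (curl V)" for V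
  proof -
    note Vs = smooth_field_sq_int[OF V(1)]
    obtain Q H where Q: "H10 \<Omega> Q H" and orth: "\<And>R S. H10 \<Omega> R S \<Longrightarrow> ip M (\<lambda>x. V x - H x) S = 0"
      using Helmholtz_decomposition[OF Vs(3)] by blast
    note Qs = H10_sq_int[OF Q]
    let ?y = "\<lambda>x. V x - H x" and ?z = "\<lambda>x. ?F x - G x"
    have y: "Hdiv0 \<Omega> ?y" "Hcurl0 \<Omega> ?y (curl V)"
      using orth Hcurl0_diff[OF V(2) gradient_Hcurl0[OF Q]] Vs Qs by (auto simp: Hdiv0_iff intro: sq_int_diff)
    have 1: "ip M (curl_of ?J) (curl V) = lam k * ip M ?z ?y" using wz y by blast
    have "ip M (div_of ?J) (div_of (jacobian V)) = ip M (\<lambda>x. - lam k * P x) (div_of (jacobian V))"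
      using DP by (intro ip_cong_AE cs Vs sq_int_mult Ps) auto
    also have "\<dots> = - lam k * ip M P (div_of (jacobian V))" by (rule ip_mult_left)
    also have "\<dots> = lam k * ip M V G"
      using smooth_field_div[OF V(1) P] by (simp add: ip_commute[of M P])
    finally have 2: "ip M (div_of ?J) (div_of (jacobian V)) = lam k * ip M V G" .
    have "ip M ?y G = 0" using orth[OF P] .
    moreover have "ip M ?z H = 0" using z(1) Q by (auto simp: Hdiv0_iff)
    ultimately have "ip M V G = ip M H G" "ip M ?F H = ip M G H"
      by (simp_all add: ip_diff_left Vs Qs Ps cs)
    moreover have "ip M ?z ?y = ip M ?F V - ip M ?F H - (ip M G V - ip M G H)"
      by (simp add: ip_diff_left ip_diff_right Vs Qs Ps cs sq_int_diff)
    ultimately have "ip M ?F V = ip M ?z ?y + ip M V G"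
      using ip_commute[of M G V] ip_commute[of M H G] by linarith
    then show ?thesis using Hodge_identity_smooth[OF comb_H10 V(1), of k b] 1 2 by (simp add: distrib_left)
  qed
  have bn: "b j \<bullet> n = 0" if pl: "planar_piece \<Omega> n S" and j: "j \<in> {1..k}" for n S j
  proof -
    obtain p r \<sigma> where p: "p \<in> frontier \<Omega>" "r > 0" "\<bar>\<sigma>\<bar> = 1"
      and loc: "\<And>x. x \<in> ball p r \<Longrightarrow> x \<in> \<Omega> \<longleftrightarrow> \<sigma> * (n \<bullet> (x - p)) < 0"
      using planar_piece_half_ball[OF lip pl] by blast
    have n: "n \<noteq> 0" using pl by (simp add: planar_piece_def)
    \<comment> \<open>The component of the critical field along the normal of the piece.\<close>
    define w where "w x = (\<Sum>j\<in>{1..k}. (b j \<bullet> n) * \<phi> j x)" for x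
    define K where "K x = (\<Sum>j\<in>{1..k}. (b j \<bullet> n) *\<^sub>R g j x)" for x
    have wK: "H10 \<Omega> w K" unfolding w_def[abs_def] K_def[abs_def] by (intro H10_sum H10_cmult phi_H10) auto
    note ws = H10_sq_int[OF wK]
    have wF: "w x = ?F x \<bullet> n" for x by (simp add: w_def comb_def inner_sum_left mult.commute)
    have KJ: "K x = (\<Sum>i\<in>UNIV. n $ i *\<^sub>R ?J x $ i)" for x
      unfolding K_def comb_grad_def inner_vec_def
      by (simp add: scaleR_sum_left scaleR_sum_right mult.commute sum.swap[of _ UNIV])
    have helm: "ip M w (\<lambda>x. laplacian \<psi> x + lam k * \<psi> x) = 0"
      if "smooth \<psi>" "ip M K (grad \<psi>) = lam k * ip M w \<psi>" for \<psi>
      using H10_laplacian[OF wK that(1)] that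
      by (subst ip_add_right) (auto intro!: smooth_sq_int smooth_laplacian smooth_cmult ws simp: ip_mult_right)
    have "weak_Helmholtz (lam k) \<Omega> w"
      unfolding weak_Helmholtz_def
    proof (intro allI impI helm)
      fix \<psi> assume \<psi>: "test_fun \<Omega> \<psi>"
      then show "smooth \<psi>" by (rule test_fun_smooth)
      have gs: "sq_int M (grad \<psi>)" and ps: "sq_int M \<psi>"
        using test_fun_smooth[OF \<psi>] smooth_sq_int smooth_grad_sq_int by blast+
      have "ip M K (grad \<psi>) = (\<Sum>j\<in>{1..k}. (b j \<bullet> n) * ip M (g j) (grad \<psi>))"
        unfolding K_def by (subst ip_sum_left) (auto intro!: sq_int_scaleR g_sq_int gs simp: ip_scaleR_left)
      also have "\<dots> = (\<Sum>j\<in>{1..k}. lam k * ((b j \<bullet> n) * ip M (\<phi> j) \<psi>))"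
      proof (intro sum.cong refl)
        fix j assume j: "j \<in> {1..k}"
        then have "ip M (g j) (grad \<psi>) = lam j * ip M (\<phi> j) \<psi>" using phi_weak[OF _ test_fun_H10[OF \<psi>]] by simp
        then show "b j \<bullet> n * ip M (g j) (grad \<psi>) = lam k * (b j \<bullet> n * ip M (\<phi> j) \<psi>)" using b(2) j by (cases "lam j = lam k") auto
      qed
      also have "\<dots> = lam k * ip M w \<psi>"
        unfolding w_def by (subst ip_sum_left) (auto intro!: sq_int_mult phi_sq_int ps simp: ip_mult_left sum_distrib_left)
      finally show "ip M K (grad \<psi>) = lam k * ip M w \<psi>" .
    qed
    \<comment> \<open>Here \<open>\<psi>\<close> may be nonzero on the planar piece. Testing
      criticality with the normal field \<open>\<psi> x *\<^sub>R n\<close> supplies the Neumann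
      condition in weak form.\<close>
    moreover have "weak_Helmholtz (lam k) (ball p r) w"
      unfolding weak_Helmholtz_def
    proof (intro allI impI helm)
      fix \<psi> assume \<psi>: "test_fun (ball p r) \<psi>"
      then show s: "smooth \<psi>" by (rule test_fun_smooth)
      let ?V = "\<lambda>x. \<psi> x *\<^sub>R n"
      have V: "smooth_field ?V" "Hcurl0 \<Omega> ?V (curl ?V)" using normal_field_Hcurl0[OF \<psi> loc] by blast+
      have Js: "sq_int M (\<lambda>x. ?J x $ i)" for i by (intro sq_int_vec cs)
      have "grad (\<lambda>y. ?V y $ i) = (\<lambda>x. n $ i *\<^sub>R grad \<psi> x)" for i
        using grad_cmult[OF s, of "n $ i"] by (simp add: mult.commute)
      then have "(\<Sum>i\<in>UNIV. n $ i * ip M (\<lambda>x. ?J x $ i) (grad \<psi>)) = lam k * ip M ?F ?V"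
        using crit[OF V] by (simp add: ip_scaleR_right)
      moreover have "(\<Sum>i\<in>UNIV. n $ i * ip M (\<lambda>x. ?J x $ i) (grad \<psi>)) = ip M K (grad \<psi>)"
        unfolding KJ by (subst ip_sum_left) (auto intro!: sq_int_scaleR Js smooth_grad_sq_int s simp: ip_scaleR_left)
      moreover have "ip M ?F ?V = ip M w \<psi>" unfolding ip_def wF by (simp add: mult.commute)
      ultimately show "ip M K (grad \<psi>) = lam k * ip M w \<psi>" by simp
    qed
    ultimately have "vanishes_near w x" if "x \<in> \<Omega>" for x
      using vanishes_from_half_ball[OF conn ws(1) less_imp_le[OF lam_pos[OF k]] p n loc _ _ that] by blast
    then have "AE x in M. w x = 0" by (intro H10_zero_of_vanishing[OF wK] vanishes_everywhere[OF ws(1)])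
    \<comment> \<open>Orthonormality of the eigenfunctions reads off each coefficient
      \<open>b j \<bullet> n\<close> of the vanishing function.\<close>
    then have "ip M w (\<phi> j) = ip M (\<lambda>x. 0) (\<phi> j)"
      using j by (intro ip_cong_AE ws sq_int_zero phi_sq_int) auto
    moreover have "ip M w (\<phi> j) = b j \<bullet> n"
    proof -
      have "ip M w (\<phi> j) = (\<Sum>l\<in>{1..k}. (b l \<bullet> n) * ip M (\<phi> l) (\<phi> j))"
        unfolding w_def using j by (subst ip_sum_left) (auto intro!: sq_int_mult phi_sq_int simp: ip_mult_left)
      also have "\<dots> = (\<Sum>l\<in>{1..k}. if l = j then b j \<bullet> n else 0)"
        using phi_on j by (intro sum.cong) auto
      finally show ?thesis using j by simp
    qed
    ultimately show ?thesis by simp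
  qed
  obtain P1 P2 P3 n1 n2 n3 where pl: "planar_piece \<Omega> n1 P1" "planar_piece \<Omega> n2 P2" "planar_piece \<Omega> n3 P3"
    and ind: "card {n1, n2, n3} = 3" "independent {n1, n2, n3}"
    using pieces unfolding three_planar_pieces_def by blast
  have "dim {n1, n2, n3} = DIM(real^3)" using dim_eq_card_independent[OF ind(2)] ind(1) by simp
  then have sp: "span {n1, n2, n3} = UNIV" by (simp only: dim_eq_full)
  have "b j = 0" if "j \<in> {1..k}" for j
  proof -
    have o: "orthogonal (b j) y" if "y \<in> {n1, n2, n3}" for y
      using that bn[OF pl(1) \<open>j \<in> {1..k}\<close>] bn[OF pl(2) \<open>j \<in> {1..k}\<close>] bn[OF pl(3) \<open>j \<in> {1..k}\<close>]
      by (auto simp: orthogonal_def)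
    have "b j \<in> span {n1, n2, n3}" unfolding sp by simp
    from orthogonal_to_span[OF this o] show ?thesis by (simp add: orthogonal_def)
  qed
  with b(1) show False by blast
qed

end

theorem theorem3p1:
  fixes \<Omega> :: "(real^3) set" and lam alpha :: "nat \<Rightarrow> real"
  assumes "lipschitz_domain \<Omega>" and "connected \<Omega>"
    and "dirichlet_eigenvalues \<Omega> lam"
    and "curlcurl_eigenvalues \<Omega> alpha"
  shows "(\<forall>k\<ge>1. alpha (2 * k + 1) \<le> lam k) \<and>
         (\<forall>k\<ge>1. (card {j. 1 \<le> j \<and> lam j = lam k} = 1 \<or> three_planar_pieces \<Omega>)
                  \<longrightarrow> alpha (2 * k + 1) < lam k)"
proof -
  interpret bounded_open \<Omega>
    using assms(1) by unfold_locales (auto simp: lipschitz_domain_def)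
  obtain \<phi> where lam: "\<forall>j k. 1 \<le> j \<longrightarrow> j \<le> k \<longrightarrow> lam j \<le> lam k" and \<phi>: "\<forall>k\<ge>1. dir_eigenpair \<Omega> (lam k) (\<phi> k)"
    "\<forall>j\<ge>1. \<forall>k\<ge>1. ip M (\<phi> j) (\<phi> k) = (if j = k then 1 else 0)"
    "\<forall>f. sq_int M f \<and> (\<forall>k\<ge>1. ip M f (\<phi> k) = 0) \<longrightarrow> (AE x in M. f x = 0)"
    using assms(3) unfolding dirichlet_eigenvalues_def L2_iff_sq_int by (auto simp: ip_def)
  obtain u where alpha: "\<forall>j k. 1 \<le> j \<longrightarrow> j \<le> k \<longrightarrow> alpha j \<le> alpha k" and u: "\<forall>k\<ge>1. curl_eigenpair \<Omega> (alpha k) (u k)"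
    "\<forall>j\<ge>1. \<forall>k\<ge>1. ip M (u j) (u k) = (if j = k then 1 else 0)"
    "\<forall>f. Hdiv0 \<Omega> f \<and> (\<forall>k\<ge>1. ip M f (u k) = 0) \<longrightarrow> (AE x in M. f x = 0)"
    using assms(4) unfolding curlcurl_eigenvalues_def ip_def by blast
  have "\<forall>k. \<exists>G. k \<ge> 1 \<longrightarrow> H10 \<Omega> (\<phi> k) G \<and> (\<forall>\<psi> H. H10 \<Omega> \<psi> H \<longrightarrow> ip M G H = lam k * ip M (\<phi> k) \<psi>)"
    using \<phi>(1) unfolding dir_eigenpair_def by (auto simp: ip_def)
  from choice[OF this] obtain g where g: "\<forall>k. k \<ge> 1 \<longrightarrow> H10 \<Omega> (\<phi> k) (g k) \<and>
      (\<forall>\<psi> H. H10 \<Omega> \<psi> H \<longrightarrow> ip M (g k) H = lam k * ip M (\<phi> k) \<psi>)" by blast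
  have "\<forall>k. \<exists>w. k \<ge> 1 \<longrightarrow> Hdiv0 \<Omega> (u k) \<and> Hcurl0 \<Omega> (u k) w \<and>
      (\<forall>v z. Hdiv0 \<Omega> v \<and> Hcurl0 \<Omega> v z \<longrightarrow> ip M w z = alpha k * ip M (u k) v)"
    using u(1) unfolding curl_eigenpair_def ip_def by blast
  from choice[OF this] obtain w where w: "\<forall>k. k \<ge> 1 \<longrightarrow> Hdiv0 \<Omega> (u k) \<and> Hcurl0 \<Omega> (u k) (w k) \<and>
      (\<forall>v z. Hdiv0 \<Omega> v \<and> Hcurl0 \<Omega> v z \<longrightarrow> ip M (w k) z = alpha k * ip M (u k) v)" by blast
  interpret eigen_data \<Omega> lam alpha \<phi> g u w
  proof unfold_locales
    show "lam j \<le> lam k" if "1 \<le> j" "j \<le> k" for j k using lam that by blast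
    show "alpha j \<le> alpha k" if "1 \<le> j" "j \<le> k" for j k using alpha that by blast
    show "H10 \<Omega> (\<phi> j) (g j)" if "1 \<le> j" for j using g that by blast
    show "ip M (g j) H = lam j * ip M (\<phi> j) \<psi>" if "1 \<le> j" "H10 \<Omega> \<psi> H" for j \<psi> H using g that by blast
    show "ip M (\<phi> i) (\<phi> j) = (if i = j then 1 else 0)" if "1 \<le> i" "1 \<le> j" for i j using \<phi>(2) that by blast
    show "AE x in M. f x = 0" if "sq_int M f" "\<And>j. 1 \<le> j \<Longrightarrow> ip M f (\<phi> j) = 0" for f using \<phi>(3) that by blast
    show "Hdiv0 \<Omega> (u j)" if "1 \<le> j" for j using w that by blast
    show "Hcurl0 \<Omega> (u j) (w j)" if "1 \<le> j" for j using w that by blast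
    show "ip M (w j) z = alpha j * ip M (u j) v" if "1 \<le> j" "Hdiv0 \<Omega> v" "Hcurl0 \<Omega> v z" for j v z using w that by blast
    show "ip M (u i) (u j) = (if i = j then 1 else 0)" if "1 \<le> i" "1 \<le> j" for i j using u(2) that by blast
    show "AE x in M. v x = 0" if "Hdiv0 \<Omega> v" "\<And>j. 1 \<le> j \<Longrightarrow> ip M v (u j) = 0" for v using u(3) that by blast
  qed
  show ?thesis
    using alpha_le_lam alpha_less_lam_simple alpha_less_lam_planar[OF assms(1,2)] by blast
qed

end
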